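(* Let $G$ and $H$ be locally compact abelian groups. Then the following are equivalent: (i) $BM(G,H)$ is a contractive Banach algebra; (ii) $M(G\times H)$ is a contractive Banach algebra; (iii) $G$ and $H$ are finite groups.
   Context: Bimeasures: for locally compact groups $G,H$, $BM(G,H)=(C_0(G)\hat\otimes C_0(H))^*$ (dual of the projective tensor product), equivalently the Banach space of bounded bilinear forms $u(f,g)$ on $C_0(G)\times C_0(H)$ with its usual norm. $M(G\times H)=C_0(G\times H)^*$ is the measure algebra with convolution product; each $\mu\in M(G\times H)$ is regarded as the bimeasure $(f,g)\mapsto\int f(x)g(y)\,d\mu(x,y)$. Convolution: by Grothendieck's inequality, for each $u\in BM(G,H)$ there are Borel probability measures $\mu$ on $G$ and $\nu$ on $H$ such that $u$ extends to a bounded bilinear form on $L^2(\mu)\times L^2(\nu)$. For $u_1,u_2\in BM(G,H)$ with associated pairs $(\mu_1,\nu_1),(\mu_2,\nu_2)$, let $u_1\otimes u_2$ be the bounded bilinear form on $L^2(G\times G,\mu_1\times\mu_2)\times L^2(H\times H,\nu_1\times\nu_2)$ determined by $(u_1\otimes u_2)(f_1\otimes f_2,g_1\otimes g_2)=u_1(f_1,g_1)u_2(f_2,g_2)$, and put $(u_1\star u_2)(f,g)=(u_1\otimes u_2)(Mf,Mg)$, where $(Mf)(x_1,x_2)=f(x_1x_2)$ and similarly for $g$. This is independent of choices, extends convolution of measures in $M(G\times H)$, and satisfies $\|u\star v\|\le K_G^2\|u\|\|v\|$ ($K_G$ is Grothendieck's constant), so $BM(G,H)$ is a Banach algebra (up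 to an equivalent norm). A Banach algebra $A$ is contractive (also called contractible) if for every Banach $A$-bimodule $X$, every continuous derivation $D:A\to X$ (i.e. $D(ab)=D(a)b+aD(b)$) is inner, i.e. of the form $a\mapsto a\cdot x-x\cdot a$ for some $x\in X$. *)

theory Defs
  imports "HOL-Probability.Probability"
begin

section \<open>Complex Banach spaces, algebras and bimodules with explicit carriers\<close>

record 'a cnormed =
  carr :: "'a set"
  zer  :: "'a"            (\<open>\<zero>\<index>\<close>)
  pls  :: "'a \<Rightarrow> 'a \<Rightarrow> 'a"  (infixl \<open>\<oplus>\<index>\<close> 65)
  scl  :: "complex \<Rightarrow> 'a \<Rightarrow> 'a"  (infixr \<open>\<odot>\<index>\<close> 75)
  nrm  :: "'a \<Rightarrow> real"

record 'a calg = "'a cnormed" +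
  tms  :: "'a \<Rightarrow> 'a \<Rightarrow> 'a"  (infixl \<open>\<otimes>\<index>\<close> 70)

definition mns :: "('a, 'z) cnormed_scheme \<Rightarrow> 'a \<Rightarrow> 'a \<Rightarrow> 'a" (infixl \<open>\<ominus>\<index>\<close> 65)
  where "x \<ominus>\<^bsub>X\<^esub> y = x \<oplus>\<^bsub>X\<^esub> (- 1) \<odot>\<^bsub>X\<^esub> y"

locale complex_normed =
  fixes X :: "('x, 'z) cnormed_scheme"  (structure)
  assumes zero_closed: "\<zero> \<in> carr X"
    and add_closed: "x \<in> carr X \<Longrightarrow> y \<in> carr X \<Longrightarrow> x \<oplus> y \<in> carr X"
    and scale_closed: "x \<in> carr X \<Longrightarrow> c \<odot> x \<in> carr X"
    and add_assoc: "x \<in> carr X \<Longrightarrow> y \<in> carr X \<Longrightarrow> z \<in> carr X \<Longrightarrow> (x \<oplus> y) \<oplus> z = x \<oplus> (y \<oplus> z)"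
    and add_commute: "x \<in> carr X \<Longrightarrow> y \<in> carr X \<Longrightarrow> x \<oplus> y = y \<oplus> x"
    and add_zero: "x \<in> carr X \<Longrightarrow> \<zero> \<oplus> x = x"
    and minus_self: "x \<in> carr X \<Longrightarrow> x \<ominus> x = \<zero>"
    and scale_one: "x \<in> carr X \<Longrightarrow> 1 \<odot> x = x"
    and scale_scale: "x \<in> carr X \<Longrightarrow> a \<odot> b \<odot> x = (a * b) \<odot> x"
    and scale_add_right: "x \<in> carr X \<Longrightarrow> y \<in> carr X \<Longrightarrow> a \<odot> (x \<oplus> y) = a \<odot> x \<oplus> a \<odot> y"
    and scale_add_left: "x \<in> carr X \<Longrightarrow> (a + b) \<odot> x = a \<odot> x \<oplus> b \<odot> x"
    and norm_nonneg: "x \<in> carr X \<Longrightarrow> 0 \<le> nrm X x"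
    and norm_eq_zero: "x \<in> carr X \<Longrightarrow> nrm X x = 0 \<longleftrightarrow> x = \<zero>"
    and norm_triangle: "x \<in> carr X \<Longrightarrow> y \<in> carr X \<Longrightarrow> nrm X (x \<oplus> y) \<le> nrm X x + nrm X y"
    and norm_scale: "x \<in> carr X \<Longrightarrow> nrm X (a \<odot> x) = cmod a * nrm X x"

locale complex_banach = complex_normed +
  assumes complete: "(\<forall>n. s n \<in> carr X) \<Longrightarrow>
      (\<forall>e>0. \<exists>N. \<forall>m\<ge>N. \<forall>n\<ge>N. nrm X (s m \<ominus> s n) < e) \<Longrightarrow>
      \<exists>x\<in>carr X. (\<lambda>n. nrm X (s n \<ominus> x)) \<longlonglongrightarrow> 0"

text \<open>Neither a unit nor submultiplicativity of the given norm is required: multiplication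
  is only required to be jointly continuous, which is to say that \<open>A\<close> is a Banach algebra in
  the strict sense after passing to an equivalent norm.\<close>

locale banach_algebra = complex_banach A for A :: "('a, 'z) calg_scheme" (structure) +
  assumes mult_closed: "a \<in> carr A \<Longrightarrow> b \<in> carr A \<Longrightarrow> a \<otimes> b \<in> carr A"
    and mult_assoc: "a \<in> carr A \<Longrightarrow> b \<in> carr A \<Longrightarrow> c \<in> carr A \<Longrightarrow> (a \<otimes> b) \<otimes> c = a \<otimes> (b \<otimes> c)"
    and mult_add_left: "a \<in> carr A \<Longrightarrow> b \<in> carr A \<Longrightarrow> c \<in> carr A \<Longrightarrow> (a \<oplus> b) \<otimes> c = a \<otimes> c \<oplus> b \<otimes> c"
    and mult_add_right: "a \<in> carr A \<Longrightarrow> b \<in> carr A \<Longrightarrow> c \<in> carr A \<Longrightarrow> a \<otimes> (b \<oplus> c) = a \<otimes> b \<oplus> a \<otimes> c"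
    and mult_scale_left: "a \<in> carr A \<Longrightarrow> b \<in> carr A \<Longrightarrow> (k \<odot> a) \<otimes> b = k \<odot> (a \<otimes> b)"
    and mult_scale_right: "a \<in> carr A \<Longrightarrow> b \<in> carr A \<Longrightarrow> a \<otimes> (k \<odot> b) = k \<odot> (a \<otimes> b)"
    and mult_bounded: "\<exists>C. \<forall>a\<in>carr A. \<forall>b\<in>carr A. nrm A (a \<otimes> b) \<le> C * nrm A a * nrm A b"

locale banach_bimodule = A: banach_algebra A + X: complex_banach X
  for A :: "('a, 'z) calg_scheme" and X :: "('x, 'y) cnormed_scheme"
    and l :: "'a \<Rightarrow> 'x \<Rightarrow> 'x" and r :: "'x \<Rightarrow> 'a \<Rightarrow> 'x" +
  assumes l_closed: "a \<in> carr A \<Longrightarrow> x \<in> carr X \<Longrightarrow> l a x \<in> carr X"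
    and r_closed: "a \<in> carr A \<Longrightarrow> x \<in> carr X \<Longrightarrow> r x a \<in> carr X"
    and l_add: "a \<in> carr A \<Longrightarrow> x \<in> carr X \<Longrightarrow> y \<in> carr X \<Longrightarrow> l a (x \<oplus>\<^bsub>X\<^esub> y) = l a x \<oplus>\<^bsub>X\<^esub> l a y"
    and r_add: "a \<in> carr A \<Longrightarrow> x \<in> carr X \<Longrightarrow> y \<in> carr X \<Longrightarrow> r (x \<oplus>\<^bsub>X\<^esub> y) a = r x a \<oplus>\<^bsub>X\<^esub> r y a"
    and l_scale: "a \<in> carr A \<Longrightarrow> x \<in> carr X \<Longrightarrow> l a (k \<odot>\<^bsub>X\<^esub> x) = k \<odot>\<^bsub>X\<^esub> l a x"
    and r_scale: "a \<in> carr A \<Longrightarrow> x \<in> carr X \<Longrightarrow> r (k \<odot>\<^bsub>X\<^esub> x) a = k \<odot>\<^bsub>X\<^esub> r x a"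
    and add_l: "a \<in> carr A \<Longrightarrow> b \<in> carr A \<Longrightarrow> x \<in> carr X \<Longrightarrow> l (a \<oplus>\<^bsub>A\<^esub> b) x = l a x \<oplus>\<^bsub>X\<^esub> l b x"
    and add_r: "a \<in> carr A \<Longrightarrow> b \<in> carr A \<Longrightarrow> x \<in> carr X \<Longrightarrow> r x (a \<oplus>\<^bsub>A\<^esub> b) = r x a \<oplus>\<^bsub>X\<^esub> r x b"
    and scale_l: "a \<in> carr A \<Longrightarrow> x \<in> carr X \<Longrightarrow> l (k \<odot>\<^bsub>A\<^esub> a) x = k \<odot>\<^bsub>X\<^esub> l a x"
    and scale_r: "a \<in> carr A \<Longrightarrow> x \<in> carr X \<Longrightarrow> r x (k \<odot>\<^bsub>A\<^esub> a) = k \<odot>\<^bsub>X\<^esub> r x a"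
    and l_mult: "a \<in> carr A \<Longrightarrow> b \<in> carr A \<Longrightarrow> x \<in> carr X \<Longrightarrow> l (a \<otimes>\<^bsub>A\<^esub> b) x = l a (l b x)"
    and r_mult: "a \<in> carr A \<Longrightarrow> b \<in> carr A \<Longrightarrow> x \<in> carr X \<Longrightarrow> r x (a \<otimes>\<^bsub>A\<^esub> b) = r (r x a) b"
    and l_r: "a \<in> carr A \<Longrightarrow> b \<in> carr A \<Longrightarrow> x \<in> carr X \<Longrightarrow> r (l a x) b = l a (r x b)"
    and l_bounded: "\<exists>C. \<forall>a\<in>carr A. \<forall>x\<in>carr X. nrm X (l a x) \<le> C * nrm A a * nrm X x"
    and r_bounded: "\<exists>C. \<forall>a\<in>carr A. \<forall>x\<in>carr X. nrm X (r x a) \<le> C * nrm A a * nrm X x"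

definition continuous_derivation ::
  "('a, 'z) calg_scheme \<Rightarrow> ('x, 'y) cnormed_scheme \<Rightarrow> ('a \<Rightarrow> 'x \<Rightarrow> 'x) \<Rightarrow> ('x \<Rightarrow> 'a \<Rightarrow> 'x)
    \<Rightarrow> ('a \<Rightarrow> 'x) \<Rightarrow> bool"
  where "continuous_derivation A X l r D \<longleftrightarrow>
    (\<forall>a\<in>carr A. D a \<in> carr X) \<and>
    (\<forall>a\<in>carr A. \<forall>b\<in>carr A. D (a \<oplus>\<^bsub>A\<^esub> b) = D a \<oplus>\<^bsub>X\<^esub> D b) \<and>
    (\<forall>k. \<forall>a\<in>carr A. D (k \<odot>\<^bsub>A\<^esub> a) = k \<odot>\<^bsub>X\<^esub> D a) \<and>
    (\<exists>C. \<forall>a\<in>carr A. nrm X (D a) \<le> C * nrm A a) \<and>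
    (\<forall>a\<in>carr A. \<forall>b\<in>carr A. D (a \<otimes>\<^bsub>A\<^esub> b) = r (D a) b \<oplus>\<^bsub>X\<^esub> l a (D b))"

definition inner_derivation ::
  "('a, 'z) calg_scheme \<Rightarrow> ('x, 'y) cnormed_scheme \<Rightarrow> ('a \<Rightarrow> 'x \<Rightarrow> 'x) \<Rightarrow> ('x \<Rightarrow> 'a \<Rightarrow> 'x)
    \<Rightarrow> ('a \<Rightarrow> 'x) \<Rightarrow> bool"
  where "inner_derivation A X l r D \<longleftrightarrow>
    (\<exists>x\<in>carr X. \<forall>a\<in>carr A. D a = l a x \<ominus>\<^bsub>X\<^esub> r x a)"

definition derivations_inner_in :: "'x itself \<Rightarrow> ('a, 'z) calg_scheme \<Rightarrow> bool"
  where "derivations_inner_in _ A \<longleftrightarrow>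
    (\<forall>(X :: 'x cnormed) l r D.
       banach_bimodule A X l r \<longrightarrow> continuous_derivation A X l r D \<longrightarrow> inner_derivation A X l r D)"

text \<open>HOL has no quantification over types inside a formula, so the bimodules range over all
  those whose underlying set is a set of elements of one sufficiently large type. This loses
  nothing: by the lemma \<open>contractive_derivations_inner\<close> at the end of this section every
  continuous derivation into a Banach bimodule over an arbitrary type is then inner.\<close>

definition contractive :: "('a, 'z) calg_scheme \<Rightarrow> bool"
  where "contractive A \<longleftrightarrow>
    banach_algebra A \<and> derivations_inner_in TYPE(nat \<Rightarrow> ('a \<times> 'a) list) A"

context complex_normed
begin

lemma minus_closed: "x \<in> carr X \<Longrightarrow> y \<in> carr X \<Longrightarrow> x \<ominus> y \<in> carr X"
  by (simp add: mns_def add_closed scale_closed)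

lemmas closed = zero_closed add_closed scale_closed minus_closed

lemma add_zero_right: "x \<in> carr X \<Longrightarrow> x \<oplus> \<zero> = x"
  using add_commute add_zero zero_closed by simp

lemma scale_zero_left: "x \<in> carr X \<Longrightarrow> 0 \<odot> x = \<zero>"
  using scale_add_left[of x 1 "-1"] minus_self[of x] by (simp add: mns_def scale_one)

lemma scale_zero: "k \<odot> \<zero> = \<zero>"
  using scale_scale[of \<zero> k 0] scale_zero_left[OF zero_closed] zero_closed by simp

lemma add_left_commute:
  "x \<in> carr X \<Longrightarrow> y \<in> carr X \<Longrightarrow> z \<in> carr X \<Longrightarrow> x \<oplus> (y \<oplus> z) = y \<oplus> (x \<oplus> z)"
  by (metis add_assoc add_commute)

lemma add_diff_add:
  assumes "x \<in> carr X" "y \<in> carr X" "x' \<in> carr X" "y' \<in> carr X"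
  shows "(x \<oplus> x') \<ominus> (y \<oplus> y') = (x \<ominus> y) \<oplus> (x' \<ominus> y')"
  using assms by (simp add: mns_def scale_add_right closed add_assoc add_left_commute)

lemma scale_diff:
  "x \<in> carr X \<Longrightarrow> y \<in> carr X \<Longrightarrow> k \<odot> (x \<ominus> y) = k \<odot> x \<ominus> k \<odot> y"
  by (simp add: mns_def scale_add_right closed scale_scale)

lemma diff_cancel:
  assumes "x \<in> carr X" "y \<in> carr X"
  shows "(x \<ominus> y) \<oplus> y = x"
proof -
  have "(x \<ominus> y) \<oplus> y = x \<oplus> (y \<ominus> y)"
    using assms by (simp add: mns_def closed add_assoc add_commute[of y])
  then show ?thesis using assms by (simp add: minus_self add_zero_right)
qed

lemma diff_eq_zero: "x \<in> carr X \<Longrightarrow> y \<in> carr X \<Longrightarrow> x \<ominus> y = \<zero> \<Longrightarrow> x = y"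
  using diff_cancel[of x y] add_zero by simp

lemma add_diff_cancel:
  assumes "x \<in> carr X" "y \<in> carr X"
  shows "(x \<oplus> y) \<ominus> y = x"
  using assms by (simp add: mns_def closed add_assoc minus_self[unfolded mns_def] add_zero_right)

lemma norm_minus_commute:
  assumes "x \<in> carr X" "y \<in> carr X"
  shows "nrm X (x \<ominus> y) = nrm X (y \<ominus> x)"
proof -
  have "x \<ominus> y = (-1) \<odot> (y \<ominus> x)"
    using assms by (simp add: mns_def scale_add_right closed scale_scale scale_one add_commute)
  then show ?thesis using assms by (simp add: norm_scale closed)
qed

lemma norm_diff_triangle:
  assumes "x \<in> carr X" "y \<in> carr X" "z \<in> carr X"
  shows "nrm X (x \<ominus> z) \<le> nrm X (x \<ominus> y) + nrm X (y \<ominus> z)"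
proof -
  have "x \<ominus> z = ((x \<ominus> y) \<oplus> y) \<ominus> z" using assms by (simp add: diff_cancel)
  also have "\<dots> = (x \<ominus> y) \<oplus> (y \<ominus> z)" 
    using assms unfolding mns_def by (simp add: closed add_assoc)
  finally show ?thesis using assms norm_triangle closed by simp
qed

end

lemma inner_via_injection:
  fixes A :: "('a, 'z) calg_scheme" and X :: "('x, 'y) cnormed_scheme" and c :: "'x \<Rightarrow> 'u"
  assumes bim: "banach_bimodule A X l r" and der: "continuous_derivation A X l r D"
    and univ: "derivations_inner_in TYPE('u) A"
    and Y: "Y \<subseteq> carr X" and inj: "inj_on c Y"
    and Y0: "\<zero>\<^bsub>X\<^esub> \<in> Y" and Yadd: "\<And>x y. x \<in> Y \<Longrightarrow> y \<in> Y \<Longrightarrow> x \<oplus>\<^bsub>X\<^esub> y \<in> Y"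
    and Yscale: "\<And>k x. x \<in> Y \<Longrightarrow> k \<odot>\<^bsub>X\<^esub> x \<in> Y"
    and Yl: "\<And>a x. a \<in> carr A \<Longrightarrow> x \<in> Y \<Longrightarrow> l a x \<in> Y"
    and Yr: "\<And>a x. a \<in> carr A \<Longrightarrow> x \<in> Y \<Longrightarrow> r x a \<in> Y"
    and YD: "\<And>a. a \<in> carr A \<Longrightarrow> D a \<in> Y"
    and Ycl: "\<And>s x. (\<forall>n. s n \<in> Y) \<Longrightarrow> x \<in> carr X \<Longrightarrow>
                (\<lambda>n. nrm X (s n \<ominus>\<^bsub>X\<^esub> x)) \<longlonglongrightarrow> 0 \<Longrightarrow> x \<in> Y"
  shows "inner_derivation A X l r D"
proof -
  interpret banach_bimodule A X l r by (rule bim)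
  define d where "d = inv_into Y c"
  have d: "d (c y) = y" if "y \<in> Y" for y
    using that inj by (simp add: d_def)
  define X' :: "'u cnormed" where "X' = \<lparr>carr = c ` Y, zer = c \<zero>\<^bsub>X\<^esub>,
    pls = (\<lambda>u v. c (d u \<oplus>\<^bsub>X\<^esub> d v)), scl = (\<lambda>k u. c (k \<odot>\<^bsub>X\<^esub> d u)), nrm = (\<lambda>u. nrm X (d u))\<rparr>"
  define l' where "l' = (\<lambda>a u. c (l a (d u)))"
  define r' where "r' = (\<lambda>u a. c (r (d u) a))"
  have YX: "y \<in> carr X" if "y \<in> Y" for y using that Y by blast
  have Ydiff: "x \<ominus>\<^bsub>X\<^esub> y \<in> Y" if "x \<in> Y" "y \<in> Y" for x y
    using that by (simp add: mns_def Yadd Yscale)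
  note Ys = Y0 Yadd Yscale Yl Yr YD Ydiff
  have X'[simp]: "carr X' = c ` Y" "\<zero>\<^bsub>X'\<^esub> = c \<zero>\<^bsub>X\<^esub>"
    "u \<oplus>\<^bsub>X'\<^esub> v = c (d u \<oplus>\<^bsub>X\<^esub> d v)" "k \<odot>\<^bsub>X'\<^esub> u = c (k \<odot>\<^bsub>X\<^esub> d u)" "nrm X' u = nrm X (d u)" for u v k
    by (simp_all add: X'_def)
  have mns': "c x \<ominus>\<^bsub>X'\<^esub> c y = c (x \<ominus>\<^bsub>X\<^esub> y)" if "x \<in> Y" "y \<in> Y" for x y
    using that by (simp add: mns_def d Ys)
  have norm': "complex_normed X'"
    by standard
      (auto simp: mns' d Ys X.add_assoc X.add_zero X.minus_self X.scale_one X.scale_scale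
        X.scale_add_right X.scale_add_left X.norm_nonneg X.norm_eq_zero X.norm_triangle X.norm_scale
        YX inj_on_eq_iff[OF inj] intro!: X.add_commute imageI)
  have ban': "complex_banach X'"
  proof (intro complex_banach.intro norm' complex_banach_axioms.intro)
    fix s :: "nat \<Rightarrow> 'u"
    assume s: "\<forall>n. s n \<in> carr X'"
      and cau: "\<forall>e>0. \<exists>N. \<forall>m\<ge>N. \<forall>n\<ge>N. nrm X' (s m \<ominus>\<^bsub>X'\<^esub> s n) < e"
    define t where "t = (\<lambda>n. d (s n))"
    have t: "t n \<in> Y" "s n = c (t n)" for n
      using s by (auto simp: t_def d dest!: spec[of _ n])
    have "\<exists>x\<in>carr X. (\<lambda>n. nrm X (t n \<ominus>\<^bsub>X\<^esub> x)) \<longlonglongrightarrow> 0"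
      using cau by (intro X.complete) (auto simp: t mns' d Ys YX)
    then obtain x where x: "x \<in> carr X" "(\<lambda>n. nrm X (t n \<ominus>\<^bsub>X\<^esub> x)) \<longlonglongrightarrow> 0" by blast
    then have "x \<in> Y" using Ycl[of t x] t by blast
    then show "\<exists>x\<in>carr X'. (\<lambda>n. nrm X' (s n \<ominus>\<^bsub>X'\<^esub> x)) \<longlonglongrightarrow> 0"
      using x by (intro bexI[of _ "c x"]) (auto simp: t mns' d Ys)
  qed
  obtain Cl where Cl: "\<forall>a\<in>carr A. \<forall>x\<in>carr X. nrm X (l a x) \<le> Cl * nrm A a * nrm X x"
    using l_bounded by blast
  obtain Cr where Cr: "\<forall>a\<in>carr A. \<forall>x\<in>carr X. nrm X (r x a) \<le> Cr * nrm A a * nrm X x"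
    using r_bounded by blast
  have "banach_bimodule A X' l' r'"
  proof (intro banach_bimodule.intro ban' A.banach_algebra_axioms banach_bimodule_axioms.intro)
    show "\<exists>C. \<forall>a\<in>carr A. \<forall>x\<in>carr X'. nrm X' (l' a x) \<le> C * nrm A a * nrm X' x"
      using Cl by (intro exI[of _ Cl]) (auto simp: l'_def d Ys YX)
    show "\<exists>C. \<forall>a\<in>carr A. \<forall>x\<in>carr X'. nrm X' (r' x a) \<le> C * nrm A a * nrm X' x"
      using Cr by (intro exI[of _ Cr]) (auto simp: r'_def d Ys YX)
  qed (auto simp: l'_def r'_def d Ys YX l_add r_add l_scale r_scale add_l add_r scale_l scale_r
      l_mult r_mult l_r A.mult_closed A.add_closed A.scale_closed)
  moreover have "continuous_derivation A X' l' r' (\<lambda>a. c (D a))"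
  proof -
    obtain C where C: "\<forall>a\<in>carr A. nrm X (D a) \<le> C * nrm A a"
      using der unfolding continuous_derivation_def by blast
    then have "\<exists>C. \<forall>a\<in>carr A. nrm X' (c (D a)) \<le> C * nrm A a"
      by (intro exI[of _ C]) (auto simp: d Ys)
    then show ?thesis
      using der unfolding continuous_derivation_def by (auto simp: l'_def r'_def d Ys)
  qed
  ultimately have "inner_derivation A X' l' r' (\<lambda>a. c (D a))"
    using univ unfolding derivations_inner_in_def by blast
  then obtain x where x: "x \<in> Y" "\<forall>a\<in>carr A. c (D a) = l' a (c x) \<ominus>\<^bsub>X'\<^esub> r' (c x) a"
    unfolding inner_derivation_def by auto
  have "D a = l a x \<ominus>\<^bsub>X\<^esub> r x a" if "a \<in> carr A" for a
    using x that by (simp add: l'_def r'_def d mns' Ys inj_on_eq_iff[OF inj])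
  then show ?thesis
    using x YX unfolding inner_derivation_def by blast
qed

text \<open>The closed sub-bimodule generated by the range of a derivation \<open>D\<close> consists of the limits of
  sequences of finite sums of elements \<open>D b + (D b) c\<close>, so it embeds into the type used in the
  definition of \<open>contractive\<close>.\<close>

lemma contractive_derivations_inner:
  fixes A :: "('a, 'z) calg_scheme"
  assumes "contractive A" and bim: "banach_bimodule A X l r" and der: "continuous_derivation A X l r D"
  shows "inner_derivation A X l r D"
proof -
  interpret banach_bimodule A X l r by (rule bim)
  have univ: "derivations_inner_in TYPE(nat \<Rightarrow> ('a \<times> 'a) list) A"
    using assms(1) by (simp add: contractive_def)
  have DX: "a \<in> carr A \<Longrightarrow> D a \<in> carr X"
    and Dadd: "a \<in> carr A \<Longrightarrow> b \<in> carr A \<Longrightarrow> D (a \<oplus>\<^bsub>A\<^esub> b) = D a \<oplus>\<^bsub>X\<^esub> D b"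
    and Dscale: "a \<in> carr A \<Longrightarrow> D (k \<odot>\<^bsub>A\<^esub> a) = k \<odot>\<^bsub>X\<^esub> D a"
    and Dmult: "a \<in> carr A \<Longrightarrow> b \<in> carr A \<Longrightarrow> D (a \<otimes>\<^bsub>A\<^esub> b) = r (D a) b \<oplus>\<^bsub>X\<^esub> l a (D b)" for a b k
    using der by (auto simp: continuous_derivation_def)
  define g where "g = (\<lambda>(b, c). D b \<oplus>\<^bsub>X\<^esub> r (D b) c)"
  define ev where "ev = (\<lambda>ys. foldr (\<lambda>p x. g p \<oplus>\<^bsub>X\<^esub> x) ys \<zero>\<^bsub>X\<^esub>)"
  have ev_simps[simp]: "ev [] = \<zero>\<^bsub>X\<^esub>" "ev (p # ys) = g p \<oplus>\<^bsub>X\<^esub> ev ys" for p ys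
    by (simp_all add: ev_def)
  define P where "P = {ys. set ys \<subseteq> carr A \<times> carr A}"
  have gX: "g p \<in> carr X" if "p \<in> carr A \<times> carr A" for p
    using that by (auto simp: g_def DX r_closed X.add_closed)
  have evX: "ev ys \<in> carr X" if "ys \<in> P" for ys
    using that by (induction ys) (auto simp: P_def gX X.closed)
  define S where "S = ev ` P"
  have SX: "S \<subseteq> carr X" using evX by (auto simp: S_def)
  have ev_app: "ev (xs @ ys) = ev xs \<oplus>\<^bsub>X\<^esub> ev ys" if "xs \<in> P" "ys \<in> P" for xs ys
    using that
  proof (induction xs)
    case (Cons p xs)
    then have "xs \<in> P" "p \<in> carr A \<times> carr A" by (auto simp: P_def)
    then show ?case using Cons by (simp add: X.add_assoc gX evX)
  qed (simp add: X.add_zero evX)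
  have S0: "\<zero>\<^bsub>X\<^esub> \<in> S"
    unfolding S_def by (rule image_eqI[of _ _ "[]"]) (auto simp: P_def)
  have Sadd: "x \<oplus>\<^bsub>X\<^esub> y \<in> S" if "x \<in> S" "y \<in> S" for x y
  proof -
    from that obtain xs ys where "xs \<in> P" "ys \<in> P" "x = ev xs" "y = ev ys" by (auto simp: S_def)
    then show ?thesis
      unfolding S_def by (intro image_eqI[of _ _ "xs @ ys"]) (auto simp: ev_app P_def)
  qed
  have Sg: "g p \<in> S" if "p \<in> carr A \<times> carr A" for p
    unfolding S_def using that
    by (intro image_eqI[of _ _ "[p]"]) (auto simp: P_def gX X.add_zero_right)
  have Sind: "Q x" if "x \<in> S" "Q \<zero>\<^bsub>X\<^esub>" "\<And>p x. p \<in> carr A \<times> carr A \<Longrightarrow> x \<in> S \<Longrightarrow> Q x \<Longrightarrow> Q (g p \<oplus>\<^bsub>X\<^esub> x)"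
    for Q x
  proof -
    from that(1) obtain ys where ys: "ys \<in> P" "x = ev ys" by (auto simp: S_def)
    have "Q (ev ys)" using ys(1)
    proof (induction ys)
      case (Cons p ys)
      then have "ys \<in> P" "p \<in> carr A \<times> carr A" by (auto simp: P_def)
      then show ?case using Cons that(3)[of p "ev ys"] by (auto simp: S_def)
    qed (simp add: that)
    then show ?thesis by (simp add: ys)
  qed
  have A0: "\<zero>\<^bsub>A\<^esub> \<in> carr A" by (rule A.zero_closed)
  have r0: "r x \<zero>\<^bsub>A\<^esub> = \<zero>\<^bsub>X\<^esub>" if "x \<in> carr X" for x
    using scale_r[OF A0 that, of 0] that
    by (simp add: A.scale_zero X.scale_zero_left r_closed A0)
  have SD: "D a \<in> S" if "a \<in> carr A" for a
    using Sg[of "(a, \<zero>\<^bsub>A\<^esub>)"] that A0 by (simp add: g_def r0 DX X.add_zero_right)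
  have gscale: "k \<odot>\<^bsub>X\<^esub> g p = g (k \<odot>\<^bsub>A\<^esub> fst p, snd p)" if "p \<in> carr A \<times> carr A" for k p
    using that by (auto simp: g_def Dscale r_scale DX X.scale_add_right r_closed)
  have Sscale: "k \<odot>\<^bsub>X\<^esub> x \<in> S" if "x \<in> S" for k x
    using that
  proof (rule Sind)
    fix p y assume *: "p \<in> carr A \<times> carr A" "y \<in> S" "k \<odot>\<^bsub>X\<^esub> y \<in> S"
    have "k \<odot>\<^bsub>X\<^esub> (g p \<oplus>\<^bsub>X\<^esub> y) = g (k \<odot>\<^bsub>A\<^esub> fst p, snd p) \<oplus>\<^bsub>X\<^esub> k \<odot>\<^bsub>X\<^esub> y"
      using * SX by (subst X.scale_add_right) (auto simp: gX gscale)
    then show "k \<odot>\<^bsub>X\<^esub> (g p \<oplus>\<^bsub>X\<^esub> y) \<in> S"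
      using * by (auto intro!: Sadd Sg simp: A.scale_closed)
  qed (simp add: X.scale_zero S0)
  have SrD: "r (D b) c \<in> S" if "b \<in> carr A" "c \<in> carr A" for b c
  proof -
    have "(D b \<oplus>\<^bsub>X\<^esub> r (D b) c) \<ominus>\<^bsub>X\<^esub> D b = r (D b) c"
      using that by (simp add: X.add_commute[of "D b"] X.add_diff_cancel DX r_closed)
    moreover have "g (b, c) \<ominus>\<^bsub>X\<^esub> D b \<in> S"
      unfolding mns_def using that by (intro Sadd Sscale Sg SD) auto
    ultimately show ?thesis by (simp add: g_def)
  qed
  have SlD: "l a (D b) \<in> S" if "a \<in> carr A" "b \<in> carr A" for a b
  proof -
    have "D (a \<otimes>\<^bsub>A\<^esub> b) \<ominus>\<^bsub>X\<^esub> r (D a) b = l a (D b)"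
      using that
      by (simp add: Dmult X.add_commute[of "r (D a) b"] X.add_diff_cancel DX r_closed l_closed)
    moreover have "D (a \<otimes>\<^bsub>A\<^esub> b) \<ominus>\<^bsub>X\<^esub> r (D a) b \<in> S"
      unfolding mns_def using that by (intro Sadd Sscale SD SrD A.mult_closed)
    ultimately show ?thesis by simp
  qed
  have r_zero: "r \<zero>\<^bsub>X\<^esub> a = \<zero>\<^bsub>X\<^esub>" "l a \<zero>\<^bsub>X\<^esub> = \<zero>\<^bsub>X\<^esub>" if "a \<in> carr A" for a
    using r_scale[OF that X.zero_closed, of 0] l_scale[OF that X.zero_closed, of 0] that
    by (simp_all add: X.scale_zero X.scale_zero_left r_closed l_closed X.zero_closed)
  have Sr: "r x a \<in> S" if "x \<in> S" "a \<in> carr A" for x a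
    using that(1)
  proof (rule Sind)
    fix p y assume *: "p \<in> carr A \<times> carr A" "y \<in> S" "r y a \<in> S"
    obtain b c where p: "p = (b, c)" "b \<in> carr A" "c \<in> carr A" using *(1) by auto
    have "r (g p \<oplus>\<^bsub>X\<^esub> y) a = r (D b) a \<oplus>\<^bsub>X\<^esub> r (D b) (c \<otimes>\<^bsub>A\<^esub> a) \<oplus>\<^bsub>X\<^esub> r y a"
      using * SX p that by (simp add: r_add gX g_def subset_iff r_mult DX r_closed X.add_closed)
    then show "r (g p \<oplus>\<^bsub>X\<^esub> y) a \<in> S"
      using * p that by (auto intro!: Sadd SrD A.mult_closed)
  qed (simp add: r_zero that S0)
  have Sl: "l a x \<in> S" if "x \<in> S" "a \<in> carr A" for x a
    using that(1)
  proof (rule Sind)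
    fix p y assume *: "p \<in> carr A \<times> carr A" "y \<in> S" "l a y \<in> S"
    obtain b c where p: "p = (b, c)" "b \<in> carr A" "c \<in> carr A" using *(1) by auto
    have "l a (g p \<oplus>\<^bsub>X\<^esub> y) = l a (D b) \<oplus>\<^bsub>X\<^esub> r (l a (D b)) c \<oplus>\<^bsub>X\<^esub> l a y"
      using * SX p that by (simp add: l_add gX g_def subset_iff l_r DX r_closed X.add_closed)
    then show "l a (g p \<oplus>\<^bsub>X\<^esub> y) \<in> S"
      using * p that by (auto intro!: Sadd SlD Sr)
  qed (simp add: r_zero that S0)

  define Y where "Y = {x \<in> carr X. \<forall>e>0. \<exists>y\<in>S. nrm X (x \<ominus>\<^bsub>X\<^esub> y) < e}"
  have YX: "Y \<subseteq> carr X" by (auto simp: Y_def)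
  have SY: "S \<subseteq> Y"
  proof
    fix x assume x: "x \<in> S"
    then have "x \<in> carr X" using SX by blast
    moreover from this have "nrm X (x \<ominus>\<^bsub>X\<^esub> x) = 0"
      by (simp add: X.minus_self X.norm_eq_zero X.zero_closed)
    ultimately show "x \<in> Y" using x by (auto simp: Y_def intro!: bexI[of _ x])
  qed
  have Ymap: "f x \<in> Y"
    if x: "x \<in> Y" and f: "\<And>y. y \<in> carr X \<Longrightarrow> f y \<in> carr X" "\<And>y. y \<in> S \<Longrightarrow> f y \<in> S"
      and C: "\<And>y. y \<in> carr X \<Longrightarrow> nrm X (f x \<ominus>\<^bsub>X\<^esub> f y) \<le> C * nrm X (x \<ominus>\<^bsub>X\<^esub> y)" for f x C
    unfolding Y_def
  proof (intro CollectI conjI allI impI)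
    show "f x \<in> carr X" using x YX f by blast
    fix e :: real assume "e > 0"
    then have "e / (\<bar>C\<bar> + 1) > 0" by simp
    then obtain y where y: "y \<in> S" "nrm X (x \<ominus>\<^bsub>X\<^esub> y) < e / (\<bar>C\<bar> + 1)"
      using x unfolding Y_def by blast
    have nn: "0 \<le> nrm X (x \<ominus>\<^bsub>X\<^esub> y)"
      using x y YX SX by (intro X.norm_nonneg X.minus_closed) auto
    have "nrm X (f x \<ominus>\<^bsub>X\<^esub> f y) \<le> C * nrm X (x \<ominus>\<^bsub>X\<^esub> y)" using C y SX by blast
    also have "\<dots> \<le> (\<bar>C\<bar> + 1) * nrm X (x \<ominus>\<^bsub>X\<^esub> y)" using nn by (intro mult_right_mono) auto
    also have "\<dots> < e" using y(2) by (simp add: field_simps)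
    finally show "\<exists>y\<in>S. nrm X (f x \<ominus>\<^bsub>X\<^esub> y) < e" using f y by blast
  qed
  obtain Cl where Cl: "\<forall>a\<in>carr A. \<forall>x\<in>carr X. nrm X (l a x) \<le> Cl * nrm A a * nrm X x"
    using l_bounded by blast
  obtain Cr where Cr: "\<forall>a\<in>carr A. \<forall>x\<in>carr X. nrm X (r x a) \<le> Cr * nrm A a * nrm X x"
    using r_bounded by blast
  have ldiff: "l a x \<ominus>\<^bsub>X\<^esub> l a y = l a (x \<ominus>\<^bsub>X\<^esub> y)" "r x a \<ominus>\<^bsub>X\<^esub> r y a = r (x \<ominus>\<^bsub>X\<^esub> y) a"
    if "a \<in> carr A" "x \<in> carr X" "y \<in> carr X" for a x y
    using that by (simp_all add: mns_def l_add l_scale r_add r_scale X.scale_closed)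

  have ex: "\<exists>\<sigma>. \<forall>n. \<sigma> n \<in> P \<and> nrm X (x \<ominus>\<^bsub>X\<^esub> ev (\<sigma> n)) < 1 / Suc n" if "x \<in> Y" for x
  proof (rule choice, rule allI)
    fix n
    have "0 < 1 / real (Suc n)" by simp
    then show "\<exists>ys. ys \<in> P \<and> nrm X (x \<ominus>\<^bsub>X\<^esub> ev ys) < 1 / Suc n"
      using that unfolding Y_def S_def by blast
  qed
  define c where "c = (\<lambda>x. SOME \<sigma>. \<forall>n. \<sigma> n \<in> P \<and> nrm X (x \<ominus>\<^bsub>X\<^esub> ev (\<sigma> n)) < 1 / Suc n)"
  have c: "c x n \<in> P" "nrm X (x \<ominus>\<^bsub>X\<^esub> ev (c x n)) < 1 / Suc n" if "x \<in> Y" for x n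
    using someI_ex[OF ex[OF that]] unfolding c_def by blast+
  have inj: "inj_on c Y"
  proof (rule inj_onI)
    fix x y assume xy: "x \<in> Y" "y \<in> Y" "c x = c y"
    then have X: "x \<in> carr X" "y \<in> carr X" using YX by auto
    have "nrm X (x \<ominus>\<^bsub>X\<^esub> y) \<le> 2 * inverse (real (Suc n))" for n
      using X.norm_diff_triangle[OF X(1) evX[OF c(1)[OF xy(1)]] X(2), of n]
        X.norm_minus_commute[OF X(2) evX[OF c(1)[OF xy(1)]], of n]
        c(2)[OF xy(1), of n] c(2)[OF xy(2), of n] xy(3)
      by (simp add: inverse_eq_divide)
    then have ub: "\<exists>N. \<forall>n\<ge>N. nrm X (x \<ominus>\<^bsub>X\<^esub> y) \<le> 2 * inverse (real (Suc n))"
      by (intro exI allI impI)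
    have "(\<lambda>n. 2 * inverse (real (Suc n))) \<longlonglongrightarrow> 0"
      using tendsto_mult_right_zero[OF LIMSEQ_inverse_real_of_nat] by blast
    then have "nrm X (x \<ominus>\<^bsub>X\<^esub> y) \<le> 0"
      using ub by (rule LIMSEQ_le_const)
    then show "x = y"
      using X X.norm_nonneg[of "x \<ominus>\<^bsub>X\<^esub> y"] X.norm_eq_zero[of "x \<ominus>\<^bsub>X\<^esub> y"]
        X.diff_eq_zero[of x y] by (simp add: X.minus_closed)
  qed
  show ?thesis
  proof (rule inner_via_injection[OF bim der univ YX inj])
    show "\<zero>\<^bsub>X\<^esub> \<in> Y" using S0 SY by blast
    show "D a \<in> Y" if "a \<in> carr A" for a using SD SY that by blast
    show "k \<odot>\<^bsub>X\<^esub> x \<in> Y" if "x \<in> Y" for k x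
      using that YX
      by (intro Ymap[where f = "\<lambda>x. k \<odot>\<^bsub>X\<^esub> x" and x = x and C = "cmod k"])
        (auto simp: X.scale_diff[symmetric] X.norm_scale X.scale_closed X.minus_closed Sscale)
    show "l a x \<in> Y" if "a \<in> carr A" "x \<in> Y" for a x
      using that YX Cl
      by (intro Ymap[where f = "l a" and x = x and C = "Cl * nrm A a"])
        (auto simp: ldiff l_closed Sl X.minus_closed)
    show "r x a \<in> Y" if "a \<in> carr A" "x \<in> Y" for a x
      using that YX Cr
      by (intro Ymap[where f = "\<lambda>x. r x a" and x = x and C = "Cr * nrm A a"])
        (auto simp: ldiff r_closed Sr X.minus_closed)
    show "x \<oplus>\<^bsub>X\<^esub> y \<in> Y" if xy: "x \<in> Y" "y \<in> Y" for x y
      unfolding Y_def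
    proof (intro CollectI conjI allI impI)
      have X: "x \<in> carr X" "y \<in> carr X" using YX xy by auto
      then show "x \<oplus>\<^bsub>X\<^esub> y \<in> carr X" by (rule X.add_closed)
      fix e :: real assume "e > 0"
      then have "e / 2 > 0" by simp
      then obtain x' y' where *: "x' \<in> S" "nrm X (x \<ominus>\<^bsub>X\<^esub> x') < e / 2" "y' \<in> S" "nrm X (y \<ominus>\<^bsub>X\<^esub> y') < e / 2"
        using xy unfolding Y_def by blast
      have X': "x' \<in> carr X" "y' \<in> carr X" using * SX by auto
      have "nrm X ((x \<oplus>\<^bsub>X\<^esub> y) \<ominus>\<^bsub>X\<^esub> (x' \<oplus>\<^bsub>X\<^esub> y')) < e"
        using X.norm_triangle[of "x \<ominus>\<^bsub>X\<^esub> x'" "y \<ominus>\<^bsub>X\<^esub> y'"] X X' *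
        by (simp add: X.add_diff_add X.minus_closed)
      then show "\<exists>z\<in>S. nrm X ((x \<oplus>\<^bsub>X\<^esub> y) \<ominus>\<^bsub>X\<^esub> z) < e" using Sadd * by blast
    qed
    show "x \<in> Y" if s: "\<forall>n. s n \<in> Y" and x: "x \<in> carr X" and lim: "(\<lambda>n. nrm X (s n \<ominus>\<^bsub>X\<^esub> x)) \<longlonglongrightarrow> 0"
      for s x
      unfolding Y_def
    proof (intro CollectI conjI allI impI x)
      fix e :: real assume "e > 0"
      then have e: "e / 2 > 0" by simp
      from order_tendstoD(2)[OF lim e] obtain n where n: "nrm X (s n \<ominus>\<^bsub>X\<^esub> x) < e / 2"
        by (auto simp: eventually_sequentially)
      obtain y where y: "y \<in> S" "nrm X (s n \<ominus>\<^bsub>X\<^esub> y) < e / 2" using s e unfolding Y_def by blast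
      have X: "s n \<in> carr X" "y \<in> carr X" using s y YX SX by auto
      have "nrm X (x \<ominus>\<^bsub>X\<^esub> y) < e"
        using X.norm_diff_triangle[OF x X] X.norm_minus_commute[OF x X(1)] n y by simp
      then show "\<exists>y\<in>S. nrm X (x \<ominus>\<^bsub>X\<^esub> y) < e" using y by blast
    qed
  qed
qed

section \<open>Function spaces\<close>

definition C0 :: "('a::topological_space \<Rightarrow> complex) set"
  where "C0 = {f. continuous_on UNIV f \<and> (\<forall>e>0. compact {x. e \<le> cmod (f x)})}"

definition supnorm :: "('a \<Rightarrow> complex) \<Rightarrow> real"
  where "supnorm f = (SUP x. cmod (f x))"

definition bounded_bilinear_form ::
  "('a \<Rightarrow> complex) set \<Rightarrow> (('a \<Rightarrow> complex) \<Rightarrow> real) \<Rightarrow> ('b \<Rightarrow> complex) set \<Rightarrow> (('b \<Rightarrow> complex) \<Rightarrow> real)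
    \<Rightarrow> (('a \<Rightarrow> complex) \<Rightarrow> ('b \<Rightarrow> complex) \<Rightarrow> complex) \<Rightarrow> bool"
  where "bounded_bilinear_form V p W q T \<longleftrightarrow>
    (\<forall>f\<in>V. \<forall>f'\<in>V. \<forall>g\<in>W. T (\<lambda>x. f x + f' x) g = T f g + T f' g) \<and>
    (\<forall>f\<in>V. \<forall>g\<in>W. \<forall>g'\<in>W. T f (\<lambda>y. g y + g' y) = T f g + T f g') \<and>
    (\<forall>c. \<forall>f\<in>V. \<forall>g\<in>W. T (\<lambda>x. c * f x) g = c * T f g) \<and>
    (\<forall>c. \<forall>f\<in>V. \<forall>g\<in>W. T f (\<lambda>y. c * g y) = c * T f g) \<and>
    (\<exists>C. \<forall>f\<in>V. \<forall>g\<in>W. cmod (T f g) \<le> C * p f * q g)"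

text \<open>Square-integrable functions rather than classes modulo null functions. A form that is
  bounded for the seminorm \<open>L2norm\<close> respects equality almost everywhere, hence is the same thing
  as a bounded form on the quotient.\<close>

definition L2 :: "'a measure \<Rightarrow> ('a \<Rightarrow> complex) set"
  where "L2 M = {f \<in> borel_measurable M. integrable M (\<lambda>x. (cmod (f x))\<^sup>2)}"

definition L2norm :: "'a measure \<Rightarrow> ('a \<Rightarrow> complex) \<Rightarrow> real"
  where "L2norm M f = sqrt (\<integral>x. (cmod (f x))\<^sup>2 \<partial>M)"


section \<open>The measure algebra as the dual of \<open>C0\<close>\<close>

instance prod :: (topological_monoid_add, topological_monoid_add) topological_monoid_add
proof
  fix a b :: "'a \<times> 'b"
  have "((\<lambda>x. (fst (fst x) + fst (snd x), snd (fst x) + snd (snd x))) \<longlongrightarrow>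
          (fst a + fst b, snd a + snd b)) (nhds a \<times>\<^sub>F nhds b)"
    by (intro tendsto_Pair tendsto_add tendsto_fst tendsto_snd filterlim_fst filterlim_snd)
  then show "((\<lambda>x. fst x + snd x) \<longlongrightarrow> a + b) (nhds a \<times>\<^sub>F nhds b)"
    by (simp add: plus_prod_def)
qed

instance prod :: (topological_group_add, topological_group_add) topological_group_add
proof
  fix a :: "'a \<times> 'b"
  have "uminus = (\<lambda>x :: 'a \<times> 'b. (- fst x, - snd x))"
    by (simp add: fun_eq_iff uminus_prod_def)
  moreover have "((\<lambda>x. (- fst x, - snd x)) \<longlongrightarrow> (- fst a, - snd a)) (nhds a)"
    by (intro tendsto_Pair tendsto_minus tendsto_fst tendsto_snd filterlim_ident)
  moreover have "- a = (- fst a, - snd a)"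
    by (simp only: uminus_prod_def)
  ultimately show "(uminus \<longlongrightarrow> - a) (nhds a)"
    by (simp only:)
qed

instance prod :: (topological_ab_group_add, topological_ab_group_add) topological_ab_group_add ..

text \<open>A functional on \<open>C0\<close> is represented by a total function that is zero outside \<open>C0\<close>, so
  that the representation is unique and the vector space operations are pointwise. The same
  convention is used for bimeasures. The convolution formula is
  \<open>\<integral> f d(\<phi> * \<psi>) = \<integral> \<integral> f (x + y) d\<psi>(y) d\<phi>(x)\<close>.\<close>

definition measure_algebra ::
  "(('a::{topological_ab_group_add, t2_space} \<Rightarrow> complex) \<Rightarrow> complex) calg"
  where "measure_algebra = \<lparr>
    carr = {\<phi>. (\<forall>f. f \<notin> C0 \<longrightarrow> \<phi> f = 0) \<and>
               (\<forall>f\<in>C0. \<forall>g\<in>C0. \<phi> (\<lambda>x. f x + g x) = \<phi> f + \<phi> g) \<and>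
               (\<forall>c. \<forall>f\<in>C0. \<phi> (\<lambda>x. c * f x) = c * \<phi> f) \<and>
               (\<exists>C. \<forall>f\<in>C0. cmod (\<phi> f) \<le> C * supnorm f)},
    zer = (\<lambda>f. 0),
    pls = (\<lambda>\<phi> \<psi> f. \<phi> f + \<psi> f),
    scl = (\<lambda>c \<phi> f. c * \<phi> f),
    nrm = (\<lambda>\<phi>. SUP f\<in>{f\<in>C0. supnorm f \<le> 1}. cmod (\<phi> f)),
    tms = (\<lambda>\<phi> \<psi> f. if f \<in> C0 then \<phi> (\<lambda>x. \<psi> (\<lambda>y. f (x + y))) else 0)\<rparr>"


section \<open>The algebra of bimeasures\<close>

text \<open>Borel probability measures on a locally compact space are taken to be regular. Without
  regularity \<open>C0\<close> need not be dense in \<open>L2\<close>, and extensions of forms would not be unique.\<close>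

definition radon_prob :: "'a::topological_space measure \<Rightarrow> bool"
  where "radon_prob M \<longleftrightarrow> prob_space M \<and> sets M = sets borel \<and>
    (\<forall>B\<in>sets borel. emeasure M B = (SUP K\<in>{K. compact K \<and> K \<subseteq> B}. emeasure M K))"

definition grothendieck_pair ::
  "(('a::topological_space \<Rightarrow> complex) \<Rightarrow> ('b::topological_space \<Rightarrow> complex) \<Rightarrow> complex)
    \<Rightarrow> 'a measure \<Rightarrow> 'b measure \<Rightarrow> bool"
  where "grothendieck_pair u M N \<longleftrightarrow> radon_prob M \<and> radon_prob N \<and>
    (\<exists>T. bounded_bilinear_form (L2 M) (L2norm M) (L2 N) (L2norm N) T \<and>
         (\<forall>f\<in>C0. \<forall>g\<in>C0. T f g = u f g))"

text \<open>For groups that are not second countable the product \<open>\<sigma>\<close>-algebra can be smaller than the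
  Borel \<open>\<sigma>\<close>-algebra of the product, and the function \<open>(x, y) \<mapsto> f (x + y)\<close> need not be measurable
  for it. By regularity that function is almost everywhere equal to a measurable one, so it is
  measurable for the completed product measure, which has the same \<open>L2\<close>.\<close>

definition tensor_form ::
  "(('a::topological_space \<Rightarrow> complex) \<Rightarrow> ('b::topological_space \<Rightarrow> complex) \<Rightarrow> complex)
    \<Rightarrow> (('a \<Rightarrow> complex) \<Rightarrow> ('b \<Rightarrow> complex) \<Rightarrow> complex)
    \<Rightarrow> 'a measure \<Rightarrow> 'b measure \<Rightarrow> 'a measure \<Rightarrow> 'b measure
    \<Rightarrow> (('a \<times> 'a \<Rightarrow> complex) \<Rightarrow> ('b \<times> 'b \<Rightarrow> complex) \<Rightarrow> complex) \<Rightarrow> bool"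
  where "tensor_form u1 u2 M1 N1 M2 N2 T \<longleftrightarrow>
    (let M = completion (M1 \<Otimes>\<^sub>M M2); N = completion (N1 \<Otimes>\<^sub>M N2) in
     bounded_bilinear_form (L2 M) (L2norm M) (L2 N) (L2norm N) T) \<and>
    (\<forall>f1\<in>C0. \<forall>f2\<in>C0. \<forall>g1\<in>C0. \<forall>g2\<in>C0.
       T (\<lambda>(x1, x2). f1 x1 * f2 x2) (\<lambda>(y1, y2). g1 y1 * g2 y2) = u1 f1 g1 * u2 f2 g2)"

text \<open>The value does not depend on the choice of the measures and of the form \<open>T\<close> (regularity
  gives density of the tensors in \<open>L2\<close>), and by Grothendieck's inequality a choice exists; hence the
  definite description.\<close>

definition bim_conv ::
  "(('a::{topological_ab_group_add, t2_space} \<Rightarrow> complex) \<Rightarrow> ('b::{topological_ab_group_add, t2_space} \<Rightarrow> complex) \<Rightarrow> complex)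
    \<Rightarrow> (('a \<Rightarrow> complex) \<Rightarrow> ('b \<Rightarrow> complex) \<Rightarrow> complex)
    \<Rightarrow> ('a \<Rightarrow> complex) \<Rightarrow> ('b \<Rightarrow> complex) \<Rightarrow> complex"
  where "bim_conv u1 u2 f g =
    (if f \<in> C0 \<and> g \<in> C0
     then THE z. \<exists>M1 N1 M2 N2 T.
        grothendieck_pair u1 M1 N1 \<and> grothendieck_pair u2 M2 N2 \<and>
        tensor_form u1 u2 M1 N1 M2 N2 T \<and>
        z = T (\<lambda>(x1, x2). f (x1 + x2)) (\<lambda>(y1, y2). g (y1 + y2))
     else 0)"

definition bimeasure_algebra ::
  "(('a::{topological_ab_group_add, t2_space} \<Rightarrow> complex) \<Rightarrow> ('b::{topological_ab_group_add, t2_space} \<Rightarrow> complex) \<Rightarrow> complex) calg"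
  where "bimeasure_algebra = \<lparr>
    carr = {u. (\<forall>f g. f \<notin> C0 \<or> g \<notin> C0 \<longrightarrow> u f g = 0) \<and>
               bounded_bilinear_form C0 supnorm C0 supnorm u},
    zer = (\<lambda>f g. 0),
    pls = (\<lambda>u v f g. u f g + v f g),
    scl = (\<lambda>c u f g. c * u f g),
    nrm = (\<lambda>u. SUP (f, g)\<in>{f\<in>C0. supnorm f \<le> 1} \<times> {g\<in>C0. supnorm g \<le> 1}. cmod (u f g)),
    tms = bim_conv\<rparr>"

end

theory Submission
  imports Defs "HOL-Algebra.QuotRing"
begin

text \<open>Both algebras are commutative, and a commutative contractive Banach algebra \<open>A\<close> is
  finite-dimensional: \<open>A\<close> has a unit, and applying contractivity to the kernel of a character \<open>h\<close>
  yields \<open>p\<close> with \<open>h p = 1\<close> and \<open>a p = h(a) p\<close> for all \<open>a\<close>. The elements \<open>a\<close> for which \<open>a A\<close> is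
  finite-dimensional form an ideal containing all these \<open>p\<close>. If it were proper, a maximal ideal
  above it would by the Gelfand--Mazur theorem be the kernel of a character \<open>h\<close>, contradicting
  \<open>h p = 1\<close>. Since the point masses are linearly independent, the groups are finite. Conversely, for
  finite groups both algebras are the group algebra, and averaging \<open>\<delta>\<^sub>g D(\<delta>\<^sub>-\<^sub>g)\<close> over the group
  shows that a derivation \<open>D\<close> is inner.\<close>

text \<open>The element p is u - x, where h u = 1 and x in the kernel of h implements the derivation
  taking a to a u - h(a) u. It is the idempotent that isolates h in the space of characters; the
  maximal ideal stands in for a compactness argument on that space. Gelfand--Mazur is reduced to a
  maximum principle: the norm of the resolvent is continuous, tends to 0 at infinity and nearly
  satisfies a mean value inequality, which fails at its rightmost maximum. Commutativity is the
  other difficulty. Elements of M(G x H) are functionals on C0, so Fubini has to be proved for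
  functionals. A function at which a functional almost attains its norm shows where the functional
  lives; a partition of unity there approximates it by finitely many point masses, for which the
  interchange is linearity. The product of bimeasures is a definite description, so it is compared
  through its defining condition, and for finite groups it is computed with uniform measures. (i)
  and (ii) are never compared directly: each is shown equivalent to (iii).\<close>

no_notation zer (\<open>\<zero>\<index>\<close>)
no_notation pls (infixl \<open>\<oplus>\<index>\<close> 65)
no_notation tms (infixl \<open>\<otimes>\<index>\<close> 70)
no_notation mns (infixl \<open>\<ominus>\<index>\<close> 65)

section \<open>The Gelfand--Mazur theorem\<close>

text \<open>Scalars act through products with \<open>\<iota> c\<close>, so that a complex algebra
  becomes a ring of HOL-Algebra and its quotients by ideals are available. The norm of
  \<open>\<one>\<close> may exceed 1.\<close>

locale complex_normed_ring = cring R for R (structure) +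
  fixes \<iota> :: "complex \<Rightarrow> 'a" and N :: "'a \<Rightarrow> real"
  assumes scalar_closed: "\<iota> c \<in> carrier R"
    and scalar_add: "\<iota> (c + d) = \<iota> c \<oplus> \<iota> d"
    and scalar_mult: "\<iota> (c * d) = \<iota> c \<otimes> \<iota> d"
    and scalar_one: "\<iota> 1 = \<one>"
    and norm_nonneg: "x \<in> carrier R \<Longrightarrow> 0 \<le> N x"
    and norm_add: "x \<in> carrier R \<Longrightarrow> y \<in> carrier R \<Longrightarrow> N (x \<oplus> y) \<le> N x + N y"
    and norm_mult: "x \<in> carrier R \<Longrightarrow> y \<in> carrier R \<Longrightarrow> N (x \<otimes> y) \<le> N x * N y"
    and norm_scale: "x \<in> carrier R \<Longrightarrow> N (\<iota> c \<otimes> x) = cmod c * N x"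
    and norm_eq_zero: "x \<in> carrier R \<Longrightarrow> N x = 0 \<Longrightarrow> x = \<zero>"
begin

lemma scalar_zero: "\<iota> 0 = \<zero>"
  using scalar_add[of 0 0] scalar_closed[of 0] by (metis add.r_cancel_one add_0)

lemma scalar_minus: "\<iota> (- c) = \<ominus> \<iota> c"
  using scalar_add[of c "- c"] scalar_closed by (simp add: scalar_zero sum_zero_eq_neg minus_equality a_comm)

lemma scalar_diff: "\<iota> (c - d) = \<iota> c \<ominus> \<iota> d"
  using scalar_add[of c "- d"] by (simp add: scalar_minus a_minus_def)

lemma norm_zero: "N \<zero> = 0"
  using norm_scale[of \<zero> 0] scalar_closed[of 0] by simp

lemma norm_minus: "x \<in> carrier R \<Longrightarrow> N (\<ominus> x) = N x"
  using norm_scale[of x "- 1"] by (simp add: scalar_minus scalar_one l_minus)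

lemma norm_diff_commute:
  assumes "x \<in> carrier R" "y \<in> carrier R"
  shows "N (x \<ominus> y) = N (y \<ominus> x)"
proof -
  have "y \<ominus> x = \<ominus> (x \<ominus> y)" using assms by algebra
  then show ?thesis using assms by (simp add: norm_minus)
qed

lemma norm_diff_le: "x \<in> carrier R \<Longrightarrow> y \<in> carrier R \<Longrightarrow> N (x \<ominus> y) \<le> N x + N y"
  using norm_add[of x "\<ominus> y"] by (simp add: a_minus_def norm_minus)

text \<open>The extra factor \<open>y\<close> lets the estimate start at \<open>n = 0\<close>, where
  \<open>x [^] n\<close> is \<open>\<one>\<close> and may have norm above 1.\<close>

lemma norm_power_mult:
  assumes "x \<in> carrier R" and that: "y \<in> carrier R"
  shows "N (x [^] (n::nat) \<otimes> y) \<le> N x ^ n * N y"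
proof (induction n)
  case (Suc n)
  have "x [^] Suc n \<otimes> y = x \<otimes> (x [^] n \<otimes> y)"
    using assms nat_pow_closed[OF assms(1), of n] unfolding nat_pow_Suc by algebra
  then have "N (x [^] Suc n \<otimes> y) \<le> N x * N (x [^] n \<otimes> y)"
    using norm_mult assms that by simp
  also have "\<dots> \<le> N x * (N x ^ n * N y)"
    using Suc norm_nonneg assms by (intro mult_left_mono) auto
  finally show ?case by (simp add: mult.assoc)
qed (use that in simp)

end

text \<open>The \<open>j\<close>-th powers form a geometric progression whose ratio is an
  \<open>n\<close>-th root of unity different from 1.\<close>

lemma sum_roots_of_unity:
  assumes "0 < j" "j < n"
  shows "(\<Sum>k<n. (cis (2 * pi * real k / real n)) ^ j) = 0"
proof -
  let ?w = "cis (2 * pi * real j / real n)"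
  have eq: "(cis (2 * pi * real k / real n)) ^ j = ?w ^ k" for k
    unfolding Complex.DeMoivre by (rule arg_cong[where f = cis]) (simp add: mult_ac)
  have "?w ^ n = 1"
    using assms unfolding Complex.DeMoivre
    by (subst cis_multiple_2pi[of "real j", symmetric]) (auto intro: arg_cong[where f = cis])
  moreover have "?w \<noteq> 1"
  proof
    assume "?w = 1"
    then have "cos (2 * pi * real j / real n) = 1" by (metis cis.simps(1) one_complex.simps(1))
    then obtain m :: int where "2 * pi * real j / real n = of_int m * 2 * pi"
      unfolding cos_one_2pi_int by blast
    then have "2 * pi * (real j / real n) = 2 * pi * of_int m" by (simp add: mult_ac)
    then have m: "real j / real n = of_int m" by (subst (asm) mult_cancel_left) simp
    have "0 < real j / real n" "real j / real n < 1" using assms by (auto simp: field_simps)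
    then have "0 < m" "m < 1" unfolding m by auto
    then show False by simp
  qed
  ultimately show ?thesis
    unfolding eq by (simp add: geometric_sum)
qed

locale complex_normed_field = complex_normed_ring + field
begin

section \<open>The resolvent of an element that is not a scalar\<close>

context
  fixes a
  assumes a: "a \<in> carrier R" and ns: "\<And>c. a \<noteq> \<iota> c"
begin

definition resolvent where "resolvent c = inv (a \<ominus> \<iota> c)"

lemma shift_unit: "a \<ominus> \<iota> c \<in> Units R"
proof -
  have "a \<ominus> \<iota> c \<noteq> \<zero>"
  proof
    assume "a \<ominus> \<iota> c = \<zero>"
    moreover have "(a \<ominus> \<iota> c) \<oplus> \<iota> c = a" using a scalar_closed[of c] by algebra
    ultimately show False using ns[of c] scalar_closed[of c] by simp
  qed
  then show ?thesis using a scalar_closed[of c] by (simp add: field_Units)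
qed

lemma resolvent_closed: "resolvent c \<in> carrier R"
  unfolding resolvent_def using shift_unit by simp

lemma resolvent_mult: "resolvent c \<otimes> (a \<ominus> \<iota> c) = \<one>"
  unfolding resolvent_def using shift_unit by simp

text \<open>The resolvent identity, from which both the continuity of the resolvent norm and the
  finite expansion of the resolvent are derived.\<close>

lemma resolvent_shift: "resolvent d = resolvent c \<oplus> \<iota> (d - c) \<otimes> (resolvent c \<otimes> resolvent d)"
proof -
  note cl = resolvent_closed[of c] resolvent_closed[of d] scalar_closed[of c] scalar_closed[of d] a
  have "resolvent d = (resolvent c \<otimes> (a \<ominus> \<iota> c)) \<otimes> resolvent d"
    using cl by (simp add: resolvent_mult)
  also have "\<dots> = resolvent c \<otimes> (resolvent d \<otimes> (a \<ominus> \<iota> d))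
      \<oplus> (\<iota> d \<ominus> \<iota> c) \<otimes> (resolvent c \<otimes> resolvent d)"
    using cl by algebra
  finally show ?thesis using cl by (simp add: resolvent_mult scalar_diff)
qed

definition resolvent_norm where "resolvent_norm c = N (resolvent c)"

lemma resolvent_norm_pos: "0 < resolvent_norm c"
proof -
  have "resolvent c \<noteq> \<zero>"
    using resolvent_mult[of c] a scalar_closed[of c] by force
  then show ?thesis
    using norm_eq_zero[OF resolvent_closed] norm_nonneg[OF resolvent_closed]
    unfolding resolvent_norm_def by (metis less_le)
qed

lemma resolvent_norm_diff:
  "\<bar>resolvent_norm d - resolvent_norm c\<bar> \<le> cmod (d - c) * resolvent_norm c * resolvent_norm d"
proof -
  have *: "resolvent_norm d - resolvent_norm c \<le> cmod (d - c) * resolvent_norm c * resolvent_norm d" for c d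
  proof -
    have "resolvent_norm d \<le> resolvent_norm c + N (\<iota> (d - c) \<otimes> (resolvent c \<otimes> resolvent d))"
      unfolding resolvent_norm_def
      using norm_add resolvent_shift[of d c] resolvent_closed scalar_closed by (metis m_closed)
    also have "N (\<iota> (d - c) \<otimes> (resolvent c \<otimes> resolvent d)) \<le> cmod (d - c) * (resolvent_norm c * resolvent_norm d)"
      unfolding resolvent_norm_def
      by (subst norm_scale) (auto simp: resolvent_closed intro!: mult_left_mono norm_mult)
    finally show ?thesis by (simp add: mult_ac)
  qed
  show ?thesis using *[of d c] *[of c d] by (simp add: abs_le_iff norm_minus_commute mult_ac)
qed

lemma resolvent_norm_continuous: "isCont resolvent_norm c"
proof -
  let ?f = resolvent_norm
  \<comment> \<open>This closeness lets \<open>?f d\<close> on the right of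
    \<open>resolvent_norm_diff\<close> be absorbed into the left, which gives
    \<open>?f d \<le> 2 * ?f c\<close>.\<close>
  have near: "\<forall>\<^sub>F d in at c. cmod (d - c) * ?f c < 1 / 2"
  proof (rule order_tendstoD)
    show "((\<lambda>d. cmod (d - c) * ?f c) \<longlongrightarrow> cmod (c - c) * ?f c) (at c)"
      by (intro tendsto_intros)
  qed simp
  have bound: "\<forall>\<^sub>F d in at c. norm (?f d - ?f c) \<le> cmod (d - c) * ?f c * (2 * ?f c)"
    using near
  proof eventually_elim
    case (elim d)
    have "?f d - ?f c \<le> (cmod (d - c) * ?f c) * ?f d"
      using resolvent_norm_diff[of d c] by simp
    also have "\<dots> \<le> 1 / 2 * ?f d"
      using elim resolvent_norm_pos[of d] by (intro mult_right_mono) auto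
    finally have "?f d \<le> 2 * ?f c" by simp
    then have "cmod (d - c) * ?f c * ?f d \<le> cmod (d - c) * ?f c * (2 * ?f c)"
      using resolvent_norm_pos[of c] by (intro mult_left_mono) auto
    then show ?case using resolvent_norm_diff[of d c] by simp
  qed
  have "((\<lambda>d. cmod (d - c) * ?f c * (2 * ?f c)) \<longlongrightarrow> cmod (c - c) * ?f c * (2 * ?f c)) (at c)"
    by (intro tendsto_intros)
  then have "((\<lambda>d. ?f d - ?f c) \<longlongrightarrow> 0) (at c)"
    by (intro Lim_null_comparison[OF bound]) simp
  then show ?thesis
    by (simp add: isCont_def LIM_zero_iff)
qed

text \<open>Follows from \<open>\<iota> c \<otimes> resolvent c = a \<otimes> resolvent c \<ominus>
  \<one>\<close>. It forces the resolvent norm to 0 as \<open>c\<close> grows, so that a maximum is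
  attained.\<close>

lemma resolvent_norm_decay: "cmod c * resolvent_norm c \<le> N a * resolvent_norm c + N \<one>"
proof -
  note cl = resolvent_closed[of c] scalar_closed[of c] a
  have "\<iota> c \<otimes> resolvent c = a \<otimes> resolvent c \<ominus> resolvent c \<otimes> (a \<ominus> \<iota> c)"
    using cl by algebra
  then have "\<iota> c \<otimes> resolvent c = a \<otimes> resolvent c \<ominus> \<one>" by (simp add: resolvent_mult)
  then have "cmod c * resolvent_norm c = N (a \<otimes> resolvent c \<ominus> \<one>)"
    unfolding resolvent_norm_def using norm_scale[OF resolvent_closed[of c]] by metis
  also have "\<dots> \<le> N (a \<otimes> resolvent c) + N \<one>"
    using cl by (intro norm_diff_le) auto
  also have "\<dots> \<le> N a * resolvent_norm c + N \<one>"
    unfolding resolvent_norm_def using cl norm_mult by simp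
  finally show ?thesis .
qed

text \<open>The weights \<open>w\<close> are a parameter because adding the expansions at several
  shifts changes only them and leaves the powers of \<open>r\<close> alone.\<close>

primrec power_sum where
  "power_sum r w 0 = \<zero>"
| "power_sum r w (Suc n) = power_sum r w n \<oplus> \<iota> (w n) \<otimes> (r [^] n \<otimes> r)"

lemma power_sum_closed: "r \<in> carrier R \<Longrightarrow> power_sum r w n \<in> carrier R"
  by (induction n) (auto simp: scalar_closed)

lemma power_sum_add:
  assumes "r \<in> carrier R"
  shows "power_sum r (\<lambda>j. v j + w j) n = power_sum r v n \<oplus> power_sum r w n"
proof (induction n)
  case (Suc n)
  have "power_sum r v n \<oplus> power_sum r w n \<oplus> (\<iota> (v n) \<oplus> \<iota> (w n)) \<otimes> (r [^] n \<otimes> r)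
    = (power_sum r v n \<oplus> \<iota> (v n) \<otimes> (r [^] n \<otimes> r)) \<oplus> (power_sum r w n \<oplus> \<iota> (w n) \<otimes> (r [^] n \<otimes> r))"
    using assms power_sum_closed[OF assms, of v n] power_sum_closed[OF assms, of w n]
      scalar_closed[of "v n"] scalar_closed[of "w n"] nat_pow_closed[OF assms, of n]
    by algebra
  then show ?case using Suc by (simp add: scalar_add)
qed simp

lemma power_sum_first:
  assumes "r \<in> carrier R" "0 < n" "\<And>j. 0 < j \<Longrightarrow> j < n \<Longrightarrow> w j = 0"
  shows "power_sum r w n = \<iota> (w 0) \<otimes> r"
  using assms(2,3)
proof (induction n)
  case (Suc n)
  show ?case
  proof (cases "n = 0")
    case True
    then show ?thesis using assms(1) scalar_closed by simp
  next
    case False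
    then show ?thesis using Suc assms(1) scalar_closed by (simp add: scalar_zero)
  qed
qed simp

text \<open>Iterates \<open>resolvent_shift\<close> on the last factor. The remainder keeps the
  shifted resolvent, so the identity is exact for every \<open>z\<close>, large or small.\<close>

lemma resolvent_expand:
  "resolvent (c + z) =
    power_sum (resolvent c) (\<lambda>j. z ^ j) n \<oplus> \<iota> (z ^ n) \<otimes> (resolvent c [^] n \<otimes> resolvent (c + z))"
proof (induction n)
  case 0
  then show ?case by (simp add: resolvent_closed scalar_one)
next
  case (Suc n)
  let ?r = "resolvent c" and ?s = "resolvent (c + z)" and ?p = "power_sum (resolvent c) (\<lambda>j. z ^ j) n"
  have cl: "?r \<in> carrier R" "?s \<in> carrier R" "\<iota> (z ^ n) \<in> carrier R" "\<iota> z \<in> carrier R"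
    "?p \<in> carrier R" "?r [^] n \<in> carrier R"
    by (auto simp: resolvent_closed scalar_closed power_sum_closed)
  have s: "?s = ?r \<oplus> \<iota> z \<otimes> (?r \<otimes> ?s)"
    using resolvent_shift[of "c + z" c] by simp
  have "?s = ?p \<oplus> \<iota> (z ^ n) \<otimes> (?r [^] n \<otimes> ?s)" by (rule Suc)
  also have "\<dots> = ?p \<oplus> \<iota> (z ^ n) \<otimes> (?r [^] n \<otimes> (?r \<oplus> \<iota> z \<otimes> (?r \<otimes> ?s)))"
    using s by simp
  also have "\<dots> = (?p \<oplus> \<iota> (z ^ n) \<otimes> (?r [^] n \<otimes> ?r)) \<oplus> (\<iota> (z ^ n) \<otimes> \<iota> z) \<otimes> ((?r [^] n \<otimes> ?r) \<otimes> ?s)"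
    using cl by algebra
  finally show ?case by (simp add: scalar_mult[symmetric] mult.commute)
qed

text \<open>Averaging the expansion of the resolvent over the \<open>n\<close>-th roots of unity kills all terms but the first
  and the last, which gives an approximate mean value property without any integration.\<close>

lemma resolvent_norm_mean:
  assumes "0 < n" "0 \<le> r"
  shows "real n * resolvent_norm c
    \<le> (1 + (r * resolvent_norm c) ^ n) * (\<Sum>k<n. resolvent_norm (c + of_real r * cis (2 * pi * real k / real n)))"
proof -
  define z where "z k = of_real r * cis (2 * pi * real k / real n)" for k
  let ?r = "resolvent c"
  define S where "S = rec_nat \<zero> (\<lambda>k x. x \<oplus> resolvent (c + z k))"
  have S_simps: "S 0 = \<zero>" "S (Suc k) = S k \<oplus> resolvent (c + z k)" for k by (simp_all add: S_def)
  have S_closed: "S m \<in> carrier R" for m by (induction m) (auto simp: S_simps resolvent_closed)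
  have S_norm: "N (S m) \<le> (\<Sum>k<m. resolvent_norm (c + z k))" for m
  proof (induction m)
    case (Suc m)
    have "N (S (Suc m)) \<le> N (S m) + N (resolvent (c + z m))"
      unfolding S_simps by (intro norm_add S_closed resolvent_closed)
    then show ?case using Suc by (simp add: resolvent_norm_def)
  qed (simp add: S_simps norm_zero)
  \<comment> \<open>All the points share the same \<open>n\<close>-th power, so the remainders of
    their expansions combine into a single multiple of \<open>S m\<close>.\<close>
  have zn: "z k ^ n = of_real r ^ n" for k
  proof -
    have "cis (2 * pi * real k / real n) ^ n = cis (2 * pi * of_nat k)"
      using assms unfolding Complex.DeMoivre by (intro arg_cong[where f = cis]) simp
    then show ?thesis
      by (simp add: z_def power_mult_distrib cis_multiple_2pi)
  qed
  have S_expand: "S m = power_sum ?r (\<lambda>j. \<Sum>k<m. z k ^ j) n \<oplus> \<iota> (of_real r ^ n) \<otimes> (?r [^] n \<otimes> S m)" for m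
  proof (induction m)
    case 0
    have "power_sum ?r (\<lambda>j. 0) n = \<zero>" for n
      by (induction n) (auto simp: scalar_zero resolvent_closed)
    then show ?case by (simp add: S_simps resolvent_closed scalar_closed)
  next
    case (Suc m)
    let ?s = "resolvent (c + z m)" and ?p = "power_sum ?r (\<lambda>j. z m ^ j) n"
      and ?q = "power_sum ?r (\<lambda>j. \<Sum>k<m. z k ^ j) n" and ?i = "\<iota> (of_real r ^ n)"
    have cl: "?r [^] n \<in> carrier R" "?s \<in> carrier R" "?p \<in> carrier R" "?q \<in> carrier R" "?i \<in> carrier R" "S m \<in> carrier R"
      by (auto simp: resolvent_closed scalar_closed power_sum_closed S_closed)
    have "S (Suc m) = (?q \<oplus> ?i \<otimes> (?r [^] n \<otimes> S m)) \<oplus> (?p \<oplus> ?i \<otimes> (?r [^] n \<otimes> ?s))"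
      using resolvent_expand[of c "z m" n] Suc by (simp add: S_simps zn)
    also have "\<dots> = (?q \<oplus> ?p) \<oplus> ?i \<otimes> (?r [^] n \<otimes> (S m \<oplus> ?s))"
      using cl by (simp add: r_distr a_ac)
    finally show ?case by (simp add: power_sum_add[OF resolvent_closed] S_simps)
  qed
  have "(\<Sum>k<n. z k ^ j) = 0" if "0 < j" "j < n" for j
    unfolding z_def power_mult_distrib sum_distrib_left[symmetric] sum_roots_of_unity[OF that] by simp
  then have "power_sum ?r (\<lambda>j. \<Sum>k<n. z k ^ j) n = \<iota> (\<Sum>k<n. z k ^ 0) \<otimes> ?r"
    using assms(1) by (intro power_sum_first resolvent_closed)
  then have eq: "S n = \<iota> (of_nat n) \<otimes> ?r \<oplus> \<iota> (of_real r ^ n) \<otimes> (?r [^] n \<otimes> S n)"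
    using S_expand[of n] by simp
  \<comment> \<open>The remainder \<open>t\<close> is itself bounded through \<open>N (S n)\<close>;
    this produces the factor \<open>1 + (r * resolvent_norm c) ^ n\<close>.\<close>
  define t where "t = \<iota> (of_real r ^ n) \<otimes> (?r [^] n \<otimes> S n)"
  have cl: "?r [^] n \<in> carrier R" "\<iota> (of_nat n) \<otimes> ?r \<in> carrier R" "\<iota> (of_real r ^ n) \<in> carrier R"
    "S n \<in> carrier R" "t \<in> carrier R"
    by (auto simp: t_def resolvent_closed scalar_closed S_closed)
  have "S n \<ominus> t = (\<iota> (of_nat n) \<otimes> ?r \<oplus> t) \<ominus> t"
    using eq unfolding t_def by (rule arg_cong)
  also have "\<dots> = \<iota> (of_nat n) \<otimes> ?r" using cl by algebra
  finally have "real n * resolvent_norm c = N (S n \<ominus> t)"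
    unfolding resolvent_norm_def using norm_scale[OF resolvent_closed, of "of_nat n" c] by simp
  also have "\<dots> \<le> N (S n) + N t"
    using cl by (intro norm_diff_le) auto
  also have "N t = r ^ n * N (?r [^] n \<otimes> S n)"
    using cl assms by (simp add: t_def norm_scale norm_power)
  also have "\<dots> \<le> r ^ n * (resolvent_norm c ^ n * N (S n))"
    unfolding resolvent_norm_def using cl assms resolvent_closed by (intro mult_left_mono norm_power_mult) auto
  finally have "real n * resolvent_norm c \<le> (1 + (r * resolvent_norm c) ^ n) * N (S n)"
    by (simp add: power_mult_distrib algebra_simps)
  also have "\<dots> \<le> (1 + (r * resolvent_norm c) ^ n) * (\<Sum>k<n. resolvent_norm (c + z k))"
    using S_norm assms resolvent_norm_pos[of c] by (intro mult_left_mono) auto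
  finally show ?thesis by (simp add: z_def)
qed

text \<open>A maximum alone could be constant along a circle around it. Taking one that is rightmost
  makes the norm strictly smaller just to the right of \<open>c\<close>, which the mean value
  estimate will contradict.\<close>

lemma resolvent_norm_attains:
  obtains c where "\<And>d. resolvent_norm d \<le> resolvent_norm c"
    and "\<And>d. resolvent_norm d = resolvent_norm c \<Longrightarrow> Re d \<le> Re c"
proof -
  let ?f = resolvent_norm
  \<comment> \<open>By \<open>resolvent_norm_decay\<close>, outside the disc of radius
    \<open>B\<close> the resolvent norm is below its value at 0, so the maximum can be sought inside
    the disc.\<close>
  define B where "B = N a + N \<one> / ?f 0"
  have out: "?f d < ?f 0" if "B < cmod d" for d
  proof -
    have "(cmod d - N a) * ?f d \<le> N \<one>"
      using resolvent_norm_decay[of d] by (simp add: algebra_simps)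
    moreover have "N \<one> < (cmod d - N a) * ?f 0"
      using that resolvent_norm_pos[of 0] by (simp add: B_def field_simps)
    ultimately have "(cmod d - N a) * ?f d < (cmod d - N a) * ?f 0" by simp
    moreover have "0 < cmod d - N a"
    proof -
      have "0 \<le> N \<one> / ?f 0" using resolvent_norm_pos[of 0] norm_nonneg[of \<one>] by simp
      then show ?thesis using that by (simp add: B_def)
    qed
    ultimately show ?thesis by simp
  qed
  have B: "0 \<le> B" using resolvent_norm_pos[of 0] norm_nonneg[of \<one>] norm_nonneg[OF a] by (simp add: B_def)
  have cont: "continuous_on S ?f" for S
    using resolvent_norm_continuous continuous_at_imp_continuous_on by blast
  have "\<exists>c\<in>cball 0 B. \<forall>d\<in>cball 0 B. ?f d \<le> ?f c"
    using B by (intro continuous_attains_sup cont) auto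
  then obtain c0 where "\<forall>d\<in>cball 0 B. ?f d \<le> ?f c0" by blast
  then have c0: "?f d \<le> ?f c0" if "cmod d \<le> B" for d using that by (simp add: dist_norm)
  have max: "?f d \<le> ?f c0" for d
    using c0[of d] c0[of 0] B out[of d] by (cases "cmod d \<le> B") auto
  define S where "S = cball 0 B \<inter> ?f -` {?f c0}"
  have S: "d \<in> S \<longleftrightarrow> ?f d = ?f c0" for d
    using out[of d] max[of 0] by (cases "cmod d \<le> B") (auto simp: S_def dist_norm)
  have "compact S"
    unfolding S_def
    by (rule compact_Int_closed[OF compact_cball continuous_closed_vimage[OF closed_singleton]])
      (rule resolvent_norm_continuous)
  moreover have "c0 \<in> S" by (simp add: S)
  ultimately have "\<exists>c\<in>S. \<forall>d\<in>S. Re d \<le> Re c"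
    by (intro continuous_attains_sup) (auto intro!: continuous_intros)
  then obtain c where c: "c \<in> S" "\<forall>d\<in>S. Re d \<le> Re c" by blast
  show ?thesis
  proof (rule that[of c])
    show "?f d \<le> ?f c" for d using c(1) max[of d] by (simp add: S)
    show "Re d \<le> Re c" if "?f d = ?f c" for d using c that by (simp add: S)
  qed
qed

text \<open>Maximum principle: on a circle around the rightmost maximum some arc stays below the
  maximum by a fixed amount. The averages over \<open>L * n\<close> points then stay below it too,
  against \<open>resolvent_norm_mean\<close> as \<open>n\<close> grows.\<close>

lemma resolvent_norm_no_maximum: False
proof -
  let ?f = resolvent_norm
  obtain c where max: "\<And>d. ?f d \<le> ?f c" and right: "\<And>d. ?f d = ?f c \<Longrightarrow> Re d \<le> Re c"
    using resolvent_norm_attains by blast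
  \<comment> \<open>With this radius \<open>r * ?f c\<close> is 1/2, so the error factor in
    \<open>resolvent_norm_mean\<close> tends to 1.\<close>
  define r where "r = 1 / (2 * ?f c)"
  have r: "0 < r" "r * ?f c = 1 / 2" using resolvent_norm_pos[of c] by (auto simp: r_def)
  have "?f (c + of_real r) < ?f c"
    using max[of "c + of_real r"] right[of "c + of_real r"] r by (auto simp: less_le)
  moreover have "isCont (\<lambda>t. ?f (c + of_real r * cis t)) 0"
    by (intro isCont_o2[where g = ?f and f = "\<lambda>t. c + of_real r * cis t"] resolvent_norm_continuous)
      (simp add: cis_conv_exp)
  then have "((\<lambda>t. ?f (c + of_real r * cis t)) \<longlongrightarrow> ?f (c + of_real r)) (at 0)"
    by (simp add: isCont_def)
  moreover define m where "m = (?f (c + of_real r) + ?f c) / 2"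
  ultimately have m: "m < ?f c" "?f (c + of_real r) < m"
    and ev: "\<forall>\<^sub>F t in at 0. ?f (c + of_real r * cis t) < m"
    by (auto intro!: order_tendstoD(2))
  from ev obtain e where e: "0 < e" "\<And>t. t \<noteq> 0 \<Longrightarrow> \<bar>t\<bar> < e \<Longrightarrow> ?f (c + of_real r * cis t) < m"
    by (auto simp: eventually_at dist_norm)
  have arc: "?f (c + of_real r * cis t) \<le> m" if "\<bar>t\<bar> < e" for t
    using e(2)[of t] m that by (cases "t = 0") auto
  \<comment> \<open>An \<open>L\<close>-th part of the circle fits into the arc: of
    \<open>L * n\<close> equally spaced points, the first \<open>n\<close> have angle below
    \<open>e\<close>.\<close>
  obtain L :: nat where L: "2 * pi / e < real L" using reals_Archimedean2 by blast
  have "0 < real L" by (rule le_less_trans[OF _ L]) (use e in simp)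
  then have L0: "0 < L" by simp
  have *: "?f c \<le> (1 + (1 / 2) ^ (L * n)) * (?f c - (?f c - m) / real L)" if "0 < n" for n
  proof -
    have n: "0 < L * n" using L0 that by simp
    have "(\<Sum>k<L * n. ?f (c + of_real r * cis (2 * pi * real k / real (L * n))))
        \<le> (\<Sum>k<L * n. if k < n then m else ?f c)"
    proof (intro sum_mono)
      fix k
      have "\<bar>2 * pi * real k / real (L * n)\<bar> < e" if "k < n"
      proof -
        have "2 * pi * real k < e * real L * real n"
        proof (rule mult_strict_mono)
          show "2 * pi < e * real L" using L e(1) by (simp add: field_simps)
          show "real k < real n" using that by simp
        qed (use that e(1) L0 in auto)
        then show ?thesis using n by (simp add: field_simps)
      qed
      then show "?f (c + of_real r * cis (2 * pi * real k / real (L * n))) \<le> (if k < n then m else ?f c)"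
        using arc max by simp
    qed
    also have "\<dots> = (\<Sum>k<L * n. ?f c) - (\<Sum>k<L * n. if k < n then ?f c - m else 0)"
      by (simp only: sum_subtractf[symmetric]) (intro sum.cong, auto)
    also have "(\<Sum>k<L * n. if k < n then ?f c - m else 0) = (\<Sum>k<n. ?f c - m)"
      using L0 by (intro sum.mono_neutral_cong_right) (auto intro: less_le_trans)
    finally have "(\<Sum>k<L * n. ?f (c + of_real r * cis (2 * pi * real k / real (L * n))))
        \<le> real (L * n) * ?f c - real n * (?f c - m)"
      by simp
    also have "\<dots> = real (L * n) * (?f c - (?f c - m) / real L)"
      using L0 by (simp add: field_simps)
    finally have "(\<Sum>k<L * n. ?f (c + of_real r * cis (2 * pi * real k / real (L * n))))
        \<le> real (L * n) * (?f c - (?f c - m) / real L)" .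
    then have "(1 + (1 / 2) ^ (L * n)) * (\<Sum>k<L * n. ?f (c + of_real r * cis (2 * pi * real k / real (L * n))))
        \<le> (1 + (1 / 2) ^ (L * n)) * (real (L * n) * (?f c - (?f c - m) / real L))"
      by (intro mult_left_mono) auto
    then have "real (L * n) * ?f c \<le> (1 + (1 / 2) ^ (L * n)) * (real (L * n) * (?f c - (?f c - m) / real L))"
      using resolvent_norm_mean[OF n, of r c] r by simp
    then have "real (L * n) * ?f c \<le> real (L * n) * ((1 + (1 / 2) ^ (L * n)) * (?f c - (?f c - m) / real L))"
      by (simp only: mult_ac)
    then show ?thesis using n by (simp only: mult_le_cancel_left_pos of_nat_0_less_iff)
  qed
  have "(\<lambda>n. (1 + (1 / 2) ^ (L * n)) * (?f c - (?f c - m) / real L))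
      \<longlonglongrightarrow> (1 + 0) * (?f c - (?f c - m) / real L)"
    unfolding power_mult using L0
    by (intro tendsto_intros LIMSEQ_power_zero) (simp add: power_less_one_iff)
  then have "?f c \<le> (1 + 0) * (?f c - (?f c - m) / real L)"
    by (rule LIMSEQ_le_const) (use * in \<open>auto intro!: exI[of _ 1]\<close>)
  moreover have "0 < (?f c - m) / real L" using m L0 by simp
  ultimately show False by simp
qed

end

theorem gelfand_mazur: "a \<in> carrier R \<Longrightarrow> \<exists>c. a = \<iota> c"
  using resolvent_norm_no_maximum by blast

end

section \<open>Maximal ideals of commutative Banach algebras\<close>

lemma (in cring) ideal_criterion:
  assumes "I \<subseteq> carrier R" "\<zero> \<in> I" "\<And>x y. x \<in> I \<Longrightarrow> y \<in> I \<Longrightarrow> x \<oplus> y \<in> I"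
    "\<And>x y. x \<in> carrier R \<Longrightarrow> y \<in> I \<Longrightarrow> x \<otimes> y \<in> I"
  shows "ideal I R"
proof (rule idealI)
  have minus: "\<ominus> x \<in> I" if "x \<in> I" for x
    using assms(4)[of "\<ominus> \<one>" x] that assms(1) by (auto simp: l_minus subset_iff)
  show "subgroup I (add_monoid R)"
    by unfold_locales (use assms minus in \<open>auto simp: a_inv_def[symmetric]\<close>)
  show "y \<otimes> x \<in> I" if "y \<in> I" "x \<in> carrier R" for x y
    using assms(4)[OF that(2,1)] that assms(1) by (auto simp: m_comm subset_iff)
qed (use assms ring_axioms in auto)

text \<open>Zorn's lemma applies because properness, phrased as \<open>\<one> \<notin> I\<close>,
  survives unions of chains.\<close>

lemma (in cring) exists_maximalideal:
  assumes J: "ideal J R" "\<one> \<notin> J"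
  obtains M where "maximalideal M R" "J \<subseteq> M"
proof -
  let ?P = "{I. ideal I R \<and> J \<subseteq> I \<and> \<one> \<notin> I}"
  have "\<Union>C \<in> ?P" if C: "C \<noteq> {}" "subset.chain ?P C" for C
  proof -
    have id: "ideal I R" "J \<subseteq> I" "\<one> \<notin> I" if "I \<in> C" for I
      using C(2) that unfolding subset.chain_def by auto
    have add: "additive_subgroup I R" if "I \<in> C" for I
      using id(1)[OF that] by (rule ideal.axioms)
    have "ideal (\<Union>C) R"
    proof (rule ideal_criterion)
      show "\<Union>C \<subseteq> carrier R"
        using additive_subgroup.a_subset[OF add] by (rule Union_least)
      obtain I where "I \<in> C" using C(1) by blast
      then show "\<zero> \<in> \<Union>C" using additive_subgroup.zero_closed[OF add] by blast
      show "x \<oplus> y \<in> \<Union>C" if xy: "x \<in> \<Union>C" "y \<in> \<Union>C" for x y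
      proof -
        from xy obtain I K where IK: "I \<in> C" "K \<in> C" "x \<in> I" "y \<in> K" by blast
        then have "I \<subseteq> K \<or> K \<subseteq> I" using C(2) unfolding subset.chain_def by auto
        then show ?thesis
        proof
          assume "I \<subseteq> K"
          then have "x \<oplus> y \<in> K"
            using additive_subgroup.a_closed[OF add[OF IK(2)], of x y] IK by auto
          then show ?thesis using IK by blast
        next
          assume "K \<subseteq> I"
          then have "x \<oplus> y \<in> I"
            using additive_subgroup.a_closed[OF add[OF IK(1)], of x y] IK by auto
          then show ?thesis using IK by blast
        qed
      qed
      show "x \<otimes> y \<in> \<Union>C" if x: "x \<in> carrier R" and y: "y \<in> \<Union>C" for x y
      proof -
        from y obtain I where "I \<in> C" "y \<in> I" by blast
        then show ?thesis using ideal.I_l_closed[OF id(1) _ x] by blast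
      qed
    qed
    then show ?thesis using C(1) id by blast
  qed
  moreover have "J \<in> ?P" using J by blast
  ultimately have "\<exists>M\<in>?P. \<forall>I\<in>?P. M \<subseteq> I \<longrightarrow> I = M"
    by (intro subset_Zorn_nonempty) blast+
  then obtain M where M: "ideal M R" "J \<subseteq> M" "\<one> \<notin> M"
    and max: "\<And>I. ideal I R \<Longrightarrow> J \<subseteq> I \<Longrightarrow> \<one> \<notin> I \<Longrightarrow> M \<subseteq> I \<Longrightarrow> I = M"
    by auto
  have "maximalideal M R"
  proof (rule maximalidealI[OF M(1)])
    show "carrier R \<noteq> M" using M(3) by blast
    show "I = M \<or> I = carrier R" if "ideal I R" "M \<subseteq> I" "I \<subseteq> carrier R" for I
    proof (cases "\<one> \<in> I")
      case True
      then show ?thesis using ideal.one_imp_carrier[OF that(1)] by simp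
    next
      case False
      then show ?thesis using max[OF that(1)] M(2) that(2) by auto
    qed
  qed
  then show ?thesis using that M by blast
qed

locale complex_banach_ring = complex_normed_ring +
  assumes complete: "(\<And>n::nat. s n \<in> carrier R) \<Longrightarrow>
    (\<And>e. 0 < e \<Longrightarrow> \<exists>K. \<forall>m\<ge>K. \<forall>n\<ge>K. N (s m \<ominus> s n) < e) \<Longrightarrow>
    \<exists>x\<in>carrier R. (\<lambda>n. N (s n \<ominus> x)) \<longlonglongrightarrow> 0"
begin

text \<open>Neumann series: the partial sums \<open>s\<close> of the powers of \<open>q\<close> form
  a Cauchy sequence, and by \<open>telescope\<close> their limit is an inverse of
  \<open>x\<close>.\<close>

lemma near_one_unit:
  assumes x: "x \<in> carrier R" and small: "N (\<one> \<ominus> x) < 1"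
  shows "x \<in> Units R"
proof -
  define q where "q = \<one> \<ominus> x"
  define t where "t = N q"
  have q: "q \<in> carrier R" and x_eq: "x = \<one> \<ominus> q" unfolding q_def using x by (simp, algebra)
  have t: "0 \<le> t" "t < 1" unfolding t_def using small norm_nonneg[OF q] by (auto simp: q_def)
  define s where "s = rec_nat \<zero> (\<lambda>n y. y \<oplus> q [^] n)"
  have s_simps: "s 0 = \<zero>" "s (Suc n) = s n \<oplus> q [^] n" for n by (simp_all add: s_def)
  have s_closed: "s n \<in> carrier R" for n by (induction n) (auto simp: s_simps q)
  have telescope: "x \<otimes> s n = \<one> \<ominus> q [^] n" for n
  proof (induction n)
    case 0
    then show ?case using x by (simp add: s_simps) algebra
  next
    case (Suc n)
    note cl = x q s_closed[of n] nat_pow_closed[OF q, of n]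
    have "x \<otimes> s (Suc n) = x \<otimes> s n \<oplus> (\<one> \<ominus> q) \<otimes> q [^] n"
      using cl x_eq by (simp add: s_simps r_distr)
    also have "\<dots> = (\<one> \<ominus> q [^] n) \<oplus> (\<one> \<ominus> q) \<otimes> q [^] n" using Suc by simp
    also have "\<dots> = \<one> \<ominus> q [^] n \<otimes> q" using cl by algebra
    finally show ?case by simp
  qed
  have pow: "N (q [^] n) \<le> t ^ n * N \<one>" for n
    using norm_power_mult[OF q one_closed, of n] q by (simp add: t_def)
  \<comment> \<open>The geometric bound is written as a difference of two tails so that the
    induction on \<open>k\<close> telescopes.\<close>
  have tail: "N (s (n + k) \<ominus> s n) \<le> N \<one> * (t ^ n / (1 - t)) - N \<one> * (t ^ (n + k) / (1 - t))" for n k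
  proof (induction k)
    case 0
    then show ?case using s_closed[of n] by (simp add: a_minus_def r_neg norm_zero)
  next
    case (Suc k)
    note cl = s_closed[of n] s_closed[of "n + k"] nat_pow_closed[OF q, of "n + k"]
    have "s (n + Suc k) \<ominus> s n = (s (n + k) \<ominus> s n) \<oplus> q [^] (n + k)"
      using cl by (simp add: s_simps) algebra
    then have "N (s (n + Suc k) \<ominus> s n) \<le> N (s (n + k) \<ominus> s n) + N (q [^] (n + k))"
      using cl norm_add by simp
    also have "\<dots> \<le> N \<one> * (t ^ n / (1 - t)) - N \<one> * (t ^ (n + k) / (1 - t)) + t ^ (n + k) * N \<one>"
      using Suc pow by (intro add_mono) auto
    also have "\<dots> = N \<one> * (t ^ n / (1 - t)) - N \<one> * (t ^ (n + Suc k) / (1 - t))"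
    proof -
      have "t ^ (n + k) / (1 - t) - t ^ (n + Suc k) / (1 - t) = t ^ (n + k) * (1 - t) / (1 - t)"
        by (simp add: diff_divide_distrib[symmetric] algebra_simps)
      also have "\<dots> = t ^ (n + k)" using t by simp
      finally have "N \<one> * (t ^ (n + k) / (1 - t) - t ^ (n + Suc k) / (1 - t)) = N \<one> * t ^ (n + k)"
        by (rule arg_cong)
      then show ?thesis by (simp only: right_diff_distrib mult.commute[of "N \<one>"])
    qed
    finally show ?case .
  qed
  have tail': "N (s m \<ominus> s n) \<le> N \<one> * (t ^ K / (1 - t))" if "K \<le> m" "K \<le> n" for m n K
  proof -
    have *: "N (s m \<ominus> s n) \<le> N \<one> * (t ^ K / (1 - t))" if "K \<le> n" "n \<le> m" for m n
    proof -
      have "N (s m \<ominus> s n) \<le> N \<one> * (t ^ n / (1 - t)) - N \<one> * (t ^ m / (1 - t))"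
        using tail[of n "m - n"] that by simp
      also have "\<dots> \<le> N \<one> * (t ^ n / (1 - t))"
        using t norm_nonneg[of \<one>] by simp
      also have "\<dots> \<le> N \<one> * (t ^ K / (1 - t))"
        using t norm_nonneg[of \<one>] that by (intro mult_left_mono divide_right_mono power_decreasing) auto
      finally show ?thesis .
    qed
    show ?thesis
      using *[of n m] *[of m n] that norm_diff_commute[OF s_closed s_closed, of m n]
      by (cases "n \<le> m") auto
  qed
  have lim0: "(\<lambda>K. N \<one> * (t ^ K / (1 - t))) \<longlonglongrightarrow> N \<one> * (0 / (1 - t))"
    using t by (intro tendsto_intros LIMSEQ_power_zero) auto
  have "\<exists>y\<in>carrier R. (\<lambda>n. N (s n \<ominus> y)) \<longlonglongrightarrow> 0"
  proof (rule complete)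
    fix e :: real assume "0 < e"
    then have "\<forall>\<^sub>F K in sequentially. N \<one> * (t ^ K / (1 - t)) < e"
      using order_tendstoD(2)[OF lim0] by simp
    then obtain K where "N \<one> * (t ^ K / (1 - t)) < e" by (auto simp: eventually_sequentially)
    then show "\<exists>K. \<forall>m\<ge>K. \<forall>n\<ge>K. N (s m \<ominus> s n) < e"
      using tail' by (intro exI[of _ K]) (auto intro: le_less_trans)
  qed (rule s_closed)
  then obtain y where y: "y \<in> carrier R" "(\<lambda>n. N (s n \<ominus> y)) \<longlonglongrightarrow> 0" by blast
  have bound: "N (x \<otimes> y \<ominus> \<one>) \<le> N x * N (s n \<ominus> y) + t ^ n * N \<one>" for n
  proof -
    note cl = x y(1) s_closed[of n] nat_pow_closed[OF q, of n]
    have "x \<otimes> y \<ominus> \<one> = (x \<otimes> s n \<ominus> \<one>) \<ominus> x \<otimes> (s n \<ominus> y)" using cl by algebra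
    also have "\<dots> = (\<one> \<ominus> q [^] n \<ominus> \<one>) \<ominus> x \<otimes> (s n \<ominus> y)" by (simp add: telescope)
    also have "\<dots> = \<ominus> (x \<otimes> (s n \<ominus> y) \<oplus> q [^] n)" using cl by algebra
    finally have "N (x \<otimes> y \<ominus> \<one>) = N (x \<otimes> (s n \<ominus> y) \<oplus> q [^] n)"
      using cl by (simp add: norm_minus)
    also have "\<dots> \<le> N (x \<otimes> (s n \<ominus> y)) + N (q [^] n)" using cl by (intro norm_add) auto
    also have "\<dots> \<le> N x * N (s n \<ominus> y) + t ^ n * N \<one>"
      using cl pow by (intro add_mono norm_mult) auto
    finally show ?thesis .
  qed
  have "(\<lambda>n. N x * N (s n \<ominus> y) + t ^ n * N \<one>) \<longlonglongrightarrow> N x * 0 + 0 * N \<one>"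
    using t by (intro tendsto_intros y LIMSEQ_power_zero) auto
  then have "N (x \<otimes> y \<ominus> \<one>) \<le> N x * 0 + 0 * N \<one>"
    by (rule LIMSEQ_le_const) (use bound in blast)
  then have "x \<otimes> y \<ominus> \<one> = \<zero>"
    using norm_nonneg[of "x \<otimes> y \<ominus> \<one>"] x y(1) by (intro norm_eq_zero) auto
  moreover have "(x \<otimes> y \<ominus> \<one>) \<oplus> \<one> = x \<otimes> y" using x y(1) by algebra
  ultimately have "x \<otimes> y = \<one>" by simp
  then show ?thesis using x y(1) m_comm[of x y] unfolding Units_def by auto
qed

lemma unit_in_ideal: "ideal I R \<Longrightarrow> x \<in> Units R \<Longrightarrow> x \<in> I \<Longrightarrow> I = carrier R"
  using ideal.I_l_closed[of I R x "inv x"] ideal.one_imp_carrier[of I R] by auto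

text \<open>The quotient seminorm is definite because \<open>M\<close> is maximal. A nonzero coset
  of seminorm 0 has an inverse in the quotient field; multiplying a small representative by a
  representative of the inverse yields an element of \<open>M\<close> within distance 1 of
  \<open>\<one>\<close>, up to sign, hence a unit in \<open>M\<close>.\<close>

lemma quotient_normed_field:
  assumes "maximalideal M R"
  shows "complex_normed_field (R Quot M) (\<lambda>c. M +> \<iota> c) (\<lambda>X. INF x\<in>X. N x)"
proof -
  interpret M: maximalideal M R by (rule assms)
  interpret F: field "R Quot M" by (rule M.quotient_is_field) (rule is_cring)
  let ?N = "\<lambda>X. INF x\<in>X. N x"
  have carr: "X \<in> carrier (R Quot M) \<longleftrightarrow> (\<exists>x\<in>carrier R. X = M +> x)" for X
    by (auto simp: FactRing_def A_RCOSETS_def')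
  have coset: "y \<in> M +> x \<Longrightarrow> y \<in> carrier R" "y \<in> M +> x \<Longrightarrow> M +> x = M +> y" if "x \<in> carrier R" for x y
    using that M.a_elemrcos_carrier a_repr_independence[OF _ _ M.a_subgroup] by blast+
  have bdd: "bdd_below (N ` (M +> x))" if "x \<in> carrier R" for x
    using coset(1)[OF that] norm_nonneg by (intro bdd_belowI[of _ 0]) auto
  have lower: "?N (M +> x) \<le> N y" if "x \<in> carrier R" "y \<in> M +> x" for x y
    using bdd that by (intro cINF_lower) auto
  have ne: "M +> x \<noteq> {}" if "x \<in> carrier R" for x using M.a_rcos_self[OF that] by blast
  have near: "\<exists>y\<in>M +> x. N y < ?N (M +> x) + e" if "x \<in> carrier R" "0 < e" for x e
    using cINF_less_iff[OF ne[OF that(1)] bdd[OF that(1)], of "?N (M +> x) + e"] that by auto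
  have nonneg: "0 \<le> ?N (M +> x)" if "x \<in> carrier R" for x
    using ne[OF that] coset(1)[OF that] norm_nonneg by (intro cINF_greatest) auto
  have add: "(M +> x) \<oplus>\<^bsub>R Quot M\<^esub> (M +> y) = M +> (x \<oplus> y)"
    and mult: "(M +> x) \<otimes>\<^bsub>R Quot M\<^esub> (M +> y) = M +> (x \<otimes> y)"
    if "x \<in> carrier R" "y \<in> carrier R" for x y
    using that by (simp_all add: FactRing_def M.a_rcos_sum M.rcoset_mult_add)
  show ?thesis
  proof unfold_locales
    show "M +> \<iota> c \<in> carrier (R Quot M)" for c using scalar_closed carr by blast
    show "M +> \<iota> (c + d) = (M +> \<iota> c) \<oplus>\<^bsub>R Quot M\<^esub> (M +> \<iota> d)" for c d
      by (simp add: add scalar_closed scalar_add)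
    show "M +> \<iota> (c * d) = (M +> \<iota> c) \<otimes>\<^bsub>R Quot M\<^esub> (M +> \<iota> d)" for c d
      by (simp add: mult scalar_closed scalar_mult)
    show "M +> \<iota> 1 = \<one>\<^bsub>R Quot M\<^esub>" by (simp add: FactRing_def scalar_one)
    fix X assume "X \<in> carrier (R Quot M)"
    then obtain x where x: "x \<in> carrier R" "X = M +> x" using carr by blast
    show "0 \<le> ?N X" using nonneg x by simp
    show "?N ((M +> \<iota> c) \<otimes>\<^bsub>R Quot M\<^esub> X) = cmod c * ?N X" for c
    proof -
      have le: "?N (M +> \<iota> c \<otimes> x) \<le> cmod c * ?N (M +> x)" if x: "x \<in> carrier R" for c x
      proof (rule field_le_epsilon)
        fix e :: real assume e: "0 < e"
        have "0 < e / (cmod c + 1)" using e by (intro divide_pos_pos) (auto simp: add_nonneg_pos)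
        from near[OF x this] obtain y where y: "y \<in> M +> x" "N y < ?N (M +> x) + e / (cmod c + 1)" by blast
        have "M +> \<iota> c \<otimes> x = M +> \<iota> c \<otimes> y"
          using coset[OF x y(1)] x mult[of "\<iota> c"] scalar_closed[of c] by metis
        then have "?N (M +> \<iota> c \<otimes> x) \<le> N (\<iota> c \<otimes> y)"
          using lower[of "\<iota> c \<otimes> y"] M.a_rcos_self coset[OF x y(1)] scalar_closed by simp
        also have "\<dots> = cmod c * N y" using coset[OF x y(1)] by (simp add: norm_scale)
        also have "\<dots> \<le> cmod c * (?N (M +> x) + e / (cmod c + 1))"
          using y by (intro mult_left_mono) auto
        also have "\<dots> = cmod c * ?N (M +> x) + e * (cmod c / (cmod c + 1))" by (simp add: algebra_simps)
        also have "e * (cmod c / (cmod c + 1)) \<le> e * 1"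
          using e by (intro mult_left_mono) (auto simp: divide_le_eq_1 add_nonneg_pos)
        finally show "?N (M +> \<iota> c \<otimes> x) \<le> cmod c * ?N (M +> x) + e" by simp
      qed
      \<comment> \<open>The reverse inequality is \<open>le\<close> applied to the inverse
        scalar.\<close>
      have "cmod c * ?N (M +> x) \<le> ?N (M +> \<iota> c \<otimes> x)"
      proof (cases "c = 0")
        case False
        have "\<iota> (inverse c) \<otimes> (\<iota> c \<otimes> x) = x"
          using x scalar_closed False by (simp add: m_assoc[symmetric] scalar_mult[symmetric] scalar_one)
        then show ?thesis
          using le[of "\<iota> c \<otimes> x" "inverse c"] x scalar_closed False by (simp add: norm_divide field_simps)
      qed (use nonneg[of "\<iota> c \<otimes> x"] x scalar_closed in auto)
      then show ?thesis using le[of x c] x scalar_closed by (simp add: mult)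
    qed
    show "X = \<zero>\<^bsub>R Quot M\<^esub>" if X0: "?N X = 0"
    proof (rule ccontr)
      assume nz: "X \<noteq> \<zero>\<^bsub>R Quot M\<^esub>"
      then have "X \<in> Units (R Quot M)"
        using F.field_Units x carr by blast
      then obtain Y where Y: "Y \<in> carrier (R Quot M)" "X \<otimes>\<^bsub>R Quot M\<^esub> Y = \<one>\<^bsub>R Quot M\<^esub>"
        using F.Units_r_inv_ex by blast
      then obtain y where y: "y \<in> carrier R" "Y = M +> y" using carr by blast
      \<comment> \<open>The bound on \<open>z\<close> is chosen so that \<open>N z * N y\<close>
        stays below 1.\<close>
      have "0 < 1 / (N y + 1)" using norm_nonneg[OF y(1)] by simp
      from near[OF x(1) this] obtain z where z: "z \<in> M +> x" "N z < 1 / (N y + 1)"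
        using X0 x by auto
      have zc: "z \<in> carrier R" "X = M +> z" using coset[OF x(1) z(1)] x by auto
      have "M +> (z \<otimes> y) = M +> \<one>"
        using Y(2) y zc by (simp add: mult) (simp add: FactRing_def)
      then have "z \<otimes> y \<in> M +> \<one>" using M.a_rcos_self[of "z \<otimes> y"] y zc by simp
      then obtain m where m: "m \<in> M" "z \<otimes> y = m \<oplus> \<one>" by (auto simp: a_r_coset_def')
      have mc: "m \<in> carrier R" using m by simp
      have "\<one> \<ominus> (\<ominus> m) = m \<oplus> \<one>" using mc by algebra
      then have "N (\<one> \<ominus> (\<ominus> m)) = N (z \<otimes> y)" using m by simp
      also have "\<dots> \<le> N z * N y" using zc y by (intro norm_mult) auto
      also have "\<dots> \<le> 1 / (N y + 1) * N y"
        using z norm_nonneg[OF y(1)] by (intro mult_right_mono) auto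
      also have "\<dots> < 1" using norm_nonneg[OF y(1)] by (simp add: field_simps)
      finally have "\<ominus> m \<in> Units R" using mc by (intro near_one_unit) auto
      then show False using unit_in_ideal[OF M.is_ideal] m M.I_notcarr M.a_inv_closed by blast
    qed
    fix Y assume "Y \<in> carrier (R Quot M)"
    then obtain y where y: "y \<in> carrier R" "Y = M +> y" using carr by blast
    show "?N (X \<oplus>\<^bsub>R Quot M\<^esub> Y) \<le> ?N X + ?N Y"
    proof (rule field_le_epsilon)
      fix e :: real assume "0 < e"
      then have e: "0 < e / 2" by simp
      obtain x' where x': "x' \<in> M +> x" "N x' < ?N X + e / 2" using near[OF x(1) e] x by blast
      obtain y' where y': "y' \<in> M +> y" "N y' < ?N Y + e / 2" using near[OF y(1) e] y by blast
      have c: "x' \<in> carrier R" "X = M +> x'" "y' \<in> carrier R" "Y = M +> y'"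
        using coset[OF x(1) x'(1)] coset[OF y(1) y'(1)] x y by auto
      have "?N (X \<oplus>\<^bsub>R Quot M\<^esub> Y) \<le> N (x' \<oplus> y')"
        using c by (simp add: add lower M.a_rcos_self)
      also have "\<dots> \<le> N x' + N y'" using c by (intro norm_add) auto
      finally show "?N (X \<oplus>\<^bsub>R Quot M\<^esub> Y) \<le> ?N X + ?N Y + e" using x' y' by simp
    qed
    show "?N (X \<otimes>\<^bsub>R Quot M\<^esub> Y) \<le> ?N X * ?N Y"
    proof (rule tendsto_lowerbound)
      show "((\<lambda>e. (?N X + e) * (?N Y + e)) \<longlongrightarrow> ?N X * ?N Y) (at_right 0)"
        by (rule tendsto_eq_intros | simp)+
      have "?N (X \<otimes>\<^bsub>R Quot M\<^esub> Y) \<le> (?N X + e) * (?N Y + e)" if e: "0 < e" for e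
      proof -
        obtain x' where x': "x' \<in> M +> x" "N x' < ?N X + e" using near[OF x(1) e] x by blast
        obtain y' where y': "y' \<in> M +> y" "N y' < ?N Y + e" using near[OF y(1) e] y by blast
        have c: "x' \<in> carrier R" "X = M +> x'" "y' \<in> carrier R" "Y = M +> y'"
          using coset[OF x(1) x'(1)] coset[OF y(1) y'(1)] x y by auto
        have "?N (X \<otimes>\<^bsub>R Quot M\<^esub> Y) \<le> N (x' \<otimes> y')"
          using c by (simp add: mult lower M.a_rcos_self)
        also have "\<dots> \<le> N x' * N y'" using c by (intro norm_mult) auto
        also have "\<dots> \<le> (?N X + e) * (?N Y + e)"
          using x' y' c norm_nonneg[of x'] norm_nonneg[of y'] by (intro mult_mono) auto
        finally show ?thesis .
      qed
      then show "\<forall>\<^sub>F e in at_right 0. ?N (X \<otimes>\<^bsub>R Quot M\<^esub> Y) \<le> (?N X + e) * (?N Y + e)"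
        by (auto simp: eventually_at_right_less intro: eventually_at_rightI[of 0 1])
    qed simp
  qed
qed

text \<open>By Gelfand--Mazur in the quotient, every \<open>x\<close> is congruent modulo
  \<open>M\<close> to exactly one scalar, and this scalar is \<open>h x\<close>. If it exceeded
  \<open>N x\<close>, then \<open>\<one> \<ominus> \<iota> (inverse (h x)) \<otimes> x\<close> would
  be a unit by \<open>near_one_unit\<close> and yet lie in \<open>M\<close>.\<close>

lemma maximalideal_character:
  assumes "maximalideal M R"
  obtains h :: "_ \<Rightarrow> complex" where "\<And>x y. x \<in> carrier R \<Longrightarrow> y \<in> carrier R \<Longrightarrow> h (x \<oplus> y) = h x + h y"
    "\<And>x y. x \<in> carrier R \<Longrightarrow> y \<in> carrier R \<Longrightarrow> h (x \<otimes> y) = h x * h y"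
    "\<And>c. h (\<iota> c) = c" "\<And>x. x \<in> M \<Longrightarrow> h x = 0"
    "\<And>x. x \<in> carrier R \<Longrightarrow> cmod (h x) \<le> N x"
proof -
  interpret M: maximalideal M R by (rule assms)
  interpret F: complex_normed_field "R Quot M" "\<lambda>c. M +> \<iota> c" "\<lambda>X. INF x\<in>X. N x"
    by (rule quotient_normed_field) (rule assms)
  have nz: "x = 0" if "\<iota> x \<in> M" for x
  proof (rule ccontr)
    assume "x \<noteq> 0"
    then have "\<iota> (inverse x) \<otimes> \<iota> x = \<one>" by (simp add: scalar_mult[symmetric] scalar_one)
    then have "\<one> \<in> M" using M.I_l_closed[OF that scalar_closed, of "inverse x"] by simp
    then show False using M.I_notcarr M.one_imp_carrier by blast
  qed
  define h where "h x = (SOME c. x \<ominus> \<iota> c \<in> M)" for x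
  have ex: "\<exists>c. x \<ominus> \<iota> c \<in> M" if x: "x \<in> carrier R" for x
  proof -
    have "M +> x \<in> carrier (R Quot M)" using x by (auto simp: FactRing_def A_RCOSETS_def')
    then obtain c where "M +> x = M +> \<iota> c" using F.gelfand_mazur by blast
    then have "x \<in> M +> \<iota> c" using M.a_rcos_self[OF x] by simp
    then have "x \<ominus> \<iota> c \<in> M"
      using M.a_rcos_module_imp[of "\<iota> c" x] scalar_closed[of c] by (simp add: a_minus_def)
    then show ?thesis by blast
  qed
  have h: "x \<ominus> \<iota> (h x) \<in> M" if "x \<in> carrier R" for x
    unfolding h_def by (rule someI_ex) (rule ex[OF that])
  have uniq: "h x = c" if x: "x \<in> carrier R" and c: "x \<ominus> \<iota> c \<in> M" for x c
  proof -
    have "\<iota> (c - h x) = (x \<ominus> \<iota> (h x)) \<ominus> (x \<ominus> \<iota> c)"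
      unfolding scalar_diff using x scalar_closed[of c] scalar_closed[of "h x"] by algebra
    also have "\<dots> \<in> M" using h[OF x] c by (simp add: a_minus_def M.a_closed M.a_inv_closed)
    finally show ?thesis using nz by fastforce
  qed
  show ?thesis
  proof (rule that[of h])
    show "h (\<iota> c) = c" for c
      using scalar_closed[of c] by (intro uniq) (auto simp: a_minus_def r_neg)
    show "h x = 0" if "x \<in> M" for x
      using that M.Icarr[OF that] by (intro uniq) (auto simp: scalar_zero a_minus_def)
    fix x assume x: "x \<in> carrier R"
    note cx = x scalar_closed[of "h x"] h[OF x]
    show "cmod (h x) \<le> N x"
    proof (rule ccontr)
      assume "\<not> ?thesis"
      then have less: "N x < cmod (h x)" by simp
      then have nz: "h x \<noteq> 0" using norm_nonneg[OF x] by auto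
      let ?i = "\<iota> (inverse (h x))"
      have "\<one> \<ominus> (\<one> \<ominus> ?i \<otimes> x) = ?i \<otimes> x" using x scalar_closed[of "inverse (h x)"] by algebra
      then have "N (\<one> \<ominus> (\<one> \<ominus> ?i \<otimes> x)) < 1"
        using less nz x by (simp add: norm_scale norm_divide field_simps)
      then have unit: "\<one> \<ominus> ?i \<otimes> x \<in> Units R"
        using x scalar_closed by (intro near_one_unit) auto
      have "?i \<otimes> \<iota> (h x) = \<one>" using nz by (simp add: scalar_mult[symmetric] scalar_one)
      then have "\<one> \<ominus> ?i \<otimes> x = ?i \<otimes> \<iota> (h x) \<ominus> ?i \<otimes> x" by simp
      also have "\<dots> = (\<ominus> ?i) \<otimes> (x \<ominus> \<iota> (h x))"
        using x scalar_closed[of "inverse (h x)"] scalar_closed[of "h x"] by algebra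
      also have "\<dots> \<in> M" using cx scalar_closed by (intro M.I_l_closed) auto
      finally show False using unit unit_in_ideal[OF M.is_ideal] M.I_notcarr by blast
    qed
    fix y assume y: "y \<in> carrier R"
    note cy = y scalar_closed[of "h y"] h[OF y]
    have "(x \<oplus> y) \<ominus> (\<iota> (h x) \<oplus> \<iota> (h y)) = (x \<ominus> \<iota> (h x)) \<oplus> (y \<ominus> \<iota> (h y))"
      using cx cy by algebra
    then show "h (x \<oplus> y) = h x + h y"
      using cx cy by (intro uniq) (auto simp: scalar_add)
    have "x \<otimes> y \<ominus> \<iota> (h x) \<otimes> \<iota> (h y) = y \<otimes> (x \<ominus> \<iota> (h x)) \<oplus> \<iota> (h x) \<otimes> (y \<ominus> \<iota> (h y))"
      using cx cy by algebra
    then show "h (x \<otimes> y) = h x * h y"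
      using cx cy by (intro uniq) (auto simp: scalar_mult M.I_l_closed)
  qed
qed

end

section \<open>Commutative contractive algebras are finite-dimensional\<close>

definition multiplicative_functional :: "('a, 'z) calg_scheme \<Rightarrow> ('a \<Rightarrow> complex) \<Rightarrow> bool"
  where "multiplicative_functional A h \<longleftrightarrow>
    (\<forall>a\<in>carr A. \<forall>b\<in>carr A. h (pls A a b) = h a + h b) \<and>
    (\<forall>k. \<forall>a\<in>carr A. h (scl A k a) = k * h a) \<and>
    (\<forall>a\<in>carr A. \<forall>b\<in>carr A. h (tms A a b) = h a * h b) \<and>
    (\<exists>C. \<forall>a\<in>carr A. cmod (h a) \<le> C * nrm A a)"

lemma multiplicative_functionalD:
  assumes "multiplicative_functional A h"
  shows "a \<in> carr A \<Longrightarrow> b \<in> carr A \<Longrightarrow> h (pls A a b) = h a + h b"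
    and "a \<in> carr A \<Longrightarrow> h (scl A k a) = k * h a"
    and "a \<in> carr A \<Longrightarrow> b \<in> carr A \<Longrightarrow> h (tms A a b) = h a * h b"
    and "\<exists>C. \<forall>a\<in>carr A. cmod (h a) \<le> C * nrm A a"
  using assms unfolding multiplicative_functional_def by auto

lemma (in complex_normed) diff_add_diff:
  assumes "p \<in> carr X" "q \<in> carr X" "r \<in> carr X"
  shows "pls X (mns X p q) (mns X r p) = mns X r q"
proof -
  let ?m = "scl X (- 1)"
  have "pls X (mns X p q) (mns X r p) = pls X (pls X p (?m p)) (pls X r (?m q))"
    unfolding mns_def using assms add_commute[of "?m p" "?m q"]
    by (simp add: closed add_assoc add_left_commute[of "?m q" r] add_left_commute[of "?m p" r])
  then show ?thesis
    using assms minus_self[of p] by (simp add: closed add_zero mns_def)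
qed

lemma complex_banach_kernel:
  fixes A :: "('a, 'z) cnormed_scheme" and h :: "'a \<Rightarrow> complex"
  assumes "complex_banach A"
    and add: "\<And>a b. a \<in> carr A \<Longrightarrow> b \<in> carr A \<Longrightarrow> h (pls A a b) = h a + h b"
    and scale: "\<And>k a. a \<in> carr A \<Longrightarrow> h (scl A k a) = k * h a"
    and bounded: "\<And>a. a \<in> carr A \<Longrightarrow> cmod (h a) \<le> C * nrm A a"
  shows "complex_banach \<lparr>carr = {a \<in> carr A. h a = 0}, zer = zer A, pls = pls A, scl = scl A, nrm = nrm A\<rparr>"
    (is "complex_banach ?X")
proof -
  interpret complex_banach A by fact
  have h0: "h (zer A) = 0" using scale[OF zero_closed, of 0] by (simp add: scale_zero)
  have mns: "mns ?X x y = mns A x y" for x y by (simp add: mns_def)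
  have norm': "complex_normed ?X"
    by unfold_locales
      (simp_all add: mns closed add scale h0 add_assoc add_zero minus_self scale_one scale_scale
        scale_add_right scale_add_left norm_nonneg norm_eq_zero norm_triangle norm_scale,
        simp add: add_commute)
  show ?thesis
  proof (intro complex_banach.intro norm' complex_banach_axioms.intro)
    fix s :: "nat \<Rightarrow> 'a"
    assume s: "\<forall>n. s n \<in> carr ?X" and "\<forall>e>0. \<exists>N. \<forall>m\<ge>N. \<forall>n\<ge>N. nrm ?X (mns ?X (s m) (s n)) < e"
    then have "\<exists>x\<in>carr A. (\<lambda>n. nrm A (mns A (s n) x)) \<longlonglongrightarrow> 0"
      by (intro complete) (auto simp: mns)
    then obtain x where x: "x \<in> carr A" "(\<lambda>n. nrm A (mns A (s n) x)) \<longlonglongrightarrow> 0" by blast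
    have "cmod (h x) \<le> C * nrm A (mns A (s n) x)" for n
    proof -
      have "h (mns A (s n) x) = - h x"
        using s x by (simp add: mns_def add scale scale_closed)
      then show ?thesis using bounded[of "mns A (s n) x"] s x by (simp add: minus_closed)
    qed
    moreover have "(\<lambda>n. C * nrm A (mns A (s n) x)) \<longlonglongrightarrow> C * 0"
      by (intro tendsto_intros x)
    ultimately have "cmod (h x) \<le> C * 0" by (intro LIMSEQ_le_const) auto
    then show "\<exists>x\<in>carr ?X. (\<lambda>n. nrm ?X (mns ?X (s n) x)) \<longlonglongrightarrow> 0"
      using x by (auto simp: mns)
  qed
qed

text \<open>The bimodule is the kernel of \<open>h\<close>, with \<open>A\<close> acting by multiplication from the left and
  through \<open>h\<close> from the right.\<close>

lemma contractive_kernel_derivation: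
  fixes A :: "('a, 'z) calg_scheme"
  assumes contr: "contractive A" and h: "multiplicative_functional A h"
    and D_closed: "\<And>a. a \<in> carr A \<Longrightarrow> D a \<in> carr A" "\<And>a. a \<in> carr A \<Longrightarrow> h (D a) = 0"
    and D_add: "\<And>a b. a \<in> carr A \<Longrightarrow> b \<in> carr A \<Longrightarrow> D (pls A a b) = pls A (D a) (D b)"
    and D_scale: "\<And>k a. a \<in> carr A \<Longrightarrow> D (scl A k a) = scl A k (D a)"
    and D_bounded: "\<And>a. a \<in> carr A \<Longrightarrow> nrm A (D a) \<le> C * nrm A a"
    and D_mult: "\<And>a b. a \<in> carr A \<Longrightarrow> b \<in> carr A \<Longrightarrow>
      D (tms A a b) = pls A (scl A (h b) (D a)) (tms A a (D b))"
  obtains x where "x \<in> carr A" "h x = 0" "\<And>a. a \<in> carr A \<Longrightarrow> D a = mns A (tms A a x) (scl A (h a) x)"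
proof -
  define X where "X = \<lparr>carr = {a \<in> carr A. h a = 0}, zer = zer A, pls = pls A, scl = scl A, nrm = nrm A\<rparr>"
  interpret banach_algebra A using contr by (simp add: contractive_def)
  note h_add = multiplicative_functionalD(1)[OF h] and h_scale = multiplicative_functionalD(2)[OF h]
    and h_mult = multiplicative_functionalD(3)[OF h]
  obtain Ch where h_bounded: "\<And>a. a \<in> carr A \<Longrightarrow> cmod (h a) \<le> Ch * nrm A a"
    using multiplicative_functionalD(4)[OF h] by blast
  obtain Cm where Cm: "\<And>a b. a \<in> carr A \<Longrightarrow> b \<in> carr A \<Longrightarrow> nrm A (tms A a b) \<le> Cm * nrm A a * nrm A b"
    using mult_bounded by metis
  have X[simp]: "carr X = {a \<in> carr A. h a = 0}" "zer X = zer A" "pls X = pls A" "scl X = scl A" "nrm X = nrm A"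
    by (simp_all add: X_def)
  have "banach_bimodule A X (tms A) (\<lambda>x a. scl A (h a) x)"
  proof (intro banach_bimodule.intro banach_algebra_axioms banach_bimodule_axioms.intro)
    show "complex_banach X"
      unfolding X_def by (rule complex_banach_kernel[OF complex_banach_axioms h_add h_scale h_bounded])
    show "\<exists>C. \<forall>a\<in>carr A. \<forall>x\<in>carr X. nrm X (tms A a x) \<le> C * nrm A a * nrm X x"
      using Cm by auto
    show "\<exists>C. \<forall>a\<in>carr A. \<forall>x\<in>carr X. nrm X (scl A (h a) x) \<le> C * nrm A a * nrm X x"
      using h_bounded norm_nonneg by (auto simp: norm_scale intro!: exI[of _ Ch] mult_right_mono)
  qed (simp_all add: h_add h_scale h_mult closed mult_closed mult_add_left mult_add_right
      mult_scale_left mult_scale_right scale_add_left scale_add_right scale_scale mult_assoc mult.commute)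
  moreover have "continuous_derivation A X (tms A) (\<lambda>x a. scl A (h a) x) D"
    unfolding continuous_derivation_def
    by (intro conjI ballI allI exI[of _ C]) (simp_all add: D_closed D_add D_scale D_bounded D_mult)
  ultimately have "inner_derivation A X (tms A) (\<lambda>x a. scl A (h a) x) D"
    by (rule contractive_derivations_inner[OF contr])
  then show ?thesis
    using that by (auto simp: inner_derivation_def mns_def)
qed

text \<open>When the right action is zero, the identity map is a derivation, and an element that
  implements it is a right unit.\<close>

lemma contractive_right_unit:
  assumes "contractive A"
  obtains e where "e \<in> carr A" "\<And>a. a \<in> carr A \<Longrightarrow> tms A a e = a"
proof -
  interpret banach_algebra A using assms by (simp add: contractive_def)
  obtain e where e: "e \<in> carr A" "\<And>a. a \<in> carr A \<Longrightarrow> a = mns A (tms A a e) (scl A 0 e)"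
  proof (rule contractive_kernel_derivation[OF assms, where h = "\<lambda>_. 0" and D = "\<lambda>a. a" and C = 1])
    show "multiplicative_functional A (\<lambda>_. 0)"
      unfolding multiplicative_functional_def by (auto intro!: exI[of _ 0])
    show "tms A a b = pls A (scl A 0 a) (tms A a b)" if "a \<in> carr A" "b \<in> carr A" for a b
      using that by (simp add: scale_zero_left mult_closed add_zero)
  qed auto
  have "tms A a e = a" if "a \<in> carr A" for a
    using e(2)[OF that] e(1) that by (simp add: scale_zero_left mns_def scale_zero add_zero_right mult_closed)
  then show ?thesis using that e by blast
qed

text \<open>\<open>D\<close> is the inner derivation of \<open>u\<close>, but \<open>u\<close> lies
  outside the kernel of \<open>h\<close>. Contractivity implements \<open>D\<close> by some
  \<open>x\<close> inside the kernel as well; on \<open>u - x\<close> the left action then agrees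
  with the scalar action through \<open>h\<close>, while \<open>h\<close> still takes the value
  1.\<close>

lemma contractive_eigenvector:
  assumes contr: "contractive A" and h: "multiplicative_functional A h" and u: "u \<in> carr A" "h u = 1"
  obtains p where "p \<in> carr A" "h p = 1" "\<And>a. a \<in> carr A \<Longrightarrow> tms A a p = scl A (h a) p"
proof -
  interpret banach_algebra A using contr by (simp add: contractive_def)
  note h_add = multiplicative_functionalD(1)[OF h] and h_scale = multiplicative_functionalD(2)[OF h]
    and h_mult = multiplicative_functionalD(3)[OF h]
  obtain Ch where h_bounded: "\<And>a. a \<in> carr A \<Longrightarrow> cmod (h a) \<le> Ch * nrm A a"
    using multiplicative_functionalD(4)[OF h] by blast
  obtain Cm where Cm: "\<And>a b. a \<in> carr A \<Longrightarrow> b \<in> carr A \<Longrightarrow> nrm A (tms A a b) \<le> Cm * nrm A a * nrm A b"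
    using mult_bounded by metis
  define D where "D a = mns A (tms A a u) (scl A (h a) u)" for a
  have D_closed: "D a \<in> carr A" if "a \<in> carr A" for a
    using that u by (simp add: D_def closed mult_closed)
  have "\<exists>x\<in>carr A. h x = 0 \<and> (\<forall>a\<in>carr A. D a = mns A (tms A a x) (scl A (h a) x))"
  proof (rule contractive_kernel_derivation[OF contr h, where D = D and C = "Cm * nrm A u + Ch * nrm A u"])
    fix a assume a: "a \<in> carr A"
    then show "D a \<in> carr A" by (rule D_closed)
    show "h (D a) = 0"
      using a u by (simp add: D_def mns_def h_add h_scale h_mult closed mult_closed)
    show "D (scl A k a) = scl A k (D a)" for k
      using a u by (simp add: D_def scale_diff closed mult_closed mult_scale_left h_scale scale_scale)
    show "nrm A (D a) \<le> (Cm * nrm A u + Ch * nrm A u) * nrm A a"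
    proof -
      have "nrm A (D a) \<le> nrm A (tms A a u) + nrm A (scl A (- 1) (scl A (h a) u))"
        unfolding D_def mns_def using a u by (intro norm_triangle) (auto simp: closed mult_closed)
      also have "nrm A (scl A (- 1) (scl A (h a) u)) = cmod (h a) * nrm A u"
        using u by (simp add: norm_scale closed)
      also have "\<dots> \<le> Ch * nrm A a * nrm A u"
        using h_bounded[OF a] u norm_nonneg by (intro mult_right_mono) auto
      finally show ?thesis using Cm[OF a u(1)] by (simp add: algebra_simps)
    qed
    fix b assume b: "b \<in> carr A"
    show "D (pls A a b) = pls A (D a) (D b)"
      using a b u by (simp add: D_def h_add mult_add_left scale_add_left add_diff_add closed mult_closed)
    have "pls A (scl A (h b) (D a)) (tms A a (D b)) =
        pls A (mns A (scl A (h b) (tms A a u)) (scl A (h a * h b) u))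
              (mns A (tms A a (tms A b u)) (scl A (h b) (tms A a u)))"
      using a b u by (simp add: D_def mns_def mult_add_right scale_add_right mult_scale_right scale_scale
          closed mult_closed mult.commute)
    also have "\<dots> = mns A (tms A a (tms A b u)) (scl A (h a * h b) u)"
      using a b u by (intro diff_add_diff) (auto simp: closed mult_closed)
    also have "\<dots> = D (tms A a b)"
      using a b u by (simp add: D_def mult_assoc h_mult)
    finally show "D (tms A a b) = pls A (scl A (h b) (D a)) (tms A a (D b))" by simp
  qed auto
  then obtain x where x: "x \<in> carr A" "h x = 0"
    and Dx: "\<And>a. a \<in> carr A \<Longrightarrow> D a = mns A (tms A a x) (scl A (h a) x)" by blast
  show ?thesis
  proof (rule that[of "mns A u x"])
    show "mns A u x \<in> carr A" using u x by (simp add: closed)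
    show "h (mns A u x) = 1" using u x by (simp add: mns_def h_add h_scale closed)
    fix a assume a: "a \<in> carr A"
    \<comment> \<open>Swaps the inner terms: it turns \<open>a u - h(a) u = a x - h(a) x\<close>
      into \<open>a u - a x = h(a) u - h(a) x\<close>.\<close>
    have *: "mns A p q = mns A r s" if "p \<in> carr A" "q \<in> carr A" "r \<in> carr A" "s \<in> carr A"
      "mns A p r = mns A q s" for p q r s
    proof -
      have "mns A p q = pls A (mns A r q) (mns A p r)"
        using that by (intro diff_add_diff[symmetric])
      also have "\<dots> = pls A (mns A r q) (mns A q s)" using that by simp
      also have "\<dots> = pls A (mns A q s) (mns A r q)" using that by (intro add_commute) (auto simp: closed)
      also have "\<dots> = mns A r s" using that by (simp add: diff_add_diff)
      finally show ?thesis .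
    qed
    have "mns A (tms A a u) (tms A a x) = mns A (scl A (h a) u) (scl A (h a) x)"
      using Dx[OF a] a u x by - (rule *, auto simp: D_def closed mult_closed)
    then show "tms A a (mns A u x) = scl A (h a) (mns A u x)"
      using a u x by (simp add: mns_def mult_add_right mult_scale_right scale_add_right scale_scale closed mult_closed
          mult.commute)
  qed
qed

section \<open>From Banach algebras to normed rings\<close>

definition ring_of :: "('a, 'z) calg_scheme \<Rightarrow> 'a \<Rightarrow> 'a ring"
  where "ring_of A e = \<lparr>carrier = carr A, mult = tms A, one = e, zero = zer A, add = pls A\<rparr>"

lemma ring_of_simps [simp]:
  "carrier (ring_of A e) = carr A" "x \<otimes>\<^bsub>ring_of A e\<^esub> y = tms A x y" "\<one>\<^bsub>ring_of A e\<^esub> = e"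
  "\<zero>\<^bsub>ring_of A e\<^esub> = zer A" "x \<oplus>\<^bsub>ring_of A e\<^esub> y = pls A x y"
  by (simp_all add: ring_of_def)

text \<open>The product is only bounded by some constant \<open>C\<close>. Multiplying the norm by
  \<open>C\<close> makes it submultiplicative, and \<open>C \<ge> 1\<close> keeps it
  definite.\<close>

lemma complex_banach_ring_of:
  assumes "banach_algebra A" and comm: "\<And>a b. a \<in> carr A \<Longrightarrow> b \<in> carr A \<Longrightarrow> tms A a b = tms A b a"
    and e: "e \<in> carr A" "\<And>a. a \<in> carr A \<Longrightarrow> tms A a e = a"
  obtains C where "complex_banach_ring (ring_of A e) (\<lambda>c. scl A c e) (\<lambda>a. C * nrm A a)"
proof -
  interpret banach_algebra A by fact
  obtain C0 where C0: "\<And>a b. a \<in> carr A \<Longrightarrow> b \<in> carr A \<Longrightarrow> nrm A (tms A a b) \<le> C0 * nrm A a * nrm A b"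
    using mult_bounded by metis
  define C where "C = max 1 C0"
  have C: "1 \<le> C" "nrm A (tms A a b) \<le> C * nrm A a * nrm A b" if "a \<in> carr A" "b \<in> carr A" for a b
  proof -
    have "C0 * nrm A a * nrm A b \<le> C * nrm A a * nrm A b"
      unfolding C_def using that norm_nonneg by (intro mult_right_mono) auto
    then show "nrm A (tms A a b) \<le> C * nrm A a * nrm A b" using C0[OF that] by linarith
  qed (simp add: C_def)
  have C1: "1 \<le> C" by (simp add: C_def)
  let ?R = "ring_of A e"
  interpret R: cring ?R
  proof (rule cringI)
    show "abelian_group ?R"
    proof (rule abelian_groupI)
      fix x assume "x \<in> carrier ?R"
      then show "\<exists>y\<in>carrier ?R. y \<oplus>\<^bsub>?R\<^esub> x = \<zero>\<^bsub>?R\<^esub>"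
        using minus_self[of x] by (auto intro!: bexI[of _ "scl A (- 1) x"] simp: closed mns_def add_commute)
    qed (auto simp: closed add_assoc add_zero intro: add_commute)
    show "comm_monoid ?R"
      by (rule comm_monoidI) (auto simp: mult_closed e mult_assoc comm[of e] intro: comm)
  qed (auto simp: mult_add_left)
  have minus: "a_minus ?R x y = mns A x y" if "x \<in> carr A" "y \<in> carr A" for x y
  proof -
    have "\<ominus>\<^bsub>?R\<^esub> y = scl A (- 1) y"
      using minus_self[of y] that by (intro R.minus_equality) (auto simp: closed mns_def add_commute)
    then show ?thesis by (simp add: a_minus_def mns_def)
  qed
  have "complex_banach_ring ?R (\<lambda>c. scl A c e) (\<lambda>a. C * nrm A a)"
  proof unfold_locales
    show "C * nrm A (x \<otimes>\<^bsub>?R\<^esub> y) \<le> C * nrm A x * (C * nrm A y)" if "x \<in> carrier ?R" "y \<in> carrier ?R" for x y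
    proof -
      have "C * nrm A (tms A x y) \<le> C * (C * nrm A x * nrm A y)"
        using C(2)[of x y] that C1 by (intro mult_left_mono) auto
      then show ?thesis by (simp add: mult_ac)
    qed
    show "C * nrm A (x \<oplus>\<^bsub>?R\<^esub> y) \<le> C * nrm A x + C * nrm A y" if "x \<in> carrier ?R" "y \<in> carrier ?R" for x y
      using norm_triangle[of x y] that C1 by (simp add: distrib_left[symmetric])
    show "C * nrm A (scl A c e \<otimes>\<^bsub>?R\<^esub> x) = cmod c * (C * nrm A x)" if "x \<in> carrier ?R" for c x
      using that e comm[of x e] by (simp add: mult_scale_left norm_scale mult_closed)
    show "x = \<zero>\<^bsub>?R\<^esub>" if "x \<in> carrier ?R" "C * nrm A x = 0" for x
      using that C1 norm_eq_zero by auto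
    show "\<exists>x\<in>carrier ?R. (\<lambda>n. C * nrm A (a_minus ?R (s n) x)) \<longlonglongrightarrow> 0"
      if s: "\<And>n. s n \<in> carrier ?R"
        and cau: "\<And>d. 0 < d \<Longrightarrow> \<exists>K. \<forall>m\<ge>K. \<forall>n\<ge>K. C * nrm A (a_minus ?R (s m) (s n)) < d"
      for s :: "nat \<Rightarrow> 'a"
    proof -
      have "\<exists>K. \<forall>m\<ge>K. \<forall>n\<ge>K. nrm A (mns A (s m) (s n)) < d" if "0 < d" for d
        using cau[of "C * d"] that C1 s by (simp add: minus)
      then have "\<exists>x\<in>carr A. (\<lambda>n. nrm A (mns A (s n) x)) \<longlonglongrightarrow> 0"
        using s by (intro complete) auto
      then obtain x where x: "x \<in> carr A" "(\<lambda>n. nrm A (mns A (s n) x)) \<longlonglongrightarrow> 0" by blast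
      then show ?thesis
        using s tendsto_mult_right_zero[OF x(2), of C] by (intro bexI[of _ x]) (auto simp: minus)
    qed
  qed (use C1 in \<open>auto simp: e closed scale_add_left scale_one norm_nonneg mult_scale_left mult_scale_right scale_scale mult.commute\<close>)
  then show ?thesis by (rule that)
qed

text \<open>An operator of finite rank, stored as coefficient functions paired with spanning
  vectors, so that sums and products of such operators become list operations. The dimension count
  evaluates the coefficient functions at finitely many arguments only.\<close>

definition lincomb :: "('a, 'z) cnormed_scheme \<Rightarrow> (('x \<Rightarrow> complex) \<times> 'a) list \<Rightarrow> 'x \<Rightarrow> 'a"
  where "lincomb A L x = foldr (\<lambda>(k, b). pls A (scl A (k x) b)) L (zer A)"

lemma lincomb_simps [simp]:
  "lincomb A [] x = zer A" "lincomb A ((k, b) # L) x = pls A (scl A (k x) b) (lincomb A L x)"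
  by (simp_all add: lincomb_def)

lemma (in complex_normed) lincomb_closed: "snd ` set L \<subseteq> carr X \<Longrightarrow> lincomb X L x \<in> carr X"
  by (induction L) (auto simp: closed)

lemma (in complex_normed) lincomb_append:
  "snd ` set L \<subseteq> carr X \<Longrightarrow> snd ` set L' \<subseteq> carr X \<Longrightarrow>
    lincomb X (L @ L') x = pls X (lincomb X L x) (lincomb X L' x)"
  by (induction L) (auto simp: closed lincomb_closed add_zero add_assoc)

lemma (in banach_algebra) mult_lincomb:
  "a \<in> carr A \<Longrightarrow> snd ` set L \<subseteq> carr A \<Longrightarrow>
    tms A a (lincomb A L x) = lincomb A (map (\<lambda>(k, b). (k, tms A a b)) L) x"
proof (induction L)
  case Nil
  then show ?case using mult_scale_right[of a "zer A" 0] by (simp add: closed mult_closed scale_zero_left)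
next
  case (Cons p L)
  then show ?case by (cases p) (auto simp: closed mult_closed lincomb_closed mult_add_right mult_scale_right)
qed

definition finite_rank :: "('a, 'z) calg_scheme \<Rightarrow> 'a \<Rightarrow> bool"
  where "finite_rank A a \<longleftrightarrow>
    (\<exists>L. snd ` set L \<subseteq> carr A \<and> (\<forall>x\<in>carr A. tms A a x = lincomb A L x))"

lemma contractive_commutative_unit_finite_rank:
  assumes contr: "contractive A"
    and comm: "\<And>a b. a \<in> carr A \<Longrightarrow> b \<in> carr A \<Longrightarrow> tms A a b = tms A b a"
    and e: "e \<in> carr A" "\<And>a. a \<in> carr A \<Longrightarrow> tms A a e = a"
  shows "finite_rank A e"
proof (rule ccontr)
  assume nfr: "\<not> finite_rank A e"
  interpret banach_algebra A using contr by (simp add: contractive_def)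
  obtain C where "complex_banach_ring (ring_of A e) (\<lambda>c. scl A c e) (\<lambda>a. C * nrm A a)"
    using complex_banach_ring_of[OF banach_algebra_axioms comm e] by blast
  then interpret R: complex_banach_ring "ring_of A e" "\<lambda>c. scl A c e" "\<lambda>a. C * nrm A a" .
  define J where "J = {a \<in> carr A. finite_rank A a}"
  have ideal_J: "ideal J (ring_of A e)"
  proof (rule R.ideal_criterion)
    have "tms A (zer A) x = lincomb A [] x" if "x \<in> carr A" for x
      using mult_scale_left[of "zer A" x 0] that by (simp add: closed mult_closed scale_zero_left)
    then show "\<zero>\<^bsub>ring_of A e\<^esub> \<in> J"
      unfolding J_def finite_rank_def by (auto simp: closed intro!: exI[of _ "[]"])
    show "x \<oplus>\<^bsub>ring_of A e\<^esub> y \<in> J" if "x \<in> J" "y \<in> J" for x y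
    proof -
      from that obtain L L' where *: "x \<in> carr A" "y \<in> carr A" "snd ` set L \<subseteq> carr A" "snd ` set L' \<subseteq> carr A"
        "\<And>z. z \<in> carr A \<Longrightarrow> tms A x z = lincomb A L z" "\<And>z. z \<in> carr A \<Longrightarrow> tms A y z = lincomb A L' z"
        unfolding J_def finite_rank_def by auto
      have "finite_rank A (pls A x y)"
        unfolding finite_rank_def
      proof (intro exI conjI ballI)
        show "snd ` set (L @ L') \<subseteq> carr A" using * by (simp add: image_Un)
        show "tms A (pls A x y) z = lincomb A (L @ L') z" if "z \<in> carr A" for z
          using that * by (simp add: mult_add_left lincomb_append)
      qed
      then show ?thesis using * by (simp add: J_def closed)
    qed
    show "x \<otimes>\<^bsub>ring_of A e\<^esub> y \<in> J" if "x \<in> carrier (ring_of A e)" "y \<in> J" for x y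
    proof -
      from that obtain L where *: "x \<in> carr A" "y \<in> carr A" "snd ` set L \<subseteq> carr A"
        "\<And>z. z \<in> carr A \<Longrightarrow> tms A y z = lincomb A L z"
        unfolding J_def finite_rank_def by auto
      have "finite_rank A (tms A x y)"
        unfolding finite_rank_def
      proof (intro exI conjI ballI)
        show "snd ` set (map (\<lambda>(k, b). (k, tms A x b)) L) \<subseteq> carr A"
          using * that(1) by (force simp: mult_closed)
        show "tms A (tms A x y) z = lincomb A (map (\<lambda>(k, b). (k, tms A x b)) L) z" if "z \<in> carr A" for z
          using that * \<open>x \<in> carrier (ring_of A e)\<close> by (simp add: mult_assoc mult_lincomb)
      qed
      then show ?thesis using * that(1) by (simp add: J_def mult_closed)
    qed
  qed (auto simp: J_def)
  have "\<one>\<^bsub>ring_of A e\<^esub> \<notin> J" using nfr by (simp add: J_def)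
  from R.exists_maximalideal[OF ideal_J this]
  obtain M where M: "maximalideal M (ring_of A e)" "J \<subseteq> M" .
  obtain h where h: "\<And>a b. a \<in> carr A \<Longrightarrow> b \<in> carr A \<Longrightarrow> h (pls A a b) = h a + h b"
    "\<And>a b. a \<in> carr A \<Longrightarrow> b \<in> carr A \<Longrightarrow> h (tms A a b) = h a * h b"
    "\<And>c. h (scl A c e) = c" "\<And>a. a \<in> M \<Longrightarrow> h a = 0" "\<And>a. a \<in> carr A \<Longrightarrow> cmod (h a) \<le> C * nrm A a"
    using R.maximalideal_character[OF M(1)] unfolding ring_of_simps by blast
  have h_scale: "h (scl A k a) = k * h a" if "a \<in> carr A" for k a
  proof -
    have "scl A k a = tms A (scl A k e) a"
      using that e comm[of e a] by (simp add: mult_scale_left)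
    then show ?thesis using that e h(2,3) by (simp add: closed)
  qed
  have mf: "multiplicative_functional A h"
    unfolding multiplicative_functional_def
    by (intro conjI ballI allI exI[of _ C]) (simp_all add: h h_scale)
  have "h e = 1" using h(3)[of 1] e by (simp add: scale_one)
  then obtain p where p: "p \<in> carr A" "h p = 1" "\<And>a. a \<in> carr A \<Longrightarrow> tms A a p = scl A (h a) p"
    using contractive_eigenvector[OF contr mf e(1)] by blast
  \<comment> \<open>Multiplication by \<open>p\<close> maps onto multiples of \<open>p\<close>
    alone, with coefficient function \<open>h\<close>, so \<open>p\<close> belongs to the ideal
    \<open>J\<close>.\<close>
  have "tms A p x = lincomb A [(h, p)] x" if "x \<in> carr A" for x
    using p comm[of p x] that by (simp add: closed add_zero_right)
  then have "p \<in> J"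
    unfolding J_def finite_rank_def using p by (auto intro!: exI[of _ "[(h, p)]"])
  then show False using M(2) h(4)[of p] p(2) by auto
qed

text \<open>Gaussian elimination: a row \<open>i\<close> with nonzero entry in column
  \<open>k\<close> clears that column from the other rows, and the induction hypothesis applies to
  what remains.\<close>

lemma linear_dependence:
  fixes v :: "'j \<Rightarrow> 'k \<Rightarrow> 'f::field"
  assumes "finite K" "finite J" "card K < card J"
  shows "\<exists>c. (\<exists>j\<in>J. c j \<noteq> 0) \<and> (\<forall>k\<in>K. (\<Sum>j\<in>J. c j * v j k) = 0)"
  using assms
proof (induction K arbitrary: J v rule: finite_induct)
  case empty
  then have "J \<noteq> {}" by auto
  then show ?case by (intro exI[of _ "\<lambda>_. 1"]) auto
next
  case (insert k K)
  show ?case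
  proof (cases "\<forall>j\<in>J. v j k = 0")
    case True
    then show ?thesis using insert.IH[of J v] insert.prems insert.hyps by auto
  next
    case False
    then obtain i where i: "i \<in> J" "v i k \<noteq> 0" by blast
    define w where "w j l = v j l - v j k / v i k * v i l" for j l
    have "card K < card (J - {i})" using insert.prems insert.hyps i by simp
    then obtain c where c: "\<exists>j\<in>J - {i}. c j \<noteq> 0" "\<And>l. l \<in> K \<Longrightarrow> (\<Sum>j\<in>J - {i}. c j * w j l) = 0"
      using insert.IH[of "J - {i}" w] insert.prems by blast
    define d where "d = c(i := - (\<Sum>j\<in>J - {i}. c j * v j k / v i k))"
    have sum_d: "(\<Sum>j\<in>J. d j * v j l) = (\<Sum>j\<in>J - {i}. c j * w j l)" for l
    proof -
      have "(\<Sum>j\<in>J. d j * v j l) = d i * v i l + (\<Sum>j\<in>J - {i}. d j * v j l)"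
        using insert.prems i by (simp add: sum.remove)
      also have "(\<Sum>j\<in>J - {i}. d j * v j l) = (\<Sum>j\<in>J - {i}. c j * v j l)"
        by (intro sum.cong) (auto simp: d_def)
      finally show ?thesis
        by (simp add: d_def w_def right_diff_distrib sum_subtractf sum_distrib_right mult.assoc)
    qed
    have "w j k = 0" for j using i by (simp add: w_def)
    then have "\<forall>l\<in>insert k K. (\<Sum>j\<in>J. d j * v j l) = 0" using c(2) by (auto simp: sum_d)
    moreover have "\<exists>j\<in>J. d j \<noteq> 0" using c(1) by (auto simp: d_def)
    ultimately show ?thesis by blast
  qed
qed

text \<open>\<open>d\<close> is the family of point masses, and \<open>T F\<close> is a family of
  functionals dual to it on the finite set \<open>F\<close>. The dual family may depend on
  \<open>F\<close>, because the contradiction takes place inside one finite set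
  \<open>J\<close>.\<close>

theorem contractive_commutative_finite:
  fixes A :: "('a, 'z) calg_scheme" and d :: "'i \<Rightarrow> 'a" and T :: "'i set \<Rightarrow> 'i \<Rightarrow> 'a \<Rightarrow> complex"
  assumes contr: "contractive A"
    and comm: "\<And>a b. a \<in> carr A \<Longrightarrow> b \<in> carr A \<Longrightarrow> tms A a b = tms A b a"
    and d: "\<And>i. d i \<in> carr A"
    and T_add: "\<And>F i a b. a \<in> carr A \<Longrightarrow> b \<in> carr A \<Longrightarrow> T F i (pls A a b) = T F i a + T F i b"
    and T_scale: "\<And>F i k a. a \<in> carr A \<Longrightarrow> T F i (scl A k a) = k * T F i a"
    and dual: "\<And>F i j. finite F \<Longrightarrow> i \<in> F \<Longrightarrow> j \<in> F \<Longrightarrow> T F i (d j) = of_bool (i = j)"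
  shows "finite (UNIV :: 'i set)"
proof (rule ccontr)
  assume "infinite (UNIV :: 'i set)"
  interpret banach_algebra A using contr by (simp add: contractive_def)
  obtain e where e: "e \<in> carr A" "\<And>a. a \<in> carr A \<Longrightarrow> tms A a e = a"
    using contractive_right_unit[OF contr] by blast
  obtain L where L: "snd ` set L \<subseteq> carr A" "\<And>x. x \<in> carr A \<Longrightarrow> tms A e x = lincomb A L x"
    using contractive_commutative_unit_finite_rank[OF contr comm e] unfolding finite_rank_def by blast
  obtain J :: "'i set" where J: "finite J" "card J = Suc (length L)"
    using infinite_arbitrarily_large[OF \<open>infinite (UNIV :: 'i set)\<close>] by blast
  \<comment> \<open>There is one index more than there are spanning vectors, so some nontrivial
    combination of the \<open>d j\<close> has all its coefficients in the expansion by
    \<open>L\<close> equal to zero. Applying \<open>T J i\<close> then gives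
    \<open>c i = 0\<close>.\<close>
  obtain c where c: "\<exists>j\<in>J. c j \<noteq> 0" "\<And>k. k < length L \<Longrightarrow> (\<Sum>j\<in>J. c j * fst (L ! k) (d j)) = 0"
    using linear_dependence[of "{..<length L}" J "\<lambda>j k. fst (L ! k) (d j)"] J by auto
  have T_lincomb: "T J i (lincomb A M x) = (\<Sum>k<length M. fst (M ! k) x * T J i (snd (M ! k)))"
    if "snd ` set M \<subseteq> carr A" for M x i
    using that
  proof (induction M)
    case Nil
    then show ?case using T_scale[of "zer A" J i 0] by (simp add: closed scale_zero_left)
  next
    case (Cons p M)
    then show ?case
      by (cases p) (simp add: T_add T_scale closed lincomb_closed lessThan_Suc_eq_insert_0 sum.reindex)
  qed
  have "c i = 0" if i: "i \<in> J" for i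
  proof -
    have "of_bool (i = j) = (\<Sum>k<length L. fst (L ! k) (d j) * T J i (snd (L ! k)))" if "j \<in> J" for j
    proof -
      have "d j = lincomb A L (d j)" using L(2)[OF d[of j]] e(2)[OF d[of j]] comm[OF e(1) d[of j]] by simp
      then show ?thesis using T_lincomb[OF L(1), of i "d j"] dual[OF J(1) i that] by simp
    qed
    then have "(\<Sum>j\<in>J. c j * of_bool (i = j)) =
        (\<Sum>j\<in>J. c j * (\<Sum>k<length L. fst (L ! k) (d j) * T J i (snd (L ! k))))"
      by (intro sum.cong) auto
    also have "\<dots> = (\<Sum>k<length L. (\<Sum>j\<in>J. c j * fst (L ! k) (d j)) * T J i (snd (L ! k)))"
      by (simp only: sum_distrib_left sum_distrib_right mult.assoc) (rule sum.swap)
    also have "\<dots> = 0" using c(2) by simp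
    finally show ?thesis using i J(1) by (simp add: of_bool_def if_distrib cong: if_cong)
  qed
  then show False using c(1) by blast
qed

section \<open>Group algebras of finite groups\<close>

text \<open>Only the additive structure carries meaning; it makes \<open>finsum\<close> available
  for finite sums in \<open>X\<close>.\<close>

definition add_of :: "('x, 'z) cnormed_scheme \<Rightarrow> 'x ring"
  where "add_of X = \<lparr>carrier = carr X, mult = undefined, one = undefined, zero = zer X, add = pls X\<rparr>"

lemma add_of_simps [simp]:
  "carrier (add_of X) = carr X" "\<zero>\<^bsub>add_of X\<^esub> = zer X" "x \<oplus>\<^bsub>add_of X\<^esub> y = pls X x y"
  by (simp_all add: add_of_def)

context complex_normed
begin

lemma abelian_group_add_of: "abelian_group (add_of X)"
proof (rule abelian_groupI)
  fix x assume "x \<in> carrier (add_of X)"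
  then show "\<exists>y\<in>carrier (add_of X). y \<oplus>\<^bsub>add_of X\<^esub> x = \<zero>\<^bsub>add_of X\<^esub>"
    using minus_self[of x] by (auto intro!: bexI[of _ "scl X (- 1) x"] simp: closed mns_def add_commute)
qed (auto simp: closed add_assoc add_zero intro: add_commute)

interpretation G: abelian_group "add_of X" by (rule abelian_group_add_of)

abbreviation vsum :: "('i \<Rightarrow> 'x) \<Rightarrow> 'i set \<Rightarrow> 'x"
  where "vsum \<equiv> finsum (add_of X)"

lemma vsum_closed: "(\<And>i. f i \<in> carr X) \<Longrightarrow> vsum f S \<in> carr X"
  using G.finsum_closed[of f S] by simp

lemma vsum_add:
  "(\<And>i. f i \<in> carr X) \<Longrightarrow> (\<And>i. g i \<in> carr X) \<Longrightarrow> vsum (\<lambda>i. pls X (f i) (g i)) S = pls X (vsum f S) (vsum g S)"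
  using G.finsum_addf[of f S g] by simp

lemma vsum_map:
  assumes "\<And>x. x \<in> carr X \<Longrightarrow> F x \<in> carr X" "F (zer X) = zer X"
    and "\<And>x y. x \<in> carr X \<Longrightarrow> y \<in> carr X \<Longrightarrow> F (pls X x y) = pls X (F x) (F y)"
    and "\<And>i. f i \<in> carr X" "finite S"
  shows "F (vsum f S) = vsum (\<lambda>i. F (f i)) S"
  using assms(5)
proof (induction S rule: finite_induct)
  case (insert i S)
  then show ?case using assms(1-4) vsum_closed[of f S] by simp
qed (use assms in simp)

lemma vsum_const:
  assumes "c \<in> carr X" "finite S"
  shows "vsum (\<lambda>_. c) S = scl X (of_nat (card S)) c"
  using assms(2)
proof (induction S rule: finite_induct)
  case (insert i S)
  then show ?case
    using assms(1) scale_add_left[of c 1 "of_nat (card S)"] by (simp add: scale_one)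
qed (use assms in \<open>simp add: scale_zero_left\<close>)

lemma vsum_translate:
  fixes f :: "'g::group_add \<Rightarrow> 'x"
  assumes "\<And>i. f i \<in> carr X"
  shows "vsum (\<lambda>i. f (h + i)) UNIV = vsum f UNIV"
proof -
  have "inj ((+) h)" "range ((+) h) = UNIV"
    by (auto simp: surj_plus)
  then show ?thesis
    using G.finsum_reindex[of f "(+) h" UNIV] assms by simp
qed

end

text \<open>The average \<open>x\<close> of \<open>d g D(d (- g))\<close> implements the part of
  \<open>D\<close> seen by the unit, as for finite groups acting on modules. The assumption
  \<open>span\<close> states spanning as an induction rule, which fits a carrier without a span
  operator.\<close>

lemma group_algebra_derivation_inner:
  fixes A :: "('a, 'z) calg_scheme" and X :: "('x, 'y) cnormed_scheme" and d :: "'g::ab_group_add \<Rightarrow> 'a"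
  assumes bim: "banach_bimodule A X l r" and der: "continuous_derivation A X l r D"
    and fin: "finite (UNIV :: 'g set)" and d: "\<And>g. d g \<in> carr A" "\<And>g h. tms A (d g) (d h) = d (g + h)"
    and unit: "\<And>a. a \<in> carr A \<Longrightarrow> tms A (d 0) a = a" "\<And>a. a \<in> carr A \<Longrightarrow> tms A a (d 0) = a"
    and span: "\<And>V. (\<And>g. d g \<in> V) \<Longrightarrow> (\<And>a b. a \<in> V \<Longrightarrow> b \<in> V \<Longrightarrow> pls A a b \<in> V) \<Longrightarrow>
      (\<And>k a. a \<in> V \<Longrightarrow> scl A k a \<in> V) \<Longrightarrow> V \<subseteq> carr A \<Longrightarrow> carr A \<subseteq> V"
  shows "inner_derivation A X l r D"
proof -
  interpret banach_bimodule A X l r by (rule bim)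
  have D_closed: "a \<in> carr A \<Longrightarrow> D a \<in> carr X"
    and D_add: "a \<in> carr A \<Longrightarrow> b \<in> carr A \<Longrightarrow> D (pls A a b) = pls X (D a) (D b)"
    and D_scale: "a \<in> carr A \<Longrightarrow> D (scl A k a) = scl X k (D a)"
    and D_mult: "a \<in> carr A \<Longrightarrow> b \<in> carr A \<Longrightarrow> D (tms A a b) = pls X (r (D a) b) (l a (D b))" for a b k
    using der by (auto simp: continuous_derivation_def)
  have zero: "r (zer X) a = zer X" "l a (zer X) = zer X" if "a \<in> carr A" for a
    using r_scale[OF that X.zero_closed, of 0] l_scale[OF that X.zero_closed, of 0] that
    by (simp_all add: X.scale_zero X.scale_zero_left r_closed l_closed X.zero_closed)
  have diff: "l a (mns X x y) = mns X (l a x) (l a y)" "r (mns X x y) a = mns X (r x a) (r y a)"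
    if "a \<in> carr A" "x \<in> carr X" "y \<in> carr X" for a x y
    using that by (simp_all add: mns_def l_add l_scale r_add r_scale X.scale_closed)
  let ?e = "d 0" and ?n = "of_nat (card (UNIV :: 'g set)) :: complex"
  define S where "S = X.vsum (\<lambda>g. l (d g) (D (d (- g)))) UNIV"
  have S: "S \<in> carr X" unfolding S_def by (intro X.vsum_closed l_closed d D_closed)
  \<comment> \<open>Translating the index by \<open>h\<close> turns the terms into
    \<open>d g D(d (h - g))\<close>. Since \<open>d (h - g)\<close> is the product of
    \<open>d (- g)\<close> and \<open>d h\<close>, the derivation rule splits each term into one of
    \<open>S d h\<close> and one copy of \<open>e D(d h)\<close>, with \<open>e\<close> the
    unit.\<close>
  have lS: "l (d h) S = pls X (r S (d h)) (scl X ?n (l ?e (D (d h))))" for h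
  proof -
    have "l (d h) S = X.vsum (\<lambda>g. l (d h) (l (d g) (D (d (- g))))) UNIV"
      unfolding S_def using fin by (intro X.vsum_map) (auto simp: l_closed l_add d D_closed zero)
    also have "\<dots> = X.vsum (\<lambda>g. l (d (h + g)) (D (d (h - (h + g))))) UNIV"
      by (simp add: l_mult[symmetric] d D_closed)
    also have "\<dots> = X.vsum (\<lambda>g. l (d g) (D (d (h - g)))) UNIV"
      by (intro X.vsum_translate l_closed d D_closed)
    also have "\<dots> = X.vsum (\<lambda>g. pls X (r (l (d g) (D (d (- g)))) (d h)) (l ?e (D (d h)))) UNIV"
    proof -
      have "l (d g) (D (d (h - g))) = pls X (r (l (d g) (D (d (- g)))) (d h)) (l ?e (D (d h)))" for g
      proof -
        have "D (d (h - g)) = pls X (r (D (d (- g))) (d h)) (l (d (- g)) (D (d h)))"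
          using D_mult[of "d (- g)" "d h"] by (simp add: d)
        then show ?thesis
          by (simp add: l_add l_r d D_closed l_closed r_closed l_mult[symmetric])
      qed
      then show ?thesis by simp
    qed
    also have "\<dots> = pls X (X.vsum (\<lambda>g. r (l (d g) (D (d (- g)))) (d h)) UNIV) (scl X ?n (l ?e (D (d h))))"
      using fin by (subst X.vsum_add) (auto simp: X.vsum_const d D_closed l_closed r_closed)
    also have "X.vsum (\<lambda>g. r (l (d g) (D (d (- g)))) (d h)) UNIV = r S (d h)"
      unfolding S_def using fin
      by (intro X.vsum_map[where F = "\<lambda>x. r x (d h)", symmetric]) (auto simp: l_closed r_closed r_add d D_closed zero)
    finally show ?thesis .
  qed
  define x where "x = scl X (1 / ?n) S"
  have n: "?n \<noteq> 0" using fin by simp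
  have x: "x \<in> carr X" using S by (simp add: x_def X.closed)
  have inner_x: "mns X (l (d h) x) (r x (d h)) = l ?e (D (d h))" for h
  proof -
    have "l (d h) x = pls X (r x (d h)) (l ?e (D (d h)))"
      using S n unfolding x_def
      by (simp add: l_scale r_scale d lS X.scale_add_right X.scale_scale X.closed l_closed r_closed D_closed X.scale_one)
    moreover have "r x (d h) \<in> carr X" "l ?e (D (d h)) \<in> carr X" using x d D_closed by (simp_all add: l_closed r_closed)
    ultimately show ?thesis
      using X.add_diff_cancel[of "l ?e (D (d h))" "r x (d h)"] X.add_commute by simp
  qed
  text \<open>The unit of \<open>A\<close> need not act as the identity on \<open>X\<close>; the correction \<open>w\<close> takes care of
    the part of \<open>D\<close> that it annihilates.\<close>
  define w where "w = mns X (D ?e) (l ?e (D ?e))"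
  have w: "w \<in> carr X" by (simp add: w_def X.closed d D_closed l_closed)
  have lw: "l a w = zer X" if "a \<in> carr A" for a
    using that unit(2)[OF that] X.minus_self
    by (simp add: w_def diff d D_closed l_closed l_mult[symmetric])
  have rw: "r w a = mns X (D a) (l ?e (D a))" if a: "a \<in> carr A" for a
  proof -
    have cl: "D a \<in> carr X" "l ?e (D a) \<in> carr X" "r (D ?e) a \<in> carr X" "l ?e (r (D ?e) a) \<in> carr X"
      using a by (simp_all add: d D_closed l_closed r_closed)
    have "D a = pls X (r (D ?e) a) (l ?e (D a))"
      using D_mult[OF d(1)[of 0] a] unit(1)[OF a] by simp
    then have eq: "r (D ?e) a = mns X (D a) (l ?e (D a))"
      using X.add_diff_cancel[OF cl(3,2)] by simp
    have "l ?e (r (D ?e) a) = zer X"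
      unfolding eq using cl by (simp add: diff d l_mult[symmetric] X.minus_self a D_closed)
    then have "r w a = mns X (r (D ?e) a) (zer X)"
      using a by (simp add: w_def diff d D_closed l_closed l_r)
    also have "\<dots> = r (D ?e) a" using cl by (simp add: mns_def X.scale_zero X.add_zero_right)
    finally show ?thesis using eq by simp
  qed
  \<comment> \<open>By \<open>lw\<close> and \<open>rw\<close>, passing from \<open>x\<close> to
    \<open>x - w\<close> leaves the left action alone and adds \<open>D a - e D a\<close>, exactly
    what \<open>inner_x\<close> is missing.\<close>
  define V where "V = {a \<in> carr A. D a = mns X (l a (mns X x w)) (r (mns X x w) a)}"
  have "carr A \<subseteq> V"
  proof (rule span)
    have xw: "mns X x w \<in> carr X" using x w by (simp add: X.closed)
    show "d g \<in> V" for g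
    proof -
      have cl: "l (d g) x \<in> carr X" "r x (d g) \<in> carr X" "D (d g) \<in> carr X" "l ?e (D (d g)) \<in> carr X"
        using x d D_closed l_closed r_closed by auto
      have "mns X (l (d g) (mns X x w)) (r (mns X x w) (d g)) =
          mns X (mns X (l (d g) x) (zer X)) (mns X (r x (d g)) (mns X (D (d g)) (l ?e (D (d g)))))"
        using x w d by (simp add: diff lw rw)
      also have "\<dots> = pls X (mns X (D (d g)) (l ?e (D (d g)))) (mns X (l (d g) x) (r x (d g)))"
        using cl by (simp add: mns_def X.closed X.scale_zero X.add_zero X.add_zero_right X.scale_add_right X.scale_scale
            X.scale_one X.add_assoc X.add_commute X.add_left_commute)
      also have "\<dots> = D (d g)" using cl by (simp add: inner_x X.diff_cancel)
      finally show ?thesis using d by (simp add: V_def)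
    qed
    show "pls A a b \<in> V" if "a \<in> V" "b \<in> V" for a b
    proof -
      have ab: "a \<in> carr A" "b \<in> carr A" using that by (auto simp: V_def)
      then have "D (pls A a b) = pls X (mns X (l a (mns X x w)) (r (mns X x w) a)) (mns X (l b (mns X x w)) (r (mns X x w) b))"
        using that by (simp add: V_def D_add)
      also have "\<dots> = mns X (l (pls A a b) (mns X x w)) (r (mns X x w) (pls A a b))"
        using ab xw by (simp add: add_l add_r X.add_diff_add l_closed r_closed)
      finally show ?thesis using ab by (simp add: V_def A.closed)
    qed
    show "scl A k a \<in> V" if "a \<in> V" for k a
      using that xw unfolding V_def
      by (auto simp: D_scale scale_l scale_r X.scale_diff l_closed r_closed A.closed)
  qed (auto simp: V_def)
  then show ?thesis
    unfolding inner_derivation_def using x w by (intro bexI[of _ "mns X x w"]) (auto simp: V_def X.closed)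
qed

text \<open>Common form of both algebras: \<open>k\<close> reads off the coefficients at the group
  elements. The norm lies between each single coefficient and their absolute sum, so convergence is
  coordinatewise and completeness follows from that of the complex numbers.\<close>

lemma convolution_algebra_contractive:
  fixes A :: "('a, 'z) calg_scheme" and k :: "'a \<Rightarrow> 'g::ab_group_add \<Rightarrow> complex"
  assumes fin: "finite (UNIV :: 'g set)" and bij: "bij_betw k (carr A) UNIV"
    and zer: "zer A \<in> carr A" "k (zer A) = (\<lambda>_. 0)"
    and pls: "\<And>a b. a \<in> carr A \<Longrightarrow> b \<in> carr A \<Longrightarrow> pls A a b \<in> carr A \<and> k (pls A a b) = (\<lambda>g. k a g + k b g)"
    and scl: "\<And>c a. a \<in> carr A \<Longrightarrow> scl A c a \<in> carr A \<and> k (scl A c a) = (\<lambda>g. c * k a g)"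
    and tms: "\<And>a b. a \<in> carr A \<Longrightarrow> b \<in> carr A \<Longrightarrow>
      tms A a b \<in> carr A \<and> k (tms A a b) = (\<lambda>g. \<Sum>h\<in>UNIV. k a h * k b (g - h))"
    and triangle: "\<And>a b. a \<in> carr A \<Longrightarrow> b \<in> carr A \<Longrightarrow> nrm A (pls A a b) \<le> nrm A a + nrm A b"
    and norm_scale: "\<And>c a. a \<in> carr A \<Longrightarrow> nrm A (scl A c a) = cmod c * nrm A a"
    and lower: "\<And>a g. a \<in> carr A \<Longrightarrow> cmod (k a g) \<le> nrm A a"
    and upper: "\<And>a. a \<in> carr A \<Longrightarrow> nrm A a \<le> (\<Sum>g\<in>UNIV. cmod (k a g))"
  shows "contractive A"
proof -
  have eqI: "a = b" if "a \<in> carr A" "b \<in> carr A" "k a = k b" for a b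
    using bij that unfolding bij_betw_def inj_on_def by blast
  have ex: "\<exists>a\<in>carr A. k a = f" for f
    using bij unfolding bij_betw_def by (metis UNIV_I imageE)
  have mns: "mns A a b \<in> carr A" "k (mns A a b) = (\<lambda>g. k a g - k b g)" if "a \<in> carr A" "b \<in> carr A" for a b
    using that by (auto simp: mns_def pls scl)
  have nonneg: "0 \<le> nrm A a" if "a \<in> carr A" for a
    using lower[OF that, of 0] norm_ge_zero order_trans by blast
  have eq_zero: "nrm A a = 0 \<longleftrightarrow> a = zer A" if "a \<in> carr A" for a
  proof
    assume "nrm A a = 0"
    then have "k a = k (zer A)" using lower[OF that] by (auto simp: zer)
    then show "a = zer A" using eqI that zer by blast
  next
    assume "a = zer A"
    then show "nrm A a = 0" using upper[OF zer(1)] nonneg[OF zer(1)] by (simp add: zer)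
  qed
  have assoc: "(\<Sum>h\<in>UNIV. (\<Sum>i\<in>UNIV. u i * v (h - i)) * w (g - h)) = (\<Sum>i\<in>UNIV. u i * (\<Sum>h\<in>UNIV. v h * w (g - i - h)))"
    for u v w :: "'g \<Rightarrow> complex" and g
  proof -
    have "(\<Sum>h\<in>UNIV. (\<Sum>i\<in>UNIV. u i * v (h - i)) * w (g - h)) = (\<Sum>i\<in>UNIV. \<Sum>h\<in>UNIV. u i * (v (h - i) * w (g - h)))"
      by (simp only: sum_distrib_right mult.assoc) (rule sum.swap)
    also have "\<dots> = (\<Sum>i\<in>UNIV. \<Sum>h\<in>UNIV. u i * (v h * w (g - i - h)))"
    proof (rule sum.cong[OF refl])
      fix i
      show "(\<Sum>h\<in>UNIV. u i * (v (h - i) * w (g - h))) = (\<Sum>h\<in>UNIV. u i * (v h * w (g - i - h)))"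
        by (rule sum.reindex_bij_witness[of _ "\<lambda>h. h + i" "\<lambda>h. h - i"]) (auto simp: algebra_simps)
    qed
    finally show ?thesis by (simp only: sum_distrib_left)
  qed
  have normed: "complex_normed A"
  proof
    show "pls A x y = pls A y x" if "x \<in> carr A" "y \<in> carr A" for x y
      using that by (intro eqI) (auto simp: pls add.commute)
    show "mns A x x = zer A" if "x \<in> carr A" for x
      using that by (intro eqI) (auto simp: mns zer)
    show "pls A (pls A x y) z = pls A x (pls A y z)" if "x \<in> carr A" "y \<in> carr A" "z \<in> carr A" for x y z
      using that by (intro eqI) (auto simp: pls add.assoc)
    show "pls A (zer A) x = x" if "x \<in> carr A" for x
      using that by (intro eqI) (auto simp: pls zer)
    show "scl A 1 x = x" if "x \<in> carr A" for x
      using that by (intro eqI) (auto simp: scl)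
    show "scl A a (scl A b x) = scl A (a * b) x" if "x \<in> carr A" for a b x
      using that by (intro eqI) (auto simp: scl mult.assoc)
    show "scl A a (pls A x y) = pls A (scl A a x) (scl A a y)" if "x \<in> carr A" "y \<in> carr A" for a x y
      using that by (intro eqI) (auto simp: scl pls distrib_left)
    show "scl A (a + b) x = pls A (scl A a x) (scl A b x)" if "x \<in> carr A" for a b x
      using that by (intro eqI) (auto simp: scl pls distrib_right)
  qed (auto simp: zer pls scl nonneg triangle norm_scale eq_zero)
  have banach: "complex_banach A"
  proof (intro complex_banach.intro normed complex_banach_axioms.intro)
    fix s :: "nat \<Rightarrow> 'a"
    assume s: "\<forall>n. s n \<in> carr A" and cau: "\<forall>e>0. \<exists>N. \<forall>m\<ge>N. \<forall>n\<ge>N. nrm A (mns A (s m) (s n)) < e"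
    have "\<exists>f. \<forall>g. (\<lambda>n. k (s n) g) \<longlonglongrightarrow> f g"
    proof (rule choice, rule allI)
      fix g
      have "cmod (k (s m) g - k (s n) g) \<le> nrm A (mns A (s m) (s n))" for m n
        using lower[of "mns A (s m) (s n)" g] s by (simp add: mns)
      then have "Cauchy (\<lambda>n. k (s n) g)"
        using cau unfolding Cauchy_def dist_norm by (meson le_less_trans)
      then show "\<exists>c. (\<lambda>n. k (s n) g) \<longlonglongrightarrow> c"
        using Cauchy_convergent_iff convergent_def by blast
    qed
    then obtain f where f: "\<And>g. (\<lambda>n. k (s n) g) \<longlonglongrightarrow> f g" by blast
    obtain x where x: "x \<in> carr A" "k x = f" using ex by blast
    have "(\<lambda>n. \<Sum>g\<in>UNIV. cmod (k (s n) g - k x g)) \<longlonglongrightarrow> (\<Sum>g\<in>(UNIV :: 'g set). cmod (k x g - k x g))"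
      unfolding x(2) by (intro tendsto_intros f)
    then have "(\<lambda>n. \<Sum>g\<in>UNIV. cmod (k (s n) g - k x g)) \<longlonglongrightarrow> 0" by simp
    then have "(\<lambda>n. nrm A (mns A (s n) x)) \<longlonglongrightarrow> 0"
    proof (rule Lim_null_comparison[rotated], intro always_eventually allI)
      fix n
      show "norm (nrm A (mns A (s n) x)) \<le> (\<Sum>g\<in>UNIV. cmod (k (s n) g - k x g))"
        using upper[of "mns A (s n) x"] nonneg[of "mns A (s n) x"] s x by (simp add: mns)
    qed
    then show "\<exists>x\<in>carr A. (\<lambda>n. nrm A (mns A (s n) x)) \<longlonglongrightarrow> 0" using x by blast
  qed
  have alg: "banach_algebra A"
  proof (intro banach_algebra.intro banach banach_algebra_axioms.intro)
    show "tms A (tms A a b) c = tms A a (tms A b c)" if "a \<in> carr A" "b \<in> carr A" "c \<in> carr A" for a b c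
      using that by (intro eqI) (auto simp: tms assoc)
    show "tms A (pls A a b) c = pls A (tms A a c) (tms A b c)" if "a \<in> carr A" "b \<in> carr A" "c \<in> carr A" for a b c
      using that by (intro eqI) (auto simp: tms pls distrib_right sum.distrib)
    show "tms A a (pls A b c) = pls A (tms A a b) (tms A a c)" if "a \<in> carr A" "b \<in> carr A" "c \<in> carr A" for a b c
      using that by (intro eqI) (auto simp: tms pls distrib_left sum.distrib)
    show "tms A (scl A c a) b = scl A c (tms A a b)" if "a \<in> carr A" "b \<in> carr A" for c a b
      using that by (intro eqI) (auto simp: tms scl mult.assoc sum_distrib_left)
    show "tms A a (scl A c b) = scl A c (tms A a b)" if "a \<in> carr A" "b \<in> carr A" for c a b
      using that by (intro eqI) (auto simp: tms scl mult.left_commute sum_distrib_left)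
    show "\<exists>C. \<forall>a\<in>carr A. \<forall>b\<in>carr A. nrm A (tms A a b) \<le> C * nrm A a * nrm A b"
    proof (intro exI ballI)
      fix a b assume ab: "a \<in> carr A" "b \<in> carr A"
      have "nrm A (tms A a b) \<le> (\<Sum>g\<in>(UNIV :: 'g set). cmod (\<Sum>h\<in>UNIV. k a h * k b (g - h)))"
        using upper[of "tms A a b"] ab by (simp add: tms)
      also have "\<dots> \<le> (\<Sum>g\<in>(UNIV :: 'g set). \<Sum>h\<in>(UNIV :: 'g set). nrm A a * nrm A b)"
        using ab lower nonneg
        by (intro sum_mono order_trans[OF norm_sum]) (auto simp: norm_mult intro!: mult_mono)
      finally show "nrm A (tms A a b) \<le> (real (card (UNIV :: 'g set)) * real (card (UNIV :: 'g set))) * nrm A a * nrm A b"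
        by (simp add: mult.assoc)
    qed
  qed (auto simp: tms)
  define d where "d g = inv_into (carr A) k (\<lambda>h. of_bool (h = g))" for g
  have d: "d g \<in> carr A" "k (d g) = (\<lambda>h. of_bool (h = g))" for g
    using bij unfolding d_def by (auto simp: bij_betw_def inv_into_into f_inv_into_f)
  have conv_d: "(\<Sum>h\<in>UNIV. of_bool (h = i) * u (g - h)) = u (g - i)"
    "(\<Sum>h\<in>UNIV. u h * of_bool (g - h = i)) = u (g - i)" for u :: "'g \<Rightarrow> complex" and g i
  proof -
    show "(\<Sum>h\<in>UNIV. of_bool (h = i) * u (g - h)) = u (g - i)"
      using fin by (subst sum.remove[of _ i]) (auto intro!: sum.neutral)
    show "(\<Sum>h\<in>UNIV. u h * of_bool (g - h = i)) = u (g - i)"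
      using fin by (subst sum.remove[of _ "g - i"]) (auto intro!: sum.neutral)
  qed
  have "derivations_inner_in TYPE(nat \<Rightarrow> ('a \<times> 'a) list) A"
    unfolding derivations_inner_in_def
  proof (intro allI impI)
    fix X :: "(nat \<Rightarrow> ('a \<times> 'a) list) cnormed" and l r D
    assume "banach_bimodule A X l r" "continuous_derivation A X l r D"
    then show "inner_derivation A X l r D"
    proof (rule group_algebra_derivation_inner[OF _ _ fin d(1)])
      show "tms A (d g) (d h) = d (g + h)" for g h
      proof (rule eqI)
        have "k (tms A (d g) (d h)) = (\<lambda>x. \<Sum>i\<in>UNIV. of_bool (i = g) * of_bool (x - i = h))"
          by (simp only: tms d)
        also have "\<dots> = (\<lambda>x. of_bool (x - g = h))"
          by (rule ext) (rule conv_d(1))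
        also have "\<dots> = k (d (g + h))"
          by (auto simp: d fun_eq_iff algebra_simps)
        finally show "k (tms A (d g) (d h)) = k (d (g + h))" .
      qed (auto simp: tms d)
      show "tms A (d 0) a = a" "tms A a (d 0) = a" if "a \<in> carr A" for a
      proof -
        have "k (tms A (d 0) a) = (\<lambda>x. \<Sum>i\<in>UNIV. of_bool (i = 0) * k a (x - i))"
          "k (tms A a (d 0)) = (\<lambda>x. \<Sum>i\<in>UNIV. k a i * of_bool (x - i = 0))"
          using that by (simp_all only: tms d)
        then show "tms A (d 0) a = a" "tms A a (d 0) = a"
          unfolding conv_d using that by (auto intro!: eqI simp: tms d)
      qed
      show "carr A \<subseteq> V"
        if V: "\<And>g. d g \<in> V" "\<And>a b. a \<in> V \<Longrightarrow> b \<in> V \<Longrightarrow> pls A a b \<in> V" "\<And>c a. a \<in> V \<Longrightarrow> scl A c a \<in> V"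
          "V \<subseteq> carr A" for V
      proof -
        \<comment> \<open>Induction over the support of \<open>a\<close>, splitting off one point
          mass at a time.\<close>
        have "a \<in> V" if "a \<in> carr A" "\<And>g. g \<notin> S \<Longrightarrow> k a g = 0" "finite S" for a S
          using that(3,1,2)
        proof (induction S arbitrary: a rule: finite_induct)
          case empty
          have "a = scl A 0 (d 0)" using empty by (intro eqI) (auto simp: scl d)
          then show ?case using V by simp
        next
          case (insert g S)
          obtain b where b: "b \<in> carr A" "k b = (k a)(g := 0)" using ex by blast
          have "b \<in> V" using insert.prems by (intro insert.IH) (auto simp: b)
          moreover have "a = pls A b (scl A (k a g) (d g))"
            using insert.prems b by (intro eqI) (auto simp: pls scl d fun_eq_iff)
          ultimately show ?case using V(1-3) by metis
        qed
        from this[of _ UNIV] fin show ?thesis by blast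
      qed
    qed
  qed
  then show ?thesis using alg by (simp add: contractive_def)
qed

section \<open>The two algebras of a finite group\<close>

lemma cSUP_norm_add_le:
  fixes u v :: "'i \<Rightarrow> 'b::real_normed_vector"
  assumes "S \<noteq> {}" "bdd_above ((\<lambda>i. norm (u i)) ` S)" "bdd_above ((\<lambda>i. norm (v i)) ` S)"
  shows "(SUP i\<in>S. norm (u i + v i)) \<le> (SUP i\<in>S. norm (u i)) + (SUP i\<in>S. norm (v i))"
  using assms(1)
proof (rule cSUP_least)
  fix i assume "i \<in> S"
  then show "norm (u i + v i) \<le> (SUP i\<in>S. norm (u i)) + (SUP i\<in>S. norm (v i))"
    using cSUP_upper[OF _ assms(2), of i] cSUP_upper[OF _ assms(3), of i] norm_triangle_ineq[of "u i" "v i"] by simp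
qed

lemma cSUP_norm_mult:
  fixes u :: "'i \<Rightarrow> 'b::real_normed_div_algebra"
  assumes "S \<noteq> {}" "bdd_above ((\<lambda>i. norm (u i)) ` S)"
  shows "(SUP i\<in>S. norm (c * u i)) = norm c * (SUP i\<in>S. norm (u i))"
proof (cases "c = 0")
  case True
  then show ?thesis using assms(1) by simp
next
  case False
  have upper: "norm (c * u i) \<le> norm c * (SUP i\<in>S. norm (u i))" if "i \<in> S" for i
    using cSUP_upper[OF that assms(2)] by (simp add: norm_mult mult_left_mono)
  then have bdd: "bdd_above ((\<lambda>i. norm (c * u i)) ` S)" by (intro bdd_aboveI2)
  have "norm (u i) \<le> (SUP i\<in>S. norm (c * u i)) / norm c" if "i \<in> S" for i
    using cSUP_upper[OF that bdd] False by (simp add: norm_mult field_simps)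
  then have "(SUP i\<in>S. norm (u i)) \<le> (SUP i\<in>S. norm (c * u i)) / norm c"
    using assms(1) by (intro cSUP_least)
  then have "norm c * (SUP i\<in>S. norm (u i)) \<le> (SUP i\<in>S. norm (c * u i))"
    using False by (simp add: field_simps)
  moreover have "(SUP i\<in>S. norm (c * u i)) \<le> norm c * (SUP i\<in>S. norm (u i))"
    using assms(1) upper by (rule cSUP_least)
  ultimately show ?thesis by simp
qed

section \<open>Expansion of linear and bilinear forms in point functions\<close>

definition point_fun :: "'a \<Rightarrow> 'a \<Rightarrow> complex"
  where "point_fun z = (\<lambda>x. of_bool (x = z))"

lemma linear_point_expansion:
  fixes \<phi> :: "('a \<Rightarrow> complex) \<Rightarrow> complex"
  assumes fin: "finite (UNIV :: 'a set)" and add: "\<And>f g. \<phi> (\<lambda>x. f x + g x) = \<phi> f + \<phi> g"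
    and scale: "\<And>c f. \<phi> (\<lambda>x. c * f x) = c * \<phi> f"
  shows "\<phi> f = (\<Sum>z\<in>UNIV. f z * \<phi> (point_fun z))"
proof -
  have "\<phi> (\<lambda>x. \<Sum>z\<in>S. f z * point_fun z x) = (\<Sum>z\<in>S. f z * \<phi> (point_fun z))" if "finite S" for S
    using that
  proof (induction S rule: finite_induct)
    case empty
    show ?case using scale[of 0 f] by simp
  next
    case (insert z S)
    then show ?case
      using add[of "\<lambda>x. f z * point_fun z x" "\<lambda>x. \<Sum>z\<in>S. f z * point_fun z x"] by (simp add: scale)
  qed
  moreover have "(\<lambda>x. \<Sum>z\<in>UNIV. f z * point_fun z x) = f"
    using fin by (auto simp: point_fun_def fun_eq_iff sum.remove intro!: sum.neutral)
  ultimately show ?thesis using fin by metis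
qed

lemma bilinear_point_expansion:
  fixes u :: "('a \<Rightarrow> complex) \<Rightarrow> ('b \<Rightarrow> complex) \<Rightarrow> complex"
  assumes fin: "finite (UNIV :: 'a set)" "finite (UNIV :: 'b set)" and u: "bounded_bilinear_form UNIV p UNIV q u"
  shows "u f g = (\<Sum>z\<in>UNIV. \<Sum>w\<in>UNIV. f z * g w * u (point_fun z) (point_fun w))"
proof -
  have "u f g = (\<Sum>z\<in>UNIV. f z * u (point_fun z) g)"
    using u by (intro linear_point_expansion fin) (auto simp: bounded_bilinear_form_def)
  also have "\<dots> = (\<Sum>z\<in>UNIV. f z * (\<Sum>w\<in>UNIV. g w * u (point_fun z) (point_fun w)))"
    using u by (intro sum.cong refl arg_cong2[where f = "(*)"] linear_point_expansion fin)
      (auto simp: bounded_bilinear_form_def)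
  finally show ?thesis by (simp add: sum_distrib_left mult.assoc)
qed

text \<open>Any finite matrix of coefficients is bounded once \<open>p\<close> and \<open>q\<close>
  dominate the point evaluations. Stated for arbitrary \<open>p\<close> and \<open>q\<close>, this
  serves the supremum norm and the L2 norms alike.\<close>

lemma bounded_bilinear_form_coefficients:
  fixes c :: "'a \<Rightarrow> 'b \<Rightarrow> complex"
  assumes fin: "finite (UNIV :: 'a set)" "finite (UNIV :: 'b set)"
    and p: "\<And>f z. f \<in> V \<Longrightarrow> cmod (f z) \<le> P * p f" and q: "\<And>g w. g \<in> W \<Longrightarrow> cmod (g w) \<le> Q * q g"
  shows "bounded_bilinear_form V p W q (\<lambda>f g. \<Sum>z\<in>UNIV. \<Sum>w\<in>UNIV. f z * g w * c z w)"
  unfolding bounded_bilinear_form_def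
proof (intro conjI ballI allI)
  have "cmod (\<Sum>z\<in>UNIV. \<Sum>w\<in>UNIV. f z * g w * c z w) \<le> (\<Sum>z\<in>UNIV. \<Sum>w\<in>UNIV. P * Q * cmod (c z w)) * p f * q g"
    if fg: "f \<in> V" "g \<in> W" for f g
  proof -
    have "cmod (\<Sum>z\<in>UNIV. \<Sum>w\<in>UNIV. f z * g w * c z w) \<le> (\<Sum>z\<in>UNIV. \<Sum>w\<in>UNIV. (P * p f) * (Q * q g) * cmod (c z w))"
    proof (intro sum_norm_le)
      fix z w
      have "cmod (f z) * cmod (g w) \<le> (P * p f) * (Q * q g)"
        using p[OF fg(1), of z] q[OF fg(2), of w] by (intro mult_mono) (auto intro: order_trans[OF norm_ge_zero])
      then show "cmod (f z * g w * c z w) \<le> (P * p f) * (Q * q g) * cmod (c z w)"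
        by (simp add: norm_mult mult_right_mono)
    qed
    also have "\<dots> = (\<Sum>z\<in>UNIV. \<Sum>w\<in>UNIV. P * Q * cmod (c z w)) * p f * q g"
      by (simp add: sum_distrib_right sum_distrib_left mult_ac)
    finally show ?thesis .
  qed
  then show "\<exists>C. \<forall>f\<in>V. \<forall>g\<in>W. cmod (\<Sum>z\<in>UNIV. \<Sum>w\<in>UNIV. f z * g w * c z w) \<le> C * p f * q g"
    by blast
qed (simp_all add: distrib_right distrib_left sum.distrib sum_distrib_left mult_ac)

lemma open_finite_t2:
  assumes "finite (UNIV :: 'a::t2_space set)"
  shows "open (S :: 'a set)"
  using assms finite_imp_closed[of "- S"] finite_subset[of "- S" UNIV] by (simp add: closed_def)

lemma C0_finite:
  assumes "finite (UNIV :: 'a::t2_space set)"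
  shows "(C0 :: ('a \<Rightarrow> complex) set) = UNIV"
proof -
  have "continuous_on UNIV f" for f :: "'a \<Rightarrow> complex"
    by (simp add: continuous_on_open_vimage open_finite_t2[OF assms])
  moreover have "compact S" for S :: "'a set"
    using assms by (intro finite_imp_compact) (rule finite_subset[OF subset_UNIV])
  ultimately show ?thesis by (simp add: C0_def)
qed

lemma supnorm_finite:
  assumes "finite (UNIV :: 'a set)"
  shows "cmod (f x) \<le> supnorm f" "supnorm f \<le> c \<longleftrightarrow> (\<forall>x :: 'a. cmod (f x) \<le> c)"
proof -
  have bdd: "bdd_above (range (\<lambda>x. cmod (f x)))" using assms by simp
  show le: "cmod (f x) \<le> supnorm f" for x
    unfolding supnorm_def by (rule cSUP_upper[OF UNIV_I bdd])
  show "supnorm f \<le> c \<longleftrightarrow> (\<forall>x :: 'a. cmod (f x) \<le> c)"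
    unfolding supnorm_def using bdd by (subst cSUP_le_iff) auto
qed

theorem measure_algebra_finite_contractive:
  assumes fin: "finite (UNIV :: 'a::{topological_ab_group_add, t2_space} set)"
  shows "contractive (measure_algebra :: (('a \<Rightarrow> complex) \<Rightarrow> complex) calg)"
proof -
  let ?A = "measure_algebra :: (('a \<Rightarrow> complex) \<Rightarrow> complex) calg"
  let ?B = "{f :: 'a \<Rightarrow> complex. supnorm f \<le> 1}"
  note C0 = C0_finite[OF fin] and sn = supnorm_finite[OF fin]
  have expand: "\<phi> f = (\<Sum>z\<in>UNIV. f z * \<phi> (point_fun z))" if "\<phi> \<in> carr ?A" for \<phi> f
    using that by (intro linear_point_expansion fin) (auto simp: measure_algebra_def C0)
  have carr: "(\<lambda>f. \<Sum>z\<in>UNIV. f z * c z) \<in> carr ?A" for c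
  proof -
    have "cmod (\<Sum>z\<in>UNIV. f z * c z) \<le> (\<Sum>z\<in>UNIV. cmod (c z)) * supnorm f" for f :: "'a \<Rightarrow> complex"
      unfolding sum_distrib_right
      by (intro sum_norm_le) (simp add: norm_mult mult.commute[of "cmod (f _)"] mult_left_mono sn(1))
    then show ?thesis
      by (auto simp: measure_algebra_def C0 distrib_right sum.distrib sum_distrib_left mult.assoc)
  qed
  have carrI: "\<phi> \<in> carr ?A" if "\<And>f. \<phi> f = (\<Sum>z\<in>UNIV. f z * c z)" for \<phi> c
  proof -
    have "\<phi> = (\<lambda>f. \<Sum>z\<in>UNIV. f z * c z)" by (rule ext) (rule that)
    then show ?thesis using carr[of c] by simp
  qed
  have nrm: "nrm ?A \<phi> = (SUP f\<in>?B. cmod (\<phi> f))" for \<phi>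
    by (simp add: measure_algebra_def C0)
  have ne: "?B \<noteq> {}" using sn(2)[of "\<lambda>_. 0" 1] by auto
  have bound: "cmod (\<phi> f) \<le> (\<Sum>z\<in>UNIV. cmod (\<phi> (point_fun z)))" if "\<phi> \<in> carr ?A" "f \<in> ?B" for \<phi> f
    unfolding expand[OF that(1), of f]
    using that(2) by (intro sum_norm_le) (auto simp: norm_mult sn(2) mult_left_le_one_le)
  have bdd: "bdd_above ((\<lambda>f. cmod (\<phi> f)) ` ?B)" if "\<phi> \<in> carr ?A" for \<phi>
    using bound[OF that] by (rule bdd_aboveI2)
  have pls: "pls ?A \<phi> \<psi> = (\<lambda>f. \<phi> f + \<psi> f)" and scl: "scl ?A c \<phi> = (\<lambda>f. c * \<phi> f)"
    and tms: "tms ?A \<phi> \<psi> = (\<lambda>f. \<phi> (\<lambda>x. \<psi> (\<lambda>y. f (x + y))))" and zer: "zer ?A = (\<lambda>f. 0)" for \<phi> \<psi> c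
    by (simp_all add: measure_algebra_def C0)
  show ?thesis
  proof (rule convolution_algebra_contractive[OF fin, where k = "\<lambda>\<phi> z. \<phi> (point_fun z)"])
    show "bij_betw (\<lambda>\<phi> z. \<phi> (point_fun z)) (carr ?A) UNIV"
    proof (rule bij_betwI')
      show "(\<lambda>z. \<phi> (point_fun z)) = (\<lambda>z. \<psi> (point_fun z)) \<longleftrightarrow> \<phi> = \<psi>" if "\<phi> \<in> carr ?A" "\<psi> \<in> carr ?A" for \<phi> \<psi>
      proof
        assume eq: "(\<lambda>z. \<phi> (point_fun z)) = (\<lambda>z. \<psi> (point_fun z))"
        show "\<phi> = \<psi>"
          by (rule ext, subst expand[OF that(1)], subst expand[OF that(2)]) (simp add: fun_cong[OF eq])
      qed simp
      fix c :: "'a \<Rightarrow> complex"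
      have "(\<Sum>z\<in>UNIV. point_fun w z * c z) = c w" for w
        using fin by (subst sum.remove[of _ w]) (auto simp: point_fun_def intro!: sum.neutral)
      then show "\<exists>\<phi>\<in>carr ?A. c = (\<lambda>z. \<phi> (point_fun z))"
        using carr[of c] by (intro bexI[of _ "\<lambda>f. \<Sum>z\<in>UNIV. f z * c z"]) auto
    qed simp
    show "zer ?A \<in> carr ?A" by (rule carrI[of _ "\<lambda>_. 0"]) (simp add: zer)
    show "(\<lambda>z. zer ?A (point_fun z)) = (\<lambda>_. 0)" by (simp add: zer)
    fix \<phi> \<psi> assume \<phi>: "\<phi> \<in> carr ?A" and \<psi>: "\<psi> \<in> carr ?A"
    show "pls ?A \<phi> \<psi> \<in> carr ?A \<and> (\<lambda>z. pls ?A \<phi> \<psi> (point_fun z)) = (\<lambda>g. \<phi> (point_fun g) + \<psi> (point_fun g))"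
    proof
      show "pls ?A \<phi> \<psi> \<in> carr ?A"
      proof (rule carrI)
        show "pls ?A \<phi> \<psi> f = (\<Sum>z\<in>UNIV. f z * (\<phi> (point_fun z) + \<psi> (point_fun z)))" for f
          unfolding pls distrib_left sum.distrib expand[OF \<phi>, symmetric] expand[OF \<psi>, symmetric] ..
      qed
    qed (simp add: pls)
    show "nrm ?A (pls ?A \<phi> \<psi>) \<le> nrm ?A \<phi> + nrm ?A \<psi>"
      unfolding nrm pls by (rule cSUP_norm_add_le[OF ne bdd[OF \<phi>] bdd[OF \<psi>]])
    have conv: "tms ?A \<phi> \<psi> f = (\<Sum>z\<in>UNIV. f z * (\<Sum>x\<in>UNIV. \<phi> (point_fun x) * \<psi> (point_fun (z - x))))" for f
    proof -
      have "tms ?A \<phi> \<psi> f = (\<Sum>x\<in>UNIV. (\<Sum>y\<in>UNIV. f (x + y) * \<psi> (point_fun y)) * \<phi> (point_fun x))"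
        unfolding tms by (subst expand[OF \<phi>], subst expand[OF \<psi>]) simp
      also have "\<dots> = (\<Sum>x\<in>UNIV. (\<Sum>z\<in>UNIV. f z * \<psi> (point_fun (z - x))) * \<phi> (point_fun x))"
      proof (rule sum.cong[OF refl])
        fix x
        have "(\<Sum>y\<in>UNIV. f (x + y) * \<psi> (point_fun y)) = (\<Sum>z\<in>UNIV. f z * \<psi> (point_fun (z - x)))"
          by (rule sum.reindex_bij_witness[of _ "\<lambda>z. z - x" "\<lambda>y. x + y"]) auto
        then show "(\<Sum>y\<in>UNIV. f (x + y) * \<psi> (point_fun y)) * \<phi> (point_fun x) =
            (\<Sum>z\<in>UNIV. f z * \<psi> (point_fun (z - x))) * \<phi> (point_fun x)" by simp
      qed
      also have "\<dots> = (\<Sum>x\<in>UNIV. \<Sum>z\<in>UNIV. f z * (\<phi> (point_fun x) * \<psi> (point_fun (z - x))))"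
        unfolding sum_distrib_right by (simp only: mult_ac)
      also have "\<dots> = (\<Sum>z\<in>UNIV. f z * (\<Sum>x\<in>UNIV. \<phi> (point_fun x) * \<psi> (point_fun (z - x))))"
        unfolding sum_distrib_left by (rule sum.swap)
      finally show ?thesis .
    qed
    have "tms ?A \<phi> \<psi> (point_fun w) = (\<Sum>x\<in>UNIV. \<phi> (point_fun x) * \<psi> (point_fun (w - x)))" for w
      unfolding conv using fin by (subst sum.remove[of _ w]) (auto simp: point_fun_def intro!: sum.neutral)
    then show "tms ?A \<phi> \<psi> \<in> carr ?A \<and>
        (\<lambda>z. tms ?A \<phi> \<psi> (point_fun z)) = (\<lambda>g. \<Sum>h\<in>UNIV. \<phi> (point_fun h) * \<psi> (point_fun (g - h)))"
      using carrI[OF conv] by auto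
  next
    fix \<phi> c assume \<phi>: "\<phi> \<in> carr ?A"
    show "scl ?A c \<phi> \<in> carr ?A \<and> (\<lambda>z. scl ?A c \<phi> (point_fun z)) = (\<lambda>g. c * \<phi> (point_fun g))"
    proof
      show "scl ?A c \<phi> \<in> carr ?A"
      proof (rule carrI)
        show "scl ?A c \<phi> f = (\<Sum>z\<in>UNIV. f z * (c * \<phi> (point_fun z)))" for f
          unfolding scl mult.left_commute[of _ c] sum_distrib_left[symmetric] expand[OF \<phi>, symmetric] ..
      qed
    qed (simp add: scl)
    show "nrm ?A (scl ?A c \<phi>) = cmod c * nrm ?A \<phi>"
      unfolding nrm scl by (rule cSUP_norm_mult[OF ne bdd[OF \<phi>]])
    show "nrm ?A \<phi> \<le> (\<Sum>z\<in>UNIV. cmod (\<phi> (point_fun z)))"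
      unfolding nrm by (rule cSUP_least[OF ne bound[OF \<phi>]])
    show "cmod (\<phi> (point_fun z)) \<le> nrm ?A \<phi>" for z
      unfolding nrm by (rule cSUP_upper[OF _ bdd[OF \<phi>]]) (simp add: sn(2) point_fun_def)
  qed
qed

section \<open>Square-integrable functions and product measures on finite sets\<close>

lemma L2_finite:
  assumes "finite_measure M" and sets: "sets M = UNIV" and fin: "finite (UNIV :: 'a set)"
  shows "L2 M = (UNIV :: ('a \<Rightarrow> complex) set)"
    and "cmod (f x) * sqrt (measure M {x}) \<le> L2norm M f"
proof -
  interpret finite_measure M by fact
  have space: "space M = UNIV" using sets sets.sets_into_space[of UNIV M] by auto
  have meas: "f \<in> borel_measurable M" for f :: "'a \<Rightarrow> 'c::topological_space"
    using sets by (simp add: measurable_def space)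
  have int: "integrable M f" for f :: "'a \<Rightarrow> real"
  proof (rule integrable_const_bound)
    show "AE x in M. norm (f x) \<le> (\<Sum>x\<in>UNIV. norm (f x))"
      using fin by (intro AE_I2 member_le_sum) auto
  qed (rule meas)
  show "L2 M = (UNIV :: ('a \<Rightarrow> complex) set)"
    by (auto simp: L2_def meas int)
  have "(cmod (f x))\<^sup>2 * measure M {x} = (\<integral>y. (cmod (f x))\<^sup>2 * indicator {x} y \<partial>M)"
    using sets by simp
  also have "\<dots> \<le> (\<integral>y. (cmod (f y))\<^sup>2 \<partial>M)"
    by (intro integral_mono int) (auto simp: indicator_def)
  finally have "sqrt ((cmod (f x))\<^sup>2 * measure M {x}) \<le> L2norm M f"
    unfolding L2norm_def by simp
  then show "cmod (f x) * sqrt (measure M {x}) \<le> L2norm M f"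
    by (simp add: real_sqrt_mult)
qed

text \<open>Positive mass at a point makes evaluation there bounded for the L2 norm; adding the
  constants of all points gives one that is uniform.\<close>

lemma L2norm_dominates:
  assumes "finite_measure M" "sets M = UNIV" "finite (UNIV :: 'a set)" "\<And>x :: 'a. 0 < measure M {x}"
  obtains P where "\<And>f x. cmod (f x) \<le> P * L2norm M f"
proof
  fix f and x :: 'a
  have "0 \<le> L2norm M f" by (simp add: L2norm_def)
  have "cmod (f x) \<le> 1 / sqrt (measure M {x}) * L2norm M f"
    using L2_finite(2)[OF assms(1-3), of f x] assms(4)[of x] by (simp add: field_simps)
  also have "\<dots> \<le> (\<Sum>x\<in>UNIV. 1 / sqrt (measure M {x})) * L2norm M f"
    using assms(3) \<open>0 \<le> L2norm M f\<close> by (intro mult_right_mono member_le_sum) auto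
  finally show "cmod (f x) \<le> (\<Sum>x\<in>UNIV. 1 / sqrt (measure M {x})) * L2norm M f" .
qed

lemma bounded_bilinear_form_L2_finite:
  fixes c :: "'a \<Rightarrow> 'b \<Rightarrow> complex"
  assumes M: "finite_measure M" "sets M = UNIV" "finite (UNIV :: 'a set)" "\<And>x :: 'a. 0 < measure M {x}"
    and N: "finite_measure N" "sets N = UNIV" "finite (UNIV :: 'b set)" "\<And>y :: 'b. 0 < measure N {y}"
  shows "bounded_bilinear_form (L2 M) (L2norm M) (L2 N) (L2norm N) (\<lambda>f g. \<Sum>z\<in>UNIV. \<Sum>w\<in>UNIV. f z * g w * c z w)"
proof -
  obtain P where P: "\<And>f x. cmod (f x) \<le> P * L2norm M f" using L2norm_dominates[OF M] by blast
  obtain Q where Q: "\<And>g y. cmod (g y) \<le> Q * L2norm N g" using L2norm_dominates[OF N] by blast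
  show ?thesis using M(3) N(3) P Q by (rule bounded_bilinear_form_coefficients)
qed

lemma radon_prob_uniform:
  assumes fin: "finite (UNIV :: 'a::t2_space set)"
  shows "radon_prob (uniform_count_measure (UNIV :: 'a set))"
  unfolding radon_prob_def
proof (intro conjI ballI)
  show "prob_space (uniform_count_measure (UNIV :: 'a set))"
    using fin by (intro prob_space_uniform_count_measure) auto
  have borel: "sets (borel :: 'a measure) = UNIV"
    using borel_open[OF open_finite_t2[OF fin]] by blast
  then show "sets (uniform_count_measure (UNIV :: 'a set)) = sets borel"
    by (simp add: sets_uniform_count_measure)
  fix B :: "'a set"
  let ?M = "uniform_count_measure (UNIV :: 'a set)"
  have "compact B" using fin by (intro finite_imp_compact) (rule finite_subset[OF subset_UNIV])
  then have "emeasure ?M B \<le> (SUP K\<in>{K. compact K \<and> K \<subseteq> B}. emeasure ?M K)"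
    by (intro SUP_upper) auto
  moreover have "(SUP K\<in>{K. compact K \<and> K \<subseteq> B}. emeasure ?M K) \<le> emeasure ?M B"
    by (intro SUP_least emeasure_mono) (auto simp: sets_uniform_count_measure)
  ultimately show "emeasure ?M B = (SUP K\<in>{K. compact K \<and> K \<subseteq> B}. emeasure ?M K)" by simp
qed

lemma radon_prob_sets_finite:
  assumes "finite (UNIV :: 'a::t2_space set)" "radon_prob (M :: 'a measure)"
  shows "prob_space M" "sets M = UNIV"
  using assms(2) borel_open[OF open_finite_t2[OF assms(1)]] unfolding radon_prob_def by blast+

lemma completion_pair_finite:
  fixes M1 :: "'a measure" and M2 :: "'b measure"
  assumes fin: "finite (UNIV :: 'a set)" "finite (UNIV :: 'b set)"
    and M1: "prob_space M1" "sets M1 = UNIV" and M2: "prob_space M2" "sets M2 = UNIV"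
  shows "finite_measure (completion (M1 \<Otimes>\<^sub>M M2))" "sets (completion (M1 \<Otimes>\<^sub>M M2)) = UNIV"
    and "measure (completion (M1 \<Otimes>\<^sub>M M2)) {(x, y)} = measure M1 {x} * measure M2 {y}"
proof -
  interpret M1: prob_space M1 by fact
  interpret M2: prob_space M2 by fact
  interpret P: pair_prob_space M1 M2 ..
  have fin2: "finite (UNIV :: ('a \<times> 'b) set)"
    using finite_cartesian_product[OF fin] by simp
  have sing: "{x} \<times> {y} \<in> sets (M1 \<Otimes>\<^sub>M M2)" for x y
    by (rule pair_measureI) (simp_all add: M1 M2)
  have S: "S \<in> sets (M1 \<Otimes>\<^sub>M M2)" for S
  proof -
    have "(\<Union>p\<in>S. {fst p} \<times> {snd p}) \<in> sets (M1 \<Otimes>\<^sub>M M2)"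
      by (intro sets.finite_UN sing) (rule finite_subset[OF subset_UNIV fin2])
    moreover have "(\<Union>p\<in>S. {fst p} \<times> {snd p}) = S" by auto
    ultimately show ?thesis by simp
  qed
  show "finite_measure (completion (M1 \<Otimes>\<^sub>M M2))"
    by (intro prob_space.finite_measure prob_space.prob_space_completion P.prob_space_axioms)
  show "sets (completion (M1 \<Otimes>\<^sub>M M2)) = UNIV" using S by (auto intro: sets_completionI_sets)
  have "measure (completion (M1 \<Otimes>\<^sub>M M2)) {(x, y)} = measure (M1 \<Otimes>\<^sub>M M2) ({x} \<times> {y})"
    using S by simp
  also have "\<dots> = measure M1 {x} * measure M2 {y}"
  proof -
    have "emeasure (M1 \<Otimes>\<^sub>M M2) ({x} \<times> {y}) = emeasure M1 {x} * emeasure M2 {y}"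
      by (rule M2.emeasure_pair_measure_Times) (simp_all add: M1 M2)
    then show ?thesis by (simp only: measure_def enn2real_mult)
  qed
  finally show "measure (completion (M1 \<Otimes>\<^sub>M M2)) {(x, y)} = measure M1 {x} * measure M2 {y}" .
qed

lemma sum_UNIV_prod: "(\<Sum>p\<in>UNIV. F p) = (\<Sum>a\<in>UNIV. \<Sum>b\<in>UNIV. F (a, b))"
  by (simp add: sum.cartesian_product)

lemma point_fun_Pair: "(\<lambda>(x1, x2). point_fun a x1 * point_fun b x2) = point_fun (a, b)"
  by (auto simp: point_fun_def fun_eq_iff)

text \<open>The definite description denotes: uniform measures provide a witness, and any admissible
  form is determined by its values on pairs of point functions, which are fixed by \<open>u\<close>
  and \<open>v\<close>.\<close>

lemma bim_conv_finite:
  fixes u v :: "('a::{topological_ab_group_add, t2_space} \<Rightarrow> complex) \<Rightarrow> ('b::{topological_ab_group_add, t2_space} \<Rightarrow> complex) \<Rightarrow> complex"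
  assumes fin: "finite (UNIV :: 'a set)" "finite (UNIV :: 'b set)"
    and u: "bounded_bilinear_form UNIV supnorm UNIV supnorm u" and v: "bounded_bilinear_form UNIV supnorm UNIV supnorm v"
  shows "bim_conv u v f g = (\<Sum>p\<in>UNIV. \<Sum>q\<in>UNIV. f (fst p + snd p) * g (fst q + snd q) *
    (u (point_fun (fst p)) (point_fun (fst q)) * v (point_fun (snd p)) (point_fun (snd q))))"
proof -
  have fin2: "finite (UNIV :: ('a \<times> 'a) set)" "finite (UNIV :: ('b \<times> 'b) set)"
    using finite_cartesian_product[OF fin(1,1)] finite_cartesian_product[OF fin(2,2)] by simp_all
  note C0 = C0_finite[OF fin(1)] C0_finite[OF fin(2)]
  define c where "c p q = u (point_fun (fst p)) (point_fun (fst q)) * v (point_fun (snd p)) (point_fun (snd q))" for p q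
  define T where "T F G = (\<Sum>p\<in>UNIV. \<Sum>q\<in>UNIV. F p * G q * c p q)" for F :: "'a \<times> 'a \<Rightarrow> complex" and G :: "'b \<times> 'b \<Rightarrow> complex"
  \<comment> \<open>The uniform measures charge every point, so every bilinear form is bounded for
    their L2 norms and the same pair serves all bimeasures.\<close>
  let ?M = "uniform_count_measure (UNIV :: 'a set)" and ?N = "uniform_count_measure (UNIV :: 'b set)"
  have pos: "0 < measure ?M {x}" "0 < measure ?N {y}" for x y
    using fin by (simp_all add: measure_uniform_count_measure card_gt_0_iff)
  note rad = radon_prob_uniform[OF fin(1)] radon_prob_uniform[OF fin(2)]
  note M = radon_prob_sets_finite[OF fin(1) rad(1)] and N = radon_prob_sets_finite[OF fin(2) rad(2)]
  have pair: "grothendieck_pair w ?M ?N" if w: "bounded_bilinear_form UNIV supnorm UNIV supnorm w" for w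
    unfolding grothendieck_pair_def
  proof (intro conjI rad exI)
    show "bounded_bilinear_form (L2 ?M) (L2norm ?M) (L2 ?N) (L2norm ?N)
        (\<lambda>f g. \<Sum>x\<in>UNIV. \<Sum>y\<in>UNIV. f x * g y * w (point_fun x) (point_fun y))"
      using M N fin pos by (intro bounded_bilinear_form_L2_finite prob_space.finite_measure) auto
    show "\<forall>f\<in>C0. \<forall>g\<in>C0. (\<Sum>x\<in>UNIV. \<Sum>y\<in>UNIV. f x * g y * w (point_fun x) (point_fun y)) = w f g"
      by (intro ballI) (rule bilinear_point_expansion[OF fin w, symmetric])
  qed
  have tensor: "tensor_form u v ?M ?N ?M ?N T"
    unfolding tensor_form_def Let_def
  proof (intro conjI ballI)
    note cM = completion_pair_finite[OF fin(1,1) M M] and cN = completion_pair_finite[OF fin(2,2) N N]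
    show "bounded_bilinear_form (L2 (completion (?M \<Otimes>\<^sub>M ?M))) (L2norm (completion (?M \<Otimes>\<^sub>M ?M)))
        (L2 (completion (?N \<Otimes>\<^sub>M ?N))) (L2norm (completion (?N \<Otimes>\<^sub>M ?N))) T"
      unfolding T_def
    proof (intro bounded_bilinear_form_L2_finite cM(1,2) cN(1,2) fin2)
      show "0 < measure (completion (?M \<Otimes>\<^sub>M ?M)) {p}" for p using cM(3) pos by (cases p) simp
      show "0 < measure (completion (?N \<Otimes>\<^sub>M ?N)) {q}" for q using cN(3) pos by (cases q) simp
    qed
    fix f1 f2 :: "'a \<Rightarrow> complex" and g1 g2 :: "'b \<Rightarrow> complex"
    have "T (\<lambda>(x1, x2). f1 x1 * f2 x2) (\<lambda>(y1, y2). g1 y1 * g2 y2)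
        = (\<Sum>x1\<in>UNIV. \<Sum>x2\<in>UNIV. \<Sum>y1\<in>UNIV. \<Sum>y2\<in>UNIV.
            (f1 x1 * g1 y1 * u (point_fun x1) (point_fun y1)) * (f2 x2 * g2 y2 * v (point_fun x2) (point_fun y2)))"
      unfolding T_def c_def by (simp add: sum_UNIV_prod mult_ac)
    also have "\<dots> = (\<Sum>x1\<in>UNIV. \<Sum>x2\<in>UNIV. (\<Sum>y1\<in>UNIV. f1 x1 * g1 y1 * u (point_fun x1) (point_fun y1)) *
          (\<Sum>y2\<in>UNIV. f2 x2 * g2 y2 * v (point_fun x2) (point_fun y2)))"
      by (simp only: sum_product)
    also have "\<dots> = u f1 g1 * v f2 g2"
      unfolding bilinear_point_expansion[OF fin u, of f1 g1] bilinear_point_expansion[OF fin v, of f2 g2]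
      by (simp only: sum_product)
    finally show "T (\<lambda>(x1, x2). f1 x1 * f2 x2) (\<lambda>(y1, y2). g1 y1 * g2 y2) = u f1 g1 * v f2 g2" .
  qed
  \<comment> \<open>A point function on pairs is a tensor of two point functions, so
    \<open>tensor_form\<close> prescribes the values of \<open>S\<close> on a basis, whatever the
    measures are.\<close>
  have unique: "S F G = T F G" if M1: "grothendieck_pair u M1 N1" and M2: "grothendieck_pair v M2 N2"
    and S: "tensor_form u v M1 N1 M2 N2 S" for M1 N1 M2 N2 S F G
  proof -
    have rad: "radon_prob M1" "radon_prob N1" "radon_prob M2" "radon_prob N2"
      using M1 M2 by (auto simp: grothendieck_pair_def)
    note m = radon_prob_sets_finite[OF fin(1) rad(1)] radon_prob_sets_finite[OF fin(1) rad(3)]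
      and n = radon_prob_sets_finite[OF fin(2) rad(2)] radon_prob_sets_finite[OF fin(2) rad(4)]
    note cM = completion_pair_finite[OF fin(1,1) m] and cN = completion_pair_finite[OF fin(2,2) n]
    have "S F G = (\<Sum>p\<in>UNIV. \<Sum>q\<in>UNIV. F p * G q * S (point_fun p) (point_fun q))"
    proof (rule bilinear_point_expansion[OF fin2])
      show "bounded_bilinear_form UNIV (L2norm (completion (M1 \<Otimes>\<^sub>M M2))) UNIV (L2norm (completion (N1 \<Otimes>\<^sub>M N2))) S"
        using S unfolding tensor_form_def Let_def L2_finite(1)[OF cM(1,2) fin2(1)] L2_finite(1)[OF cN(1,2) fin2(2)]
        by blast
    qed
    moreover have "S (point_fun p) (point_fun q) = c p q" for p q
      using S unfolding tensor_form_def c_def C0 by (metis point_fun_Pair UNIV_I prod.collapse)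
    ultimately show ?thesis by (simp add: T_def)
  qed
  let ?F = "\<lambda>(x1, x2). f (x1 + x2)" and ?G = "\<lambda>(y1, y2). g (y1 + y2)"
  have "(THE z. \<exists>M1 N1 M2 N2 S. grothendieck_pair u M1 N1 \<and> grothendieck_pair v M2 N2 \<and>
      tensor_form u v M1 N1 M2 N2 S \<and> z = S ?F ?G) = T ?F ?G"
    by (rule the_equality) (use pair[OF u] pair[OF v] tensor unique in blast)+
  then have "bim_conv u v f g = T ?F ?G"
    by (simp add: bim_conv_def C0)
  then show ?thesis by (simp add: T_def c_def case_prod_beta)
qed

theorem bimeasure_algebra_finite_contractive:
  assumes fin: "finite (UNIV :: 'a::{topological_ab_group_add, t2_space} set)"
    "finite (UNIV :: 'b::{topological_ab_group_add, t2_space} set)"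
  shows "contractive (bimeasure_algebra :: (('a \<Rightarrow> complex) \<Rightarrow> ('b \<Rightarrow> complex) \<Rightarrow> complex) calg)"
proof -
  let ?A = "bimeasure_algebra :: (('a \<Rightarrow> complex) \<Rightarrow> ('b \<Rightarrow> complex) \<Rightarrow> complex) calg"
  let ?B = "{f :: 'a \<Rightarrow> complex. supnorm f \<le> 1} \<times> {g :: 'b \<Rightarrow> complex. supnorm g \<le> 1}"
  let ?k = "\<lambda>u p. u (point_fun (fst p)) (point_fun (snd p))"
  note C0 = C0_finite[OF fin(1)] C0_finite[OF fin(2)]
  note sn = supnorm_finite[OF fin(1)] supnorm_finite[OF fin(2)]
  have fin2: "finite (UNIV :: ('a \<times> 'b) set)"
    using finite_cartesian_product[OF fin] by simp
  have carr: "u \<in> carr ?A \<longleftrightarrow> bounded_bilinear_form UNIV supnorm UNIV supnorm u" for u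
    by (simp add: bimeasure_algebra_def C0)
  have expand: "u f g = (\<Sum>x\<in>UNIV. \<Sum>y\<in>UNIV. f x * g y * u (point_fun x) (point_fun y))" if "u \<in> carr ?A" for u f g
    using that unfolding carr by (rule bilinear_point_expansion[OF fin])
  have carrI: "u \<in> carr ?A" if "\<And>f g. u f g = (\<Sum>x\<in>UNIV. \<Sum>y\<in>UNIV. f x * g y * c x y)" for u c
  proof -
    have "u = (\<lambda>f g. \<Sum>x\<in>UNIV. \<Sum>y\<in>UNIV. f x * g y * c x y)" by (intro ext) (rule that)
    moreover have "bounded_bilinear_form UNIV supnorm UNIV supnorm (\<lambda>f g. \<Sum>x\<in>UNIV. \<Sum>y\<in>UNIV. f x * g y * c x y)"
      by (rule bounded_bilinear_form_coefficients[OF fin, where P = 1 and Q = 1]) (simp_all add: sn)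
    ultimately show ?thesis by (simp add: carr)
  qed
  have nrm: "nrm ?A u = (SUP i\<in>?B. cmod (u (fst i) (snd i)))" for u
    by (simp add: bimeasure_algebra_def C0 case_prod_beta)
  have pls: "pls ?A u v = (\<lambda>f g. u f g + v f g)" and scl: "scl ?A c u = (\<lambda>f g. c * u f g)"
    and tms: "tms ?A = bim_conv" and zer: "zer ?A = (\<lambda>f g. 0)" for u v c
    by (simp_all add: bimeasure_algebra_def)
  have ne: "?B \<noteq> {}" using sn(2)[of "\<lambda>_. 0" 1] sn(4)[of "\<lambda>_. 0" 1] by auto
  have bound: "cmod (u (fst i) (snd i)) \<le> (\<Sum>p\<in>UNIV. cmod (?k u p))" if u: "u \<in> carr ?A" and i: "i \<in> ?B" for u i
  proof -
    have "cmod (fst i x * snd i y * ?k u (x, y)) \<le> cmod (?k u (x, y))" for x y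
    proof -
      have "cmod (fst i x) * cmod (snd i y) \<le> 1 * 1"
        using i by (intro mult_mono) (auto simp: sn)
      then have "cmod (fst i x) * cmod (snd i y) * cmod (?k u (x, y)) \<le> 1 * 1 * cmod (?k u (x, y))"
        by (intro mult_right_mono) auto
      then show ?thesis by (simp add: norm_mult)
    qed
    then have "cmod (u (fst i) (snd i)) \<le> (\<Sum>x\<in>UNIV. \<Sum>y\<in>UNIV. cmod (?k u (x, y)))"
      unfolding expand[OF u, of "fst i" "snd i"] by (intro sum_norm_le) simp
    then show ?thesis by (simp add: sum_UNIV_prod)
  qed
  have bdd: "bdd_above ((\<lambda>i. cmod (u (fst i) (snd i))) ` ?B)" if "u \<in> carr ?A" for u
    using bound[OF that] by (rule bdd_aboveI2)
  have coeff: "(\<Sum>x\<in>UNIV. \<Sum>y\<in>UNIV. point_fun a x * point_fun b y * c x y) = c a b" for a b and c :: "'a \<Rightarrow> 'b \<Rightarrow> complex"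
  proof -
    have "(\<Sum>y\<in>UNIV. point_fun a x * point_fun b y * c x y) = point_fun a x * c x b" for x
      using fin by (subst sum.remove[of _ b]) (auto simp: point_fun_def intro!: sum.neutral)
    then show ?thesis
      using fin by (simp, subst sum.remove[of _ a]) (auto simp: point_fun_def intro!: sum.neutral)
  qed
  show ?thesis
  proof (rule convolution_algebra_contractive[OF fin2, where k = ?k])
    show "bij_betw ?k (carr ?A) UNIV"
    proof (rule bij_betwI')
      show "?k u = ?k v \<longleftrightarrow> u = v" if "u \<in> carr ?A" "v \<in> carr ?A" for u v
      proof
        assume eq: "?k u = ?k v"
        show "u = v"
        proof (intro ext)
          fix f g
          show "u f g = v f g"
            unfolding expand[OF that(1), of f g] expand[OF that(2), of f g]
            using fun_cong[OF eq, of "(x, y)" for x y] by simp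
        qed
      qed simp
      fix c :: "'a \<times> 'b \<Rightarrow> complex"
      show "\<exists>u\<in>carr ?A. c = ?k u"
        by (intro bexI[of _ "\<lambda>f g. \<Sum>x\<in>UNIV. \<Sum>y\<in>UNIV. f x * g y * c (x, y)"] carrI[OF refl]) (simp add: coeff)
    qed simp
    show "zer ?A \<in> carr ?A" by (rule carrI[of _ "\<lambda>_ _. 0"]) (simp add: zer)
    show "?k (zer ?A) = (\<lambda>_. 0)" by (simp add: zer)
    fix u v assume u: "u \<in> carr ?A" and v: "v \<in> carr ?A"
    show "pls ?A u v \<in> carr ?A \<and> ?k (pls ?A u v) = (\<lambda>p. ?k u p + ?k v p)"
    proof
      show "pls ?A u v \<in> carr ?A"
      proof (rule carrI)
        show "pls ?A u v f g = (\<Sum>x\<in>UNIV. \<Sum>y\<in>UNIV. f x * g y * (?k u (x, y) + ?k v (x, y)))" for f g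
          unfolding pls expand[OF u, of f g] expand[OF v, of f g] by (simp add: distrib_left sum.distrib)
      qed
    qed (simp add: pls)
    show "nrm ?A (pls ?A u v) \<le> nrm ?A u + nrm ?A v"
      unfolding nrm pls by (rule cSUP_norm_add_le[OF ne bdd[OF u] bdd[OF v]])
    have conv: "bim_conv u v f g = (\<Sum>x\<in>UNIV. \<Sum>y\<in>UNIV. f x * g y * (\<Sum>p\<in>UNIV. ?k u p * ?k v ((x, y) - p)))" for f g
    proof -
      \<comment> \<open>Groups the pairs by their sum \<open>x\<close>, keeping the first component
        \<open>a\<close>. It is stated for a generic group because it is applied once in each of the
        two factors.\<close>
      have shift: "(\<Sum>p\<in>(UNIV :: ('c \<times> 'c) set). F (fst p + snd p) (fst p) (snd p)) = (\<Sum>x\<in>UNIV. \<Sum>a\<in>UNIV. F x a (x - a))"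
        for F :: "'c::ab_group_add \<Rightarrow> 'c \<Rightarrow> 'c \<Rightarrow> complex"
      proof -
        have "(\<Sum>p\<in>(UNIV :: ('c \<times> 'c) set). F (fst p + snd p) (fst p) (snd p)) = (\<Sum>(x, a)\<in>UNIV. F x a (x - a))"
          by (rule sum.reindex_bij_witness[of _ "\<lambda>(x, a). (a, x - a)" "\<lambda>(a, b). (a + b, a)"]) auto
        then show ?thesis by (simp add: sum_UNIV_prod)
      qed
      have "bim_conv u v f g = (\<Sum>p\<in>UNIV. \<Sum>q\<in>UNIV. f (fst p + snd p) * g (fst q + snd q) *
          (?k u (fst p, fst q) * ?k v (snd p, snd q)))"
        using u v unfolding carr by (simp add: bim_conv_finite[OF fin])
      also have "\<dots> = (\<Sum>p\<in>UNIV. \<Sum>y\<in>UNIV. \<Sum>b\<in>UNIV. f (fst p + snd p) * g y * (?k u (fst p, b) * ?k v (snd p, y - b)))"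
        by (intro sum.cong refl shift)
      also have "\<dots> = (\<Sum>x\<in>UNIV. \<Sum>a\<in>UNIV. \<Sum>y\<in>UNIV. \<Sum>b\<in>UNIV. f x * g y * (?k u (a, b) * ?k v (x - a, y - b)))"
        by (rule shift)
      also have "\<dots> = (\<Sum>x\<in>UNIV. \<Sum>y\<in>UNIV. \<Sum>a\<in>UNIV. \<Sum>b\<in>UNIV. f x * g y * (?k u (a, b) * ?k v (x - a, y - b)))"
        by (intro sum.cong refl sum.swap)
      also have "\<dots> = (\<Sum>x\<in>UNIV. \<Sum>y\<in>UNIV. f x * g y * (\<Sum>a\<in>UNIV. \<Sum>b\<in>UNIV. ?k u (a, b) * ?k v ((x, y) - (a, b))))"
        by (simp add: sum_distrib_left)
      also have "\<dots> = (\<Sum>x\<in>UNIV. \<Sum>y\<in>UNIV. f x * g y * (\<Sum>p\<in>UNIV. ?k u p * ?k v ((x, y) - p)))"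
        by (simp add: sum_UNIV_prod)
      finally show ?thesis .
    qed
    have "?k (bim_conv u v) w = (\<Sum>p\<in>UNIV. ?k u p * ?k v (w - p))" for w
      unfolding conv coeff by simp
    then show "tms ?A u v \<in> carr ?A \<and> ?k (tms ?A u v) = (\<lambda>w. \<Sum>p\<in>UNIV. ?k u p * ?k v (w - p))"
      using carrI[OF conv] by (auto simp: tms)
  next
    fix u c assume u: "u \<in> carr ?A"
    show "scl ?A c u \<in> carr ?A \<and> ?k (scl ?A c u) = (\<lambda>p. c * ?k u p)"
    proof
      show "scl ?A c u \<in> carr ?A"
      proof (rule carrI)
        show "scl ?A c u f g = (\<Sum>x\<in>UNIV. \<Sum>y\<in>UNIV. f x * g y * (c * ?k u (x, y)))" for f g
          unfolding scl expand[OF u, of f g] by (simp add: sum_distrib_left mult_ac)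
      qed
    qed (simp add: scl)
    show "nrm ?A (scl ?A c u) = cmod c * nrm ?A u"
      unfolding nrm scl by (rule cSUP_norm_mult[OF ne bdd[OF u]])
    show "nrm ?A u \<le> (\<Sum>p\<in>UNIV. cmod (?k u p))"
      unfolding nrm by (rule cSUP_least[OF ne bound[OF u]])
    show "cmod (?k u p) \<le> nrm ?A u" for p
      unfolding nrm using cSUP_upper[OF _ bdd[OF u], of "(point_fun (fst p), point_fun (snd p))"]
      by (simp add: sn point_fun_def)
  qed
qed

section \<open>Functions vanishing at infinity\<close>

lemma C0I:
  assumes "continuous_on UNIV f" "\<And>e. 0 < e \<Longrightarrow> \<exists>K. compact K \<and> (\<forall>x. x \<notin> K \<longrightarrow> cmod (f x) < e)"
  shows "f \<in> C0"
  unfolding C0_def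
proof (intro CollectI conjI allI impI assms(1))
  fix e :: real assume "0 < e"
  then obtain K where K: "compact K" "\<And>x. x \<notin> K \<Longrightarrow> cmod (f x) < e" using assms(2) by blast
  have "closed {x. e \<le> cmod (f x)}"
    by (intro closed_Collect_le continuous_intros assms(1))
  moreover have "K \<inter> {x. e \<le> cmod (f x)} = {x. e \<le> cmod (f x)}" using K(2) by force
  ultimately show "compact {x. e \<le> cmod (f x)}" using compact_Int_closed[OF K(1)] by metis
qed

lemma C0_continuous: "f \<in> C0 \<Longrightarrow> continuous_on UNIV f"
  by (simp add: C0_def)

lemma C0_small:
  assumes "f \<in> C0" "0 < e"
  shows "\<exists>K. compact K \<and> (\<forall>x. x \<notin> K \<longrightarrow> cmod (f x) < e)"
  using assms by (intro exI[of _ "{x. e \<le> cmod (f x)}"]) (auto simp: C0_def not_le)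

lemma C0_bounded:
  assumes "f \<in> C0"
  shows "\<exists>B. \<forall>x. cmod (f x) \<le> B"
proof -
  obtain K where K: "compact K" "\<And>x. x \<notin> K \<Longrightarrow> cmod (f x) < 1"
    using C0_small[OF assms zero_less_one] by blast
  have "compact (f ` K)"
    using C0_continuous[OF assms] K(1) by (intro compact_continuous_image) (auto intro: continuous_on_subset)
  then obtain B where B: "\<And>x. x \<in> K \<Longrightarrow> cmod (f x) \<le> B"
    using compact_imp_bounded bounded_iff by (metis imageI)
  have "cmod (f x) \<le> max 1 B" for x using K(2)[of x] B[of x] by (cases "x \<in> K") force+
  then show ?thesis by blast
qed

lemma C0_le_supnorm:
  assumes "f \<in> C0"
  shows "cmod (f x) \<le> supnorm f"
proof -
  obtain B where "\<And>x. cmod (f x) \<le> B" using C0_bounded[OF assms] by blast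
  then have "bdd_above (range (\<lambda>x. cmod (f x)))" by (intro bdd_aboveI2)
  then show ?thesis unfolding supnorm_def by (intro cSUP_upper) auto
qed

lemma supnorm_least: "(\<And>x. cmod (f x) \<le> B) \<Longrightarrow> supnorm f \<le> B"
  unfolding supnorm_def by (intro cSUP_least) auto

lemma C0_zero: "(\<lambda>_. 0) \<in> C0"
  by (intro C0I) (auto intro!: exI[of _ "{}"])

lemma C0_add:
  assumes "f \<in> C0" "g \<in> C0"
  shows "(\<lambda>x. f x + g x) \<in> C0"
proof (rule C0I)
  show "continuous_on UNIV (\<lambda>x. f x + g x)"
    using assms by (intro continuous_intros C0_continuous)
  fix e :: real assume "0 < e"
  then have e: "0 < e / 2" by simp
  obtain K where K: "compact K" "\<And>x. x \<notin> K \<Longrightarrow> cmod (f x) < e / 2" using C0_small[OF assms(1) e] by blast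
  obtain L where L: "compact L" "\<And>x. x \<notin> L \<Longrightarrow> cmod (g x) < e / 2" using C0_small[OF assms(2) e] by blast
  have "cmod (f x + g x) < e" if "x \<notin> K \<union> L" for x
    using that K(2)[of x] L(2)[of x] norm_triangle_ineq[of "f x" "g x"] by simp
  then show "\<exists>K. compact K \<and> (\<forall>x. x \<notin> K \<longrightarrow> cmod (f x + g x) < e)"
    using compact_Un[OF K(1) L(1)] by blast
qed

lemma C0_mult:
  assumes "f \<in> C0" "continuous_on UNIV h" "\<And>x. cmod (h x) \<le> B"
  shows "(\<lambda>x. h x * f x) \<in> C0"
proof (rule C0I)
  show "continuous_on UNIV (\<lambda>x. h x * f x)"
    using assms(2) C0_continuous[OF assms(1)] by (rule continuous_on_mult)
  fix e :: real assume e: "0 < e"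
  have B: "0 \<le> B" using assms(3)[of undefined] norm_ge_zero order_trans by blast
  then have "0 < e / (B + 1)" using e by simp
  then obtain K where K: "compact K" "\<And>x. x \<notin> K \<Longrightarrow> cmod (f x) < e / (B + 1)"
    using C0_small[OF assms(1)] by blast
  have "cmod (h x * f x) < e" if "x \<notin> K" for x
  proof -
    have "cmod (h x * f x) \<le> (B + 1) * cmod (f x)"
      using assms(3)[of x] by (simp add: norm_mult mult_right_mono)
    also have "\<dots> < e" using K(2)[OF that] B by (simp add: field_simps)
    finally show ?thesis .
  qed
  then show "\<exists>K. compact K \<and> (\<forall>x. x \<notin> K \<longrightarrow> cmod (h x * f x) < e)" using K(1) by blast
qed

lemma C0_scale: "f \<in> C0 \<Longrightarrow> (\<lambda>x. c * f x) \<in> C0"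
  by (rule C0_mult[where B = "cmod c"]) auto

lemma C0_translate:
  fixes f :: "'a::topological_ab_group_add \<Rightarrow> complex"
  assumes "f \<in> C0"
  shows "(\<lambda>x. f (a + x)) \<in> C0"
proof (rule C0I)
  have "continuous_on UNIV (\<lambda>x :: 'a. a + x)" by (intro continuous_intros)
  then show "continuous_on UNIV (\<lambda>x. f (a + x))"
    using C0_continuous[OF assms] continuous_on_compose2 by blast
  fix e :: real assume "0 < e"
  then obtain K where K: "compact K" "\<And>x. x \<notin> K \<Longrightarrow> cmod (f x) < e"
    using C0_small[OF assms] by blast
  have "compact ((\<lambda>x. - a + x) ` K)"
    using K(1) by (intro compact_continuous_image continuous_intros)
  moreover have "cmod (f (a + x)) < e" if "x \<notin> (\<lambda>x. - a + x) ` K" for x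
  proof (rule K(2))
    show "a + x \<notin> K"
    proof
      assume "a + x \<in> K"
      moreover have "x = - a + (a + x)" by simp
      ultimately show False using that by blast
    qed
  qed
  ultimately show "\<exists>K. compact K \<and> (\<forall>x. x \<notin> K \<longrightarrow> cmod (f (a + x)) < e)" by blast
qed

lemma locally_compact_bump:
  fixes U :: "'a::t2_space set"
  assumes lc: "locally_compact_space (euclidean :: 'a topology)" and U: "open U" "a \<in> U"
  obtains b :: "'a \<Rightarrow> real" where "continuous_on UNIV b" "\<And>x. 0 \<le> b x" "\<And>x. b x \<le> 1" "b a = 1"
    "\<And>x. x \<notin> U \<Longrightarrow> b x = 0"
proof -
  have "completely_regular_space (euclidean :: 'a topology)"
  proof (rule locally_compact_regular_imp_completely_regular_space[OF lc])
    have "Hausdorff_space (euclidean :: 'a topology)"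
      unfolding Hausdorff_space_def disjnt_def by (auto dest!: hausdorff)
    then show "Hausdorff_space (euclidean :: 'a topology) \<or> regular_space (euclidean :: 'a topology)" ..
  qed
  moreover have "closedin euclidean (- U)" "a \<in> topspace euclidean - - U"
    using U by (auto simp: closed_closedin[symmetric])
  ultimately obtain f :: "'a \<Rightarrow> real" where f: "continuous_map euclidean (top_of_set {0..1}) f" "f a = 0" "f ` (- U) \<subseteq> {1}"
    unfolding completely_regular_space_def by blast
  have cont: "continuous_on UNIV f" and range: "f x \<in> {0..1}" for x
    using f(1) by (auto simp: continuous_map_in_subtopology image_subset_iff)
  show ?thesis
  proof (rule that[of "\<lambda>x. 1 - f x"])
    show "continuous_on UNIV (\<lambda>x. 1 - f x)" by (intro continuous_intros cont)
  qed (use f(2,3) range in auto)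
qed

text \<open>These functions are dual to the point masses at the points of \<open>F\<close>; this is
  how linear independence of point masses enters.\<close>

lemma C0_separates:
  fixes a :: "'a::t2_space"
  assumes lc: "locally_compact_space (euclidean :: 'a topology)" and F: "finite F"
  shows "\<exists>f. f \<in> C0 \<and> (\<forall>x\<in>F. f x = of_bool (x = a))"
proof -
  obtain V K where V: "open V" "compact K" "a \<in> V" "V \<subseteq> K"
    using lc unfolding locally_compact_space_def by (auto dest!: spec[of _ a])
  \<comment> \<open>Deleting the other points of \<open>F\<close> makes the bump vanish at them, and
    containment in \<open>K\<close> gives it compact support.\<close>
  have "open (V - (F - {a}))" using V F by (intro open_Diff finite_imp_closed) auto
  moreover have "a \<in> V - (F - {a})" using V by simp
  ultimately obtain b :: "'a \<Rightarrow> real" where b: "continuous_on UNIV b" "b a = 1" "\<And>x. x \<notin> V - (F - {a}) \<Longrightarrow> b x = 0"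
    using locally_compact_bump[OF lc] by metis
  show ?thesis
  proof (intro exI[of _ "\<lambda>x. complex_of_real (b x)"] conjI ballI)
    show "(\<lambda>x. complex_of_real (b x)) \<in> C0"
    proof (rule C0I)
      show "continuous_on UNIV (\<lambda>x. complex_of_real (b x))" by (intro continuous_intros b)
      show "\<exists>K. compact K \<and> (\<forall>x. x \<notin> K \<longrightarrow> cmod (complex_of_real (b x)) < e)" if "0 < e" for e
      proof -
        have "b x = 0" if "x \<notin> K" for x using that V(4) by (intro b(3)) auto
        then show ?thesis using V(2) that by (intro exI[of _ K]) auto
      qed
    qed
    show "complex_of_real (b x) = of_bool (x = a)" if "x \<in> F" for x
      using b(2,3) that by auto
  qed
qed

section \<open>Commutativity of the convolution of bimeasures\<close>

text \<open>Exchanging the two factors turns a tensor form for \<open>(u, v)\<close> into one for \<open>(v, u)\<close>, so the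
  two definite descriptions agree even where they fail to denote; hence Grothendieck's inequality
  is not needed.\<close>

lemma completion_pair_swap:
  assumes "prob_space M" "prob_space N"
  shows "prod.swap \<in> completion (M \<Otimes>\<^sub>M N) \<rightarrow>\<^sub>M completion (N \<Otimes>\<^sub>M M)"
    and "distr (completion (M \<Otimes>\<^sub>M N)) (completion (N \<Otimes>\<^sub>M M)) prod.swap = completion (N \<Otimes>\<^sub>M M)"
proof -
  interpret M: prob_space M by fact
  interpret N: prob_space N by fact
  interpret pair_prob_space N M ..
  have swap: "prod.swap = (\<lambda>(x, y). (y, x))" by auto
  have meas: "prod.swap \<in> M \<Otimes>\<^sub>M N \<rightarrow>\<^sub>M N \<Otimes>\<^sub>M M"
    unfolding swap by (rule measurable_pair_swap')
  have distr: "distr (completion (M \<Otimes>\<^sub>M N)) (N \<Otimes>\<^sub>M M) prod.swap = N \<Otimes>\<^sub>M M"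
    unfolding distr_completion[OF meas] unfolding swap by (rule distr_pair_swap[symmetric])
  show "prod.swap \<in> completion (M \<Otimes>\<^sub>M N) \<rightarrow>\<^sub>M completion (N \<Otimes>\<^sub>M M)"
    by (rule completion.measurable_completion2[OF measurable_completion[OF meas]]) (simp add: distr)
  show "distr (completion (M \<Otimes>\<^sub>M N)) (completion (N \<Otimes>\<^sub>M M)) prod.swap = completion (N \<Otimes>\<^sub>M M)"
    using completion.completion_distr_eq[OF measurable_completion[OF meas]] by (simp add: distr)
qed

lemma L2_completion_swap:
  assumes "prob_space M" "prob_space N" "F \<in> L2 (completion (N \<Otimes>\<^sub>M M))"
  shows "F \<circ> prod.swap \<in> L2 (completion (M \<Otimes>\<^sub>M N))"
    and "L2norm (completion (M \<Otimes>\<^sub>M N)) (F \<circ> prod.swap) = L2norm (completion (N \<Otimes>\<^sub>M M)) F"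
proof -
  note swap = completion_pair_swap[OF assms(1,2)]
  have F: "F \<in> borel_measurable (completion (N \<Otimes>\<^sub>M M))" "integrable (completion (N \<Otimes>\<^sub>M M)) (\<lambda>x. (cmod (F x))\<^sup>2)"
    using assms(3) by (auto simp: L2_def)
  have sq: "(\<lambda>x. (cmod (F x))\<^sup>2) \<in> borel_measurable (completion (N \<Otimes>\<^sub>M M))"
    using F(1) by measurable
  have "integrable (completion (M \<Otimes>\<^sub>M N)) (\<lambda>x. (cmod (F (prod.swap x)))\<^sup>2)"
    using F(2) integrable_distr_eq[OF swap(1) sq] by (simp add: swap(2))
  then show "F \<circ> prod.swap \<in> L2 (completion (M \<Otimes>\<^sub>M N))"
    using measurable_comp[OF swap(1) F(1)] by (simp add: L2_def)
  show "L2norm (completion (M \<Otimes>\<^sub>M N)) (F \<circ> prod.swap) = L2norm (completion (N \<Otimes>\<^sub>M M)) F"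
    using integral_distr[OF swap(1) sq] by (simp add: L2norm_def swap(2))
qed

lemma tensor_form_swap:
  fixes u v :: "('a::topological_space \<Rightarrow> complex) \<Rightarrow> ('b::topological_space \<Rightarrow> complex) \<Rightarrow> complex"
  assumes prob: "prob_space M1" "prob_space M2" "prob_space N1" "prob_space N2"
    and T: "tensor_form u v M1 N1 M2 N2 T"
  shows "tensor_form v u M2 N2 M1 N1 (\<lambda>F G. T (F \<circ> prod.swap) (G \<circ> prod.swap))"
proof -
  note sF = L2_completion_swap[OF prob(1,2)] and sG = L2_completion_swap[OF prob(3,4)]
  have comp: "(\<lambda>x. f x + g x) \<circ> prod.swap = (\<lambda>x. (f \<circ> prod.swap) x + (g \<circ> prod.swap) x)"
    "(\<lambda>x. c * f x) \<circ> prod.swap = (\<lambda>x. c * (f \<circ> prod.swap) x)"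
    for f g :: "'c \<times> 'd \<Rightarrow> complex" and c
    by (simp_all add: fun_eq_iff)
  show ?thesis
    unfolding tensor_form_def Let_def
  proof (intro conjI ballI)
    have T': "bounded_bilinear_form (L2 (completion (M1 \<Otimes>\<^sub>M M2))) (L2norm (completion (M1 \<Otimes>\<^sub>M M2)))
        (L2 (completion (N1 \<Otimes>\<^sub>M N2))) (L2norm (completion (N1 \<Otimes>\<^sub>M N2))) T"
      using T by (simp add: tensor_form_def Let_def)
    then obtain C where C: "\<forall>f\<in>L2 (completion (M1 \<Otimes>\<^sub>M M2)). \<forall>g\<in>L2 (completion (N1 \<Otimes>\<^sub>M N2)).
        cmod (T f g) \<le> C * L2norm (completion (M1 \<Otimes>\<^sub>M M2)) f * L2norm (completion (N1 \<Otimes>\<^sub>M N2)) g"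
      unfolding bounded_bilinear_form_def by blast
    have "\<forall>f\<in>L2 (completion (M2 \<Otimes>\<^sub>M M1)). \<forall>g\<in>L2 (completion (N2 \<Otimes>\<^sub>M N1)).
        cmod (T (f \<circ> prod.swap) (g \<circ> prod.swap)) \<le>
          C * L2norm (completion (M2 \<Otimes>\<^sub>M M1)) f * L2norm (completion (N2 \<Otimes>\<^sub>M N1)) g"
      using C sF sG by metis
    then show "bounded_bilinear_form (L2 (completion (M2 \<Otimes>\<^sub>M M1))) (L2norm (completion (M2 \<Otimes>\<^sub>M M1)))
        (L2 (completion (N2 \<Otimes>\<^sub>M N1))) (L2norm (completion (N2 \<Otimes>\<^sub>M N1)))
        (\<lambda>F G. T (F \<circ> prod.swap) (G \<circ> prod.swap))"
      using T' sF(1) sG(1) unfolding bounded_bilinear_form_def comp by blast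
    fix f1 f2 :: "'a \<Rightarrow> complex" and g1 g2 :: "'b \<Rightarrow> complex"
    assume C0: "f1 \<in> C0" "f2 \<in> C0" "g1 \<in> C0" "g2 \<in> C0"
    have swap: "(\<lambda>(x1, x2). f1 x1 * f2 x2) \<circ> prod.swap = (\<lambda>(x1, x2). f2 x1 * f1 x2)"
      "(\<lambda>(y1, y2). g1 y1 * g2 y2) \<circ> prod.swap = (\<lambda>(y1, y2). g2 y1 * g1 y2)"
      by (auto simp: fun_eq_iff)
    have "T (\<lambda>(x1, x2). f2 x1 * f1 x2) (\<lambda>(y1, y2). g2 y1 * g1 y2) = u f2 g2 * v f1 g1"
      using T C0 unfolding tensor_form_def by blast
    then show "T ((\<lambda>(x1, x2). f1 x1 * f2 x2) \<circ> prod.swap) ((\<lambda>(y1, y2). g1 y1 * g2 y2) \<circ> prod.swap)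
        = v f1 g1 * u f2 g2"
      unfolding swap by (simp only: mult.commute)
  qed
qed

lemma bim_conv_commute:
  fixes u v :: "('a::{topological_ab_group_add, t2_space} \<Rightarrow> complex) \<Rightarrow> ('b::{topological_ab_group_add, t2_space} \<Rightarrow> complex) \<Rightarrow> complex"
  shows "bim_conv u v = bim_conv v u"
proof (intro ext)
  fix f :: "'a \<Rightarrow> complex" and g :: "'b \<Rightarrow> complex"
  let ?P = "\<lambda>u v z. \<exists>M1 N1 M2 N2 T. grothendieck_pair u M1 N1 \<and> grothendieck_pair v M2 N2 \<and>
    tensor_form u v M1 N1 M2 N2 T \<and> z = T (\<lambda>(x1, x2). f (x1 + x2)) (\<lambda>(y1, y2). g (y1 + y2))"
  have "?P v u z" if "?P u v z" for u v z
  proof -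
    from that obtain M1 N1 M2 N2 T where *: "grothendieck_pair u M1 N1" "grothendieck_pair v M2 N2"
      "tensor_form u v M1 N1 M2 N2 T" "z = T (\<lambda>(x1, x2). f (x1 + x2)) (\<lambda>(y1, y2). g (y1 + y2))" by blast
    have "tensor_form v u M2 N2 M1 N1 (\<lambda>F G. T (F \<circ> prod.swap) (G \<circ> prod.swap))"
      using * by (intro tensor_form_swap) (auto simp: grothendieck_pair_def radon_prob_def)
    \<comment> \<open>Commutativity of the groups is used here: the functions on which
      \<open>T\<close> is evaluated are invariant under the exchange.\<close>
    moreover have "(\<lambda>(x1, x2). f (x1 + x2)) \<circ> prod.swap = (\<lambda>(x1, x2). f (x1 + x2))"
      "(\<lambda>(y1, y2). g (y1 + y2)) \<circ> prod.swap = (\<lambda>(y1, y2). g (y1 + y2))"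
      by (auto simp: fun_eq_iff add.commute)
    ultimately show ?thesis using * by (metis (no_types, lifting))
  qed
  then have "?P u v = ?P v u" by (intro ext iffI)
  then show "bim_conv u v f g = bim_conv v u f g"
    unfolding bim_conv_def by (simp only:)
qed

theorem bimeasure_algebra_contractive_imp_finite:
  assumes lc: "locally_compact_space (euclidean :: 'a::{topological_ab_group_add, t2_space} topology)"
    "locally_compact_space (euclidean :: 'b::{topological_ab_group_add, t2_space} topology)"
    and contr: "contractive (bimeasure_algebra :: (('a \<Rightarrow> complex) \<Rightarrow> ('b \<Rightarrow> complex) \<Rightarrow> complex) calg)"
  shows "finite (UNIV :: ('a \<times> 'b) set)"
proof -
  let ?A = "bimeasure_algebra :: (('a \<Rightarrow> complex) \<Rightarrow> ('b \<Rightarrow> complex) \<Rightarrow> complex) calg"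
  define sA where "sA F a = (SOME f :: 'a \<Rightarrow> complex. f \<in> C0 \<and> (\<forall>x\<in>F. f x = of_bool (x = a)))" for F a
  define sB where "sB F b = (SOME g :: 'b \<Rightarrow> complex. g \<in> C0 \<and> (\<forall>y\<in>F. g y = of_bool (y = b)))" for F b
  have sA: "sA F a \<in> C0 \<and> (\<forall>x\<in>F. sA F a x = of_bool (x = a))" if "finite F" for F a
    unfolding sA_def by (rule someI_ex[OF C0_separates[OF lc(1) that]])
  have sB: "sB F b \<in> C0 \<and> (\<forall>y\<in>F. sB F b y = of_bool (y = b))" if "finite F" for F b
    unfolding sB_def by (rule someI_ex[OF C0_separates[OF lc(2) that]])
  \<comment> \<open>The point mass at \<open>p\<close> as a bimeasure, with the value 0 outside
    \<open>C0\<close> that the carrier prescribes.\<close>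
  define d where "d p = (\<lambda>f g. if f \<in> C0 \<and> g \<in> C0 then f (fst p) * g (snd p) else 0)"
    for p :: "'a \<times> 'b"
  show ?thesis
  \<comment> \<open>Each coordinate is separated on its own projection of \<open>F\<close>; the
    product of the two bumps then isolates a single pair in \<open>F\<close>.\<close>
  proof (rule contractive_commutative_finite[OF contr, where d = d and
        T = "\<lambda>F p u. u (sA (fst ` F) (fst p)) (sB (snd ` F) (snd p))"])
    show "tms ?A u v = tms ?A v u" for u v
      by (simp add: bimeasure_algebra_def bim_conv_commute)
    show "d p \<in> carr ?A" for p
    proof -
      have "cmod (f (fst p)) * cmod (g (snd p)) \<le> supnorm f * supnorm g" if "f \<in> C0" "g \<in> C0"
        for f :: "'a \<Rightarrow> complex" and g :: "'b \<Rightarrow> complex"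
        using that C0_le_supnorm[of f "fst p"] C0_le_supnorm[of g "snd p"]
        by (intro mult_mono) (auto intro: order_trans[OF norm_ge_zero])
      then show ?thesis
        by (auto simp: bimeasure_algebra_def bounded_bilinear_form_def d_def C0_add C0_scale distrib_left distrib_right
            norm_mult mult_ac intro!: exI[of _ 1])
    qed
    show "d q (sA (fst ` F) (fst p)) (sB (snd ` F) (snd p)) = of_bool (p = q)"
      if "finite F" "p \<in> F" "q \<in> F" for F p q
      using that sA[of "fst ` F" "fst p"] sB[of "snd ` F" "snd p"] by (auto simp: d_def prod_eq_iff)
  qed (simp_all add: bimeasure_algebra_def)
qed

section \<open>Commutativity of the measure algebra\<close>

text \<open>\<open>n\<close> is the norm of \<phi>, described by being an upper bound that is almost
  attained. Pointwise bounds \<open>B\<close> take the place of \<open>supnorm\<close> so that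
  pointwise estimates apply directly.\<close>

locale C0_functional =
  fixes \<phi> :: "('a::{topological_ab_group_add, t2_space} \<Rightarrow> complex) \<Rightarrow> complex" and n :: real
  assumes add: "f \<in> C0 \<Longrightarrow> g \<in> C0 \<Longrightarrow> \<phi> (\<lambda>x. f x + g x) = \<phi> f + \<phi> g"
    and scale: "f \<in> C0 \<Longrightarrow> \<phi> (\<lambda>x. c * f x) = c * \<phi> f"
    and bound: "f \<in> C0 \<Longrightarrow> (\<And>x. cmod (f x) \<le> B) \<Longrightarrow> cmod (\<phi> f) \<le> n * B"
    and attain: "0 < e \<Longrightarrow> \<exists>g\<in>C0. (\<forall>x. cmod (g x) \<le> 1) \<and> n - e < cmod (\<phi> g)"
begin

lemma n_nonneg: "0 \<le> n"
  using order_trans[OF norm_ge_zero bound[OF C0_zero, of 1]] by simp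

lemma diff: "f \<in> C0 \<Longrightarrow> g \<in> C0 \<Longrightarrow> \<phi> (\<lambda>x. f x - g x) = \<phi> f - \<phi> g"
  using add[of f "\<lambda>x. - 1 * g x"] C0_scale[of g "- 1"] scale[of g "- 1"] by simp

lemma sum:
  assumes "finite P" "\<And>p. p \<in> P \<Longrightarrow> F p \<in> C0"
  shows "(\<lambda>x. \<Sum>p\<in>P. F p x) \<in> C0" "\<phi> (\<lambda>x. \<Sum>p\<in>P. F p x) = (\<Sum>p\<in>P. \<phi> (F p))"
proof -
  have "(\<lambda>x. \<Sum>p\<in>P. F p x) \<in> C0 \<and> \<phi> (\<lambda>x. \<Sum>p\<in>P. F p x) = (\<Sum>p\<in>P. \<phi> (F p))"
    using assms
  proof (induction P rule: finite_induct)
    case empty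
    then show ?case using scale[OF C0_zero, of 0] by (simp add: C0_zero)
  next
    case (insert p P)
    then show ?case
      using C0_add[of "F p" "\<lambda>x. \<Sum>p\<in>P. F p x"] add[of "F p" "\<lambda>x. \<Sum>p\<in>P. F p x"] by simp
  qed
  then show "(\<lambda>x. \<Sum>p\<in>P. F p x) \<in> C0" "\<phi> (\<lambda>x. \<Sum>p\<in>P. F p x) = (\<Sum>p\<in>P. \<phi> (F p))" by auto
qed

text \<open>If \<open>g\<close> almost attains the norm of \<open>\<phi>\<close>, then \<open>\<phi>\<close> is small on functions that live where
  \<open>g\<close> is small. So \<open>k = min 1 (\<bar>g\<bar> / \<eta>)\<close> is a cut-off function for \<open>\<phi>\<close>.\<close>

lemma cutoff:
  assumes e: "0 < e"
  obtains k :: "'a \<Rightarrow> real" where "(\<lambda>x. complex_of_real (k x)) \<in> C0" "\<And>x. 0 \<le> k x" "\<And>x. k x \<le> 1"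
    "\<And>f B. f \<in> C0 \<Longrightarrow> (\<And>x. cmod (f x) \<le> B) \<Longrightarrow> cmod (\<phi> f - \<phi> (\<lambda>x. of_real (k x) * f x)) \<le> e * B"
proof -
  \<comment> \<open>The excess \<open>n * \<eta>\<close> of the perturbed function and the amount by
    which \<open>g\<close> misses the norm are each at most \<open>e / 2\<close>.\<close>
  define \<eta> where "\<eta> = e / (2 * (n + 1))"
  have \<eta>: "0 < \<eta>" "n * \<eta> \<le> e / 2"
    using e n_nonneg by (auto simp: \<eta>_def field_simps)
  obtain g where g: "g \<in> C0" "\<And>x. cmod (g x) \<le> 1" "n - e / 2 < cmod (\<phi> g)"
    using attain[of "e / 2"] e by auto
  define k where "k x = min 1 (cmod (g x) / \<eta>)" for x
  have k: "0 \<le> k x" "k x \<le> 1" for x using \<eta> by (auto simp: k_def)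
  have k_cont: "continuous_on UNIV (\<lambda>x. complex_of_real (k x))"
    unfolding k_def using \<eta> C0_continuous[OF g(1)] by (intro continuous_intros) auto
  have k_C0: "(\<lambda>x. complex_of_real (k x)) \<in> C0"
  proof (rule C0I[OF k_cont])
    fix d :: real assume d: "0 < d"
    then obtain K where K: "compact K" "\<And>x. x \<notin> K \<Longrightarrow> cmod (g x) < \<eta> * d"
      using C0_small[OF g(1), of "\<eta> * d"] \<eta> by auto
    have "cmod (complex_of_real (k x)) < d" if "x \<notin> K" for x
      using K(2)[OF that] \<eta> k(1)[of x] by (auto simp: k_def min_less_iff_disj field_simps)
    then show "\<exists>K. compact K \<and> (\<forall>x. x \<notin> K \<longrightarrow> cmod (complex_of_real (k x)) < d)" using K(1) by blast
  qed
  have small: "cmod (\<phi> f - \<phi> (\<lambda>x. of_real (k x) * f x)) \<le> e" if f: "f \<in> C0" "\<And>x. cmod (f x) \<le> 1" for f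
  proof -
    have kf: "(\<lambda>x. of_real (k x) * f x) \<in> C0"
      using k by (intro C0_mult[OF f(1) k_cont, of 1]) simp
    define h where "h x = f x - of_real (k x) * f x" for x
    have h: "h \<in> C0"
      unfolding h_def using C0_add[OF f(1) C0_scale[OF kf, of "- 1"]] by simp
    have \<phi>h: "\<phi> h = \<phi> f - \<phi> (\<lambda>x. of_real (k x) * f x)"
      unfolding h_def by (rule diff[OF f(1) kf])
    \<comment> \<open>The phase \<open>c\<close> aligns the values at \<open>g\<close> and
      \<open>h\<close>, so that their moduli add up without cancellation.\<close>
    obtain c where c: "cmod c = 1" "cmod (\<phi> g + c * \<phi> h) = cmod (\<phi> g) + cmod (\<phi> h)"
    proof (cases "\<phi> g = 0 \<or> \<phi> h = 0")
      case True
      then show ?thesis using that[of 1] by auto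
    next
      case False
      let ?c = "sgn (\<phi> g) * of_real (cmod (\<phi> h)) / \<phi> h"
      have "\<phi> g + ?c * \<phi> h = sgn (\<phi> g) * of_real (cmod (\<phi> g) + cmod (\<phi> h))"
        using False by (simp add: distrib_left sgn_div_norm scaleR_conv_of_real field_simps)
      moreover have "cmod \<dots> = cmod (\<phi> g) + cmod (\<phi> h)"
        unfolding norm_mult norm_of_real using False by (simp add: norm_sgn)
      ultimately show ?thesis using that[of ?c] False by (simp add: norm_mult norm_divide norm_sgn)
    qed
    \<comment> \<open>\<open>h\<close> vanishes where the modulus of \<open>g\<close> is at least
      \<eta> and is bounded by 1 elsewhere. Adding it raises the bound on \<open>g\<close> by at
      most \<eta>, while the value of \<phi> gains all of \<open>cmod (\<phi> h)\<close>; hence the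
      latter must be small.\<close>
    have "cmod (g x + c * h x) \<le> 1 + \<eta>" for x
    proof (cases "cmod (g x) < \<eta>")
      case True
      have "cmod (h x) = (1 - k x) * cmod (f x)"
      proof -
        have "h x = of_real (1 - k x) * f x" by (simp add: h_def algebra_simps)
        then show ?thesis using k[of x] by (simp only: norm_mult norm_of_real)
      qed
      also have "\<dots> \<le> 1 * 1" using k[of x] f(2)[of x] by (intro mult_mono) auto
      finally have "cmod (h x) \<le> 1" by simp
      then show ?thesis
        using True norm_triangle_ineq[of "g x" "c * h x"] by (simp add: norm_mult c)
    next
      case False
      then have "k x = 1" using \<eta> by (simp add: k_def)
      then show ?thesis using g(2)[of x] \<eta> by (simp add: h_def)
    qed
    moreover have "(\<lambda>x. g x + c * h x) \<in> C0" by (intro C0_add C0_scale g h)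
    ultimately have "cmod (\<phi> (\<lambda>x. g x + c * h x)) \<le> n * (1 + \<eta>)" by (intro bound)
    then have "cmod (\<phi> g) + cmod (\<phi> h) \<le> n * (1 + \<eta>)"
      using add[OF g(1) C0_scale[OF h]] scale[OF h] c(2) by simp
    then have "cmod (\<phi> h) \<le> e" using g(3) \<eta>(2) by (simp add: distrib_left)
    then show ?thesis by (simp add: \<phi>h)
  qed
  show ?thesis
  proof (rule that[OF k_C0 k])
    fix f :: "'a \<Rightarrow> complex" and B :: real assume f: "f \<in> C0" "\<And>x. cmod (f x) \<le> B"
    have kf: "(\<lambda>x. of_real (k x) * f x) \<in> C0"
      using k by (intro C0_mult[OF f(1) k_cont, of 1]) simp
    show "cmod (\<phi> f - \<phi> (\<lambda>x. of_real (k x) * f x)) \<le> e * B"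
    proof (cases "B = 0")
      case True
      then have "f = (\<lambda>_. 0)" using f(2) by auto
      then show ?thesis using True by simp
    next
      case False
      then have B: "0 < B" using f(2)[of 0] norm_ge_zero[of "f 0"] by linarith
      have "cmod (\<phi> (\<lambda>x. of_real (1 / B) * f x) - \<phi> (\<lambda>x. of_real (k x) * (of_real (1 / B) * f x))) \<le> e"
        using B f(2) by (intro small C0_scale f) (simp add: norm_divide field_simps)
      also have "(\<lambda>x. of_real (k x) * (of_real (1 / B) * f x)) = (\<lambda>x. of_real (1 / B) * (of_real (k x) * f x))"
        by (simp add: mult_ac)
      also have "\<phi> (\<lambda>x. of_real (1 / B) * f x) - \<phi> (\<lambda>x. of_real (1 / B) * (of_real (k x) * f x))
          = of_real (1 / B) * (\<phi> f - \<phi> (\<lambda>x. of_real (k x) * f x))"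
        by (simp only: scale[OF f(1)] scale[OF kf] right_diff_distrib)
      also have "cmod \<dots> = cmod (\<phi> f - \<phi> (\<lambda>x. of_real (k x) * f x)) / B"
        using B by (simp add: norm_mult norm_divide)
      finally show ?thesis using B by (simp add: field_simps)
    qed
  qed
qed

text \<open>A partition of unity turns \<open>\<phi>\<close> into a combination of finitely many point masses, up to a
  small error on functions that vary little along \<open>U\<close>.\<close>

lemma discretize:
  assumes lc: "locally_compact_space (euclidean :: 'a topology)"
    and U: "open U" "0 \<in> U" and e: "0 < e"
  obtains P a where "finite P" "\<And>F B \<omega>. F \<in> C0 \<Longrightarrow> (\<And>x. cmod (F x) \<le> B) \<Longrightarrow>
    (\<And>x x'. x - x' \<in> U \<Longrightarrow> cmod (F x - F x') \<le> \<omega>) \<Longrightarrow> cmod (\<phi> F - (\<Sum>p\<in>P. a p * F p)) \<le> n * \<omega> + e * B"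
proof -
  define e1 where "e1 = e / (2 * (n + 1))"
  have e1: "0 < e1" "n * e1 \<le> e / 2"
    using e n_nonneg by (auto simp: e1_def field_simps)
  obtain k :: "'a \<Rightarrow> real" where k: "(\<lambda>x. complex_of_real (k x)) \<in> C0" "\<And>x. 0 \<le> k x" "\<And>x. k x \<le> 1"
    "\<And>f B. f \<in> C0 \<Longrightarrow> (\<And>x. cmod (f x) \<le> B) \<Longrightarrow> cmod (\<phi> f - \<phi> (\<lambda>x. of_real (k x) * f x)) \<le> e / 2 * B"
    using cutoff[of "e / 2"] e by auto
  obtain K where K: "compact K" "\<And>x. x \<notin> K \<Longrightarrow> k x < e1"
    using C0_small[OF k(1) e1(1)] k(2) by auto
  obtain b :: "'a \<Rightarrow> real" where b: "continuous_on UNIV b" "\<And>x. 0 \<le> b x" "\<And>x. b x \<le> 1" "b 0 = 1"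
    "\<And>x. x \<notin> U \<Longrightarrow> b x = 0"
    by (rule locally_compact_bump[OF lc U]) blast
  have b_cont: "continuous_on UNIV (\<lambda>x. b (x - p))" for p
    by (rule continuous_on_compose2[OF b(1)]) (auto intro: continuous_intros)
  have "K \<subseteq> (\<Union>p\<in>K. {x. 1 / 2 < b (x - p)})" using b(4) by auto
  moreover have "open {x. 1 / 2 < b (x - p)}" for p
    by (intro open_Collect_less continuous_intros b_cont)
  ultimately obtain P where P: "P \<subseteq> K" "finite P" "K \<subseteq> (\<Union>p\<in>P. {x. 1 / 2 < b (x - p)})"
    using compactE_image[OF K(1)] by metis
  define s where "s x = (\<Sum>p\<in>P. b (x - p))" for x
  \<comment> \<open>The maximum with 1/2 keeps the denominator away from 0 on the whole group, and
    on \<open>K\<close> it equals \<open>s\<close>, so that there the weights \<open>w\<close> form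
    a partition of unity.\<close>
  define m where "m x = max (1 / 2) (s x)" for x
  have s: "0 \<le> s x" for x unfolding s_def by (intro sum_nonneg b)
  have m: "0 < m x" "s x \<le> m x" for x by (auto simp: m_def)
  have m_K: "m x = s x" if "x \<in> K" for x
  proof -
    obtain p where p: "p \<in> P" "1 / 2 < b (x - p)" using P(3) \<open>x \<in> K\<close> by blast
    have "b (x - p) \<le> s x" unfolding s_def using P(2) b(2) p(1) by (intro member_le_sum) auto
    then show ?thesis using p by (simp add: m_def)
  qed
  have m_cont: "continuous_on UNIV m"
    unfolding m_def s_def by (intro continuous_intros b_cont)
  define w where "w p x = b (x - p) / m x" for p x
  have w_nonneg: "0 \<le> w p x" for p x using b(2) m(1)[of x] by (simp add: w_def)
  have w_sum: "(\<Sum>p\<in>P. w p x) = s x / m x" for x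
    by (simp add: w_def s_def sum_divide_distrib)
  \<comment> \<open>The factor \<open>k\<close> puts the weights into \<open>C0\<close>, so that
    \<phi> can be applied to them; the values are the masses of the approximating point
    masses.\<close>
  define g where "g p x = complex_of_real (w p x) * complex_of_real (k x)" for p x
  have g: "g p \<in> C0" for p
    unfolding g_def
  proof (rule C0_mult[OF k(1), where B = 2])
    have "m x \<noteq> 0" for x using m(1)[of x] by simp
    then show "continuous_on UNIV (\<lambda>x. complex_of_real (w p x))"
      unfolding w_def by (intro continuous_intros b_cont m_cont) auto
    have "b (x - p) \<le> 2 * m x" for x using b(3)[of "x - p"] by (simp add: m_def)
    then have "w p x \<le> 2" for x using m(1)[of x] by (simp add: w_def divide_le_eq)
    then show "cmod (complex_of_real (w p x)) \<le> 2" for x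
      using w_nonneg[of p x] by simp
  qed
  show ?thesis
  proof (rule that[of P "\<lambda>p. \<phi> (g p)", OF P(2)])
    fix F :: "'a \<Rightarrow> complex" and B \<omega> :: real assume F: "F \<in> C0" "\<And>x. cmod (F x) \<le> B" "\<And>x x'. x - x' \<in> U \<Longrightarrow> cmod (F x - F x') \<le> \<omega>"
    have B: "0 \<le> B" using F(2)[of 0] norm_ge_zero order_trans by blast
    have \<omega>: "0 \<le> \<omega>" using F(3)[of 0 0] U(2) by simp
    have kF: "(\<lambda>x. of_real (k x) * F x) \<in> C0"
      using k(2,3) by (intro C0_mult[OF F(1) C0_continuous[OF k(1)], of 1]) simp
    have Fg: "(\<lambda>x. F p * g p x) \<in> C0" for p by (intro C0_scale g)
    note S = sum[of P "\<lambda>p x. F p * g p x", OF P(2) Fg]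
    have pointwise: "cmod (of_real (k x) * F x - (\<Sum>p\<in>P. F p * g p x)) \<le> \<omega> + e1 * B" for x
    proof -
      have "(\<Sum>p\<in>P. complex_of_real (w p x)) = of_real (s x / m x)"
        by (simp only: of_real_sum[symmetric] w_sum)
      then have diffs: "(\<Sum>p\<in>P. of_real (w p x) * (F x - F p)) =
          of_real (s x / m x) * F x - (\<Sum>p\<in>P. of_real (w p x) * F p)"
        by (simp only: right_diff_distrib sum_subtractf sum_distrib_right[symmetric])
      have "(\<Sum>p\<in>P. F p * g p x) = of_real (k x) * (\<Sum>p\<in>P. of_real (w p x) * F p)"
        by (simp add: g_def sum_distrib_left mult_ac)
      \<comment> \<open>The error splits into the variation of \<open>F\<close> along
        \<open>U\<close> and the defect of the partition of unity. The defect is zero on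
        \<open>K\<close>, and off \<open>K\<close> it is damped by \<open>k < e1\<close>.\<close>
      then have eq: "of_real (k x) * F x - (\<Sum>p\<in>P. F p * g p x) =
          of_real (k x) * (\<Sum>p\<in>P. of_real (w p x) * (F x - F p)) + of_real (k x * (1 - s x / m x)) * F x"
        unfolding diffs of_real_mult of_real_diff of_real_1 by (simp only:) (simp only: algebra_simps mult_1)
      have "cmod (\<Sum>p\<in>P. of_real (w p x) * (F x - F p)) \<le> (\<Sum>p\<in>P. w p x * \<omega>)"
      proof (rule sum_norm_le)
        fix p assume "p \<in> P"
        show "cmod (of_real (w p x) * (F x - F p)) \<le> w p x * \<omega>"
        proof (cases "x - p \<in> U")
          case True
          then show ?thesis using F(3) w_nonneg by (simp add: norm_mult mult_left_mono)
        next
          case False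
          then show ?thesis using b(5) by (simp add: w_def)
        qed
      qed
      also have "\<dots> = s x / m x * \<omega>" by (simp only: sum_distrib_right[symmetric] w_sum)
      also have "\<dots> \<le> 1 * \<omega>" using m[of x] \<omega> by (intro mult_right_mono) auto
      finally have "cmod (of_real (k x) * (\<Sum>p\<in>P. of_real (w p x) * (F x - F p))) \<le> 1 * \<omega>"
        unfolding norm_mult using k(2,3)[of x] by (intro mult_mono) auto
      moreover have "cmod (of_real (k x * (1 - s x / m x)) * F x) \<le> e1 * B"
      proof -
        have "k x * (1 - s x / m x) \<le> e1"
        proof (cases "x \<in> K")
          case True
          then show ?thesis using m(1)[of x] m_K[of x] e1 by simp
        next
          case False
          have "k x * (1 - s x / m x) \<le> k x * 1"
            using k(2)[of x] m(1)[of x] s[of x] by (intro mult_left_mono) auto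
          then show ?thesis using K(2)[OF False] by simp
        qed
        moreover have "0 \<le> k x * (1 - s x / m x)"
          using k(2)[of x] m[of x] by (intro mult_nonneg_nonneg) auto
        ultimately show ?thesis
          unfolding norm_mult norm_of_real using F(2)[of x] e1 by (intro mult_mono) auto
      qed
      ultimately show ?thesis
        unfolding eq using norm_triangle_ineq order_trans add_mono by (smt (verit))
    qed
    have "cmod (\<phi> (\<lambda>x. of_real (k x) * F x - (\<Sum>p\<in>P. F p * g p x))) \<le> n * (\<omega> + e1 * B)"
    proof (rule bound)
      show "(\<lambda>x. of_real (k x) * F x - (\<Sum>p\<in>P. F p * g p x)) \<in> C0"
        using C0_add[OF kF C0_scale[OF S(1), of "- 1"]] by simp
    qed (rule pointwise)
    also have "\<phi> (\<lambda>x. of_real (k x) * F x - (\<Sum>p\<in>P. F p * g p x)) = \<phi> (\<lambda>x. of_real (k x) * F x) - (\<Sum>p\<in>P. \<phi> (g p) * F p)"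
      unfolding diff[OF kF S(1)] S(2) by (simp add: scale[OF g] mult.commute)
    finally have "cmod (\<phi> (\<lambda>x. of_real (k x) * F x) - (\<Sum>p\<in>P. \<phi> (g p) * F p)) \<le> n * \<omega> + (n * e1) * B"
      by (simp add: distrib_left mult.assoc)
    also have "\<dots> \<le> n * \<omega> + e / 2 * B" using mult_right_mono[OF e1(2) B] by simp
    finally show "cmod (\<phi> F - (\<Sum>p\<in>P. \<phi> (g p) * F p)) \<le> n * \<omega> + e * B"
      using k(4)[OF F(1,2)] norm_triangle_ineq[of "\<phi> F - \<phi> (\<lambda>x. of_real (k x) * F x)" "\<phi> (\<lambda>x. of_real (k x) * F x) - (\<Sum>p\<in>P. \<phi> (g p) * F p)"]
      by simp
  qed
qed

end

text \<open>Joint continuity of \<open>f (y + u) - f y\<close> near \<open>u = 0\<close> and a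
  finite cover of \<open>K\<close> handle pairs that meet \<open>K\<close>; outside \<open>K\<close>
  both values are below \<open>e / 2\<close>.\<close>

lemma C0_uniformly_continuous:
  fixes f :: "'a::topological_ab_group_add \<Rightarrow> complex"
  assumes f: "f \<in> C0" and e: "0 < e"
  obtains U where "open U" "0 \<in> U" "\<And>x y. x - y \<in> U \<Longrightarrow> cmod (f x - f y) < e"
proof -
  obtain K where K: "compact K" "\<And>x. x \<notin> K \<Longrightarrow> cmod (f x) < e / 2" using C0_small[OF f, of "e / 2"] e by auto
  have "\<exists>A U. open A \<and> open U \<and> x \<in> A \<and> 0 \<in> U \<and> (\<forall>y\<in>A. \<forall>u\<in>U. cmod (f (y + u) - f y) < e)" for x
  proof -
    let ?h = "\<lambda>z :: 'a \<times> 'a. cmod (f (fst z + snd z) - f (fst z))"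
    have "continuous_on UNIV (\<lambda>z :: 'a \<times> 'a. f (fst z + snd z))" "continuous_on UNIV (\<lambda>z :: 'a \<times> 'a. f (fst z))"
      by (rule continuous_on_compose2[OF C0_continuous[OF f]]; auto intro!: continuous_intros)+
    then have "open {z. ?h z < e}"
      by (intro open_Collect_less continuous_intros)
    moreover have "(x, 0) \<in> {z. ?h z < e}" using e by simp
    ultimately obtain A U where "open A" "open U" "x \<in> A" "0 \<in> U" "A \<times> U \<subseteq> {z. ?h z < e}"
      by (auto elim!: open_prod_elim)
    then show ?thesis by (intro exI[of _ A] exI[of _ U]) auto
  qed
  then have "\<forall>x. \<exists>A U. open A \<and> open U \<and> x \<in> A \<and> 0 \<in> U \<and> (\<forall>y\<in>A. \<forall>u\<in>U. cmod (f (y + u) - f y) < e)"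
    by (intro allI)
  then obtain A U where AU: "\<And>x. open (A x)" "\<And>x. open (U x)" "\<And>x. x \<in> A x" "\<And>x. 0 \<in> U x"
    "\<And>x y u. y \<in> A x \<Longrightarrow> u \<in> U x \<Longrightarrow> cmod (f (y + u) - f y) < e"
    unfolding choice_iff by blast
  have cover: "K \<subseteq> (\<Union>x\<in>K. A x)" using AU(3) by auto
  obtain P where "P \<subseteq> K" and P: "finite P" "K \<subseteq> (\<Union>x\<in>P. A x)"
    by (rule compactE_image[OF K(1) AU(1) cover])
  define V where "V = (\<Inter>x\<in>P. U x)"
  have V: "open V" "0 \<in> V" using P(1) AU(2,4) by (auto simp: V_def)
  have V_K: "cmod (f (y + u) - f y) < e" if "y \<in> K" "u \<in> V" for y u
    using P(2) AU(5) that unfolding V_def by blast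
  show ?thesis
  \<comment> \<open>Symmetrizing \<open>V\<close> covers the case in which only \<open>x\<close>,
    and not \<open>y\<close>, lies in \<open>K\<close>.\<close>
  proof (rule that[of "V \<inter> uminus -` V"])
    have "open (uminus -` V)"
      using V(1) by (intro open_vimage continuous_intros) auto
    then show "open (V \<inter> uminus -` V)" using V(1) by blast
    show "0 \<in> V \<inter> uminus -` V" using V(2) by simp
    fix x y assume xy: "x - y \<in> V \<inter> uminus -` V"
    then have xy': "x - y \<in> V" "y - x \<in> V" by auto
    consider "y \<in> K" | "x \<in> K" | "x \<notin> K" "y \<notin> K" by blast
    then show "cmod (f x - f y) < e"
    proof cases
      case 1
      then show ?thesis using V_K[OF 1 xy'(1)] by simp
    next
      case 2
      then show ?thesis using V_K[OF 2 xy'(2)] by (simp add: norm_minus_commute)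
    next
      case 3
      then show ?thesis using K(2)[of x] K(2)[of y] norm_triangle_ineq4[of "f x" "f y"] by simp
    qed
  qed
qed

section \<open>Convolution with a functional and the interchange of two functionals\<close>

context C0_functional
begin

lemma convolution_diff:
  assumes f: "f \<in> C0" and U: "\<And>x y. x - y \<in> U \<Longrightarrow> cmod (f x - f y) < e" and xy: "x - y \<in> U"
  shows "cmod (\<phi> (\<lambda>z. f (x + z)) - \<phi> (\<lambda>z. f (y + z))) \<le> n * e"
  unfolding diff[OF C0_translate[OF f] C0_translate[OF f], symmetric]
proof (rule bound)
  show "(\<lambda>z. f (x + z) - f (y + z)) \<in> C0"
    using C0_add[OF C0_translate[OF f, of x] C0_scale[OF C0_translate[OF f, of y], of "- 1"]] by simp
  show "cmod (f (x + z) - f (y + z)) \<le> e" for z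
    using U[of "x + z" "y + z"] xy by simp
qed

text \<open>For decay, cut \<phi> off to a compact set \<open>K\<close> and let \<open>f\<close> be
  small outside a compact set \<open>L\<close>. If \<open>x\<close> is not a difference of a point
  of \<open>L\<close> and a point of \<open>K\<close>, then \<open>f (x + z)\<close> is small for
  every \<open>z\<close> in \<open>K\<close>, and for other \<open>z\<close> the cut-off is
  small.\<close>

lemma convolution_C0:
  assumes f: "f \<in> C0"
  shows "(\<lambda>x. \<phi> (\<lambda>z. f (x + z))) \<in> C0"
proof (rule C0I)
  obtain B where B: "\<And>x. cmod (f x) \<le> B" using C0_bounded[OF f] by blast
  have B0: "0 \<le> B" using B[of 0] norm_ge_zero order_trans by blast
  show "continuous_on UNIV (\<lambda>x. \<phi> (\<lambda>z. f (x + z)))"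
    unfolding continuous_on_def
  proof (intro ballI tendstoI)
    fix x :: 'a and e :: real assume e: "0 < e"
    have "0 < e / (n + 1)" using e n_nonneg by simp
    then obtain U where U: "open U" "0 \<in> U" "\<And>x y. x - y \<in> U \<Longrightarrow> cmod (f x - f y) < e / (n + 1)"
      by (rule C0_uniformly_continuous[OF f]) blast
    have "open ((\<lambda>y. y - x) -` U)" using U(1) by (intro open_vimage continuous_intros) auto
    moreover have "x \<in> (\<lambda>y. y - x) -` U" using U(2) by simp
    moreover have "dist (\<phi> (\<lambda>z. f (y + z))) (\<phi> (\<lambda>z. f (x + z))) < e" if "y \<in> (\<lambda>y. y - x) -` U" for y
    proof -
      have "dist (\<phi> (\<lambda>z. f (y + z))) (\<phi> (\<lambda>z. f (x + z))) \<le> n * (e / (n + 1))"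
        unfolding dist_norm using that by (intro convolution_diff[OF f U(3)]) auto
      also have "\<dots> < e" using e n_nonneg by (simp add: field_simps)
      finally show ?thesis .
    qed
    ultimately show "\<forall>\<^sub>F y in at x within UNIV. dist (\<phi> (\<lambda>z. f (y + z))) (\<phi> (\<lambda>z. f (x + z))) < e"
      unfolding eventually_at_topological by blast
  qed
  fix e :: real assume e: "0 < e"
  have "0 < e / (2 * (B + 1))" using e B0 by simp
  then obtain k :: "'a \<Rightarrow> real" where k: "(\<lambda>x. complex_of_real (k x)) \<in> C0" "\<And>x. 0 \<le> k x" "\<And>x. k x \<le> 1"
    "\<And>f C. f \<in> C0 \<Longrightarrow> (\<And>x. cmod (f x) \<le> C) \<Longrightarrow>
      cmod (\<phi> f - \<phi> (\<lambda>x. of_real (k x) * f x)) \<le> e / (2 * (B + 1)) * C"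
    by (rule cutoff) blast
  \<comment> \<open>The part of \<phi> kept by the cut-off contributes at most \<open>n * d\<close>,
    which is below \<open>e / 2\<close>; the part that is dropped contributes at most
    \<open>e / 2\<close>.\<close>
  define d where "d = e / (4 * (n + 1))"
  have d0: "0 < d" using e n_nonneg by (simp add: d_def)
  have "(n + 1) * d = e / 4" using n_nonneg by (simp add: d_def divide_simps)
  then have d: "0 < d" "n * d < e / 2" using d0 e by (auto simp: distrib_right)
  obtain K where K: "compact K" "\<And>x. x \<notin> K \<Longrightarrow> k x < d / (B + 1)"
    using C0_small[OF k(1), of "d / (B + 1)"] d(1) B0 k(2) by auto
  obtain L where L: "compact L" "\<And>x. x \<notin> L \<Longrightarrow> cmod (f x) < d"
    using C0_small[OF f d(1)] by blast
  have "compact ((\<lambda>z :: 'a \<times> 'a. fst z - snd z) ` (L \<times> K))"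
    by (intro compact_continuous_image compact_Times L(1) K(1)) (auto intro!: continuous_intros)
  moreover have "cmod (\<phi> (\<lambda>z. f (x + z))) < e" if x: "x \<notin> (\<lambda>z :: 'a \<times> 'a. fst z - snd z) ` (L \<times> K)" for x
  proof -
    have fx: "(\<lambda>z. f (x + z)) \<in> C0" by (rule C0_translate[OF f])
    have "cmod (of_real (k z) * f (x + z)) \<le> d" for z
    proof (cases "z \<in> K")
      case True
      have "x + z \<notin> L"
      proof
        assume "x + z \<in> L"
        then have "(x + z) - z \<in> (\<lambda>z :: 'a \<times> 'a. fst z - snd z) ` (L \<times> K)" using True by force
        then show False using x by simp
      qed
      then have "cmod (f (x + z)) < d" by (rule L(2))
      then have "k z * cmod (f (x + z)) \<le> 1 * d" using k(2,3)[of z] by (intro mult_mono) auto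
      then show ?thesis using k(2) by (simp add: norm_mult)
    next
      case False
      have "k z * cmod (f (x + z)) \<le> d / (B + 1) * (B + 1)"
        using K(2)[OF False] k(2)[of z] B[of "x + z"] B0 d(1) by (intro mult_mono) auto
      then show ?thesis using k(2) B0 by (simp add: norm_mult)
    qed
    then have "cmod (\<phi> (\<lambda>z. of_real (k z) * f (x + z))) \<le> n * d"
      using k(2,3) by (intro bound C0_mult[OF fx C0_continuous[OF k(1)], of 1]) auto
    moreover have "cmod (\<phi> (\<lambda>z. f (x + z)) - \<phi> (\<lambda>z. of_real (k z) * f (x + z))) \<le> e / (2 * (B + 1)) * B"
      by (rule k(4)[OF fx B])
    moreover have "e / (2 * (B + 1)) * B \<le> e / 2" using e B0 by (simp add: field_simps)
    ultimately show ?thesis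
      using d(2) norm_triangle_sub[of "\<phi> (\<lambda>z. f (x + z))" "\<phi> (\<lambda>z. of_real (k z) * f (x + z))"] by linarith
  qed
  ultimately show "\<exists>K. compact K \<and> (\<forall>x. x \<notin> K \<longrightarrow> cmod (\<phi> (\<lambda>z. f (x + z))) < e)" by blast
qed

end

text \<open>After \<phi> is replaced by finitely many point masses, the interchange with \<psi> is
  linearity. By \<open>discretize\<close> and uniform continuity both sides change by a multiple of
  \<open>d\<close>, which is arbitrary.\<close>

lemma C0_functional_fubini:
  fixes \<phi> \<psi> :: "('a::{topological_ab_group_add, t2_space} \<Rightarrow> complex) \<Rightarrow> complex"
  assumes lc: "locally_compact_space (euclidean :: 'a topology)"
    and "C0_functional \<phi> n" "C0_functional \<psi> m" and f: "f \<in> C0"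
  shows "\<phi> (\<lambda>x. \<psi> (\<lambda>y. f (x + y))) = \<psi> (\<lambda>y. \<phi> (\<lambda>x. f (y + x)))"
proof -
  interpret \<phi>: C0_functional \<phi> n by fact
  interpret \<psi>: C0_functional \<psi> m by fact
  obtain B where B: "\<And>x. cmod (f x) \<le> B" using C0_bounded[OF f] by blast
  let ?F = "\<lambda>x. \<psi> (\<lambda>y. f (x + y))" and ?G = "\<lambda>y. \<phi> (\<lambda>x. f (y + x))"
  have F: "?F \<in> C0" by (rule \<psi>.convolution_C0[OF f])
  have G: "?G \<in> C0" by (rule \<phi>.convolution_C0[OF f])
  have fx: "(\<lambda>y. f (x + y)) \<in> C0" for x by (rule C0_translate[OF f])
  have close: "cmod (\<phi> ?F - \<psi> ?G) \<le> d * (2 * n * m + 2 * m * B)" if d: "0 < d" for d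
  proof -
    obtain U where U: "open U" "0 \<in> U" "\<And>x y. x - y \<in> U \<Longrightarrow> cmod (f x - f y) < d"
      by (rule C0_uniformly_continuous[OF f d]) blast
    \<comment> \<open>The same points and weights serve \<open>?F\<close> and every translate of
      \<open>f\<close>. This uniformity in the translate is what allows \<psi> to be applied to the
      approximation error.\<close>
    obtain P a where P: "finite P" "\<And>F B \<omega>. F \<in> C0 \<Longrightarrow> (\<And>x. cmod (F x) \<le> B) \<Longrightarrow>
      (\<And>x x'. x - x' \<in> U \<Longrightarrow> cmod (F x - F x') \<le> \<omega>) \<Longrightarrow> cmod (\<phi> F - (\<Sum>p\<in>P. a p * F p)) \<le> n * \<omega> + d * B"
      by (rule \<phi>.discretize[OF lc U(1,2) d]) blast
    have 1: "cmod (\<phi> ?F - (\<Sum>p\<in>P. a p * ?F p)) \<le> n * (m * d) + d * (m * B)"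
    proof (rule P(2)[OF F])
      show "cmod (?F x) \<le> m * B" for x by (intro \<psi>.bound fx B)
      show "cmod (?F x - ?F x') \<le> m * d" if "x - x' \<in> U" for x x'
        by (rule \<psi>.convolution_diff[OF f U(3) that])
    qed
    have S: "(\<lambda>y. \<Sum>p\<in>P. a p * f (p + y)) \<in> C0" "\<psi> (\<lambda>y. \<Sum>p\<in>P. a p * f (p + y)) = (\<Sum>p\<in>P. a p * ?F p)"
      using \<psi>.sum[of P "\<lambda>p y. a p * f (p + y)", OF P(1) C0_scale[OF fx]] by (simp_all add: \<psi>.scale[OF fx])
    have "cmod (\<psi> (\<lambda>y. ?G y - (\<Sum>p\<in>P. a p * f (p + y)))) \<le> m * (n * d + d * B)"
    proof (rule \<psi>.bound)
      show "(\<lambda>y. ?G y - (\<Sum>p\<in>P. a p * f (p + y))) \<in> C0"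
        using C0_add[OF G C0_scale[OF S(1), of "- 1"]] by simp
      show "cmod (?G y - (\<Sum>p\<in>P. a p * f (p + y))) \<le> n * d + d * B" for y
        unfolding add.commute[of _ y]
      proof (rule P(2)[OF fx B])
        show "cmod (f (y + x) - f (y + x')) \<le> d" if "x - x' \<in> U" for x x'
          using U(3)[of "y + x" "y + x'"] that by simp
      qed
    qed
    then have 2: "cmod (\<psi> ?G - (\<Sum>p\<in>P. a p * ?F p)) \<le> m * (n * d + d * B)"
      unfolding \<psi>.diff[OF G S(1)] S(2) .
    have "cmod (\<phi> ?F - \<psi> ?G) \<le> cmod (\<phi> ?F - (\<Sum>p\<in>P. a p * ?F p)) + cmod (\<psi> ?G - (\<Sum>p\<in>P. a p * ?F p))"
      using norm_triangle_ineq4[of "\<phi> ?F - (\<Sum>p\<in>P. a p * ?F p)" "\<psi> ?G - (\<Sum>p\<in>P. a p * ?F p)"] by simp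
    also have "\<dots> \<le> (n * (m * d) + d * (m * B)) + m * (n * d + d * B)" by (intro add_mono 1 2)
    also have "\<dots> = d * (2 * n * m + 2 * m * B)" by (simp add: algebra_simps)
    finally show ?thesis .
  qed
  have "cmod (\<phi> ?F - \<psi> ?G) \<le> 0"
  proof (rule tendsto_lowerbound)
    show "((\<lambda>d. d * (2 * n * m + 2 * m * B)) \<longlongrightarrow> 0) (at_right 0)"
      by (auto intro!: tendsto_eq_intros)
    show "\<forall>\<^sub>F d in at_right 0. cmod (\<phi> ?F - \<psi> ?G) \<le> d * (2 * n * m + 2 * m * B)"
      using close by (auto intro: eventually_at_rightI[of 0 1])
  qed simp
  then show ?thesis by simp
qed

text \<open>\<open>n\<close> is the operator norm, the supremum over the unit ball of
  \<open>C0\<close>, so it is almost attained by definition.\<close>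

lemma measure_algebra_functional:
  assumes "\<phi> \<in> carr (measure_algebra :: (('a::{topological_ab_group_add, t2_space} \<Rightarrow> complex) \<Rightarrow> complex) calg)"
  shows "\<exists>n. C0_functional \<phi> n"
proof -
  let ?B = "{f :: 'a \<Rightarrow> complex. f \<in> C0 \<and> (\<forall>x. cmod (f x) \<le> 1)}"
  have \<phi>: "f \<in> C0 \<Longrightarrow> g \<in> C0 \<Longrightarrow> \<phi> (\<lambda>x. f x + g x) = \<phi> f + \<phi> g"
    "f \<in> C0 \<Longrightarrow> \<phi> (\<lambda>x. c * f x) = c * \<phi> f" "\<exists>C. \<forall>f\<in>C0. cmod (\<phi> f) \<le> C * supnorm f" for f g c
    using assms by (simp_all add: measure_algebra_def)
  then obtain C where C: "\<forall>f\<in>C0. cmod (\<phi> f) \<le> C * supnorm f" by blast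
  define n where "n = (SUP f\<in>?B. cmod (\<phi> f))"
  have ne: "?B \<noteq> {}" using C0_zero by force
  have bdd: "bdd_above ((\<lambda>f. cmod (\<phi> f)) ` ?B)"
  proof (rule bdd_aboveI2)
    fix f assume f: "f \<in> ?B"
    have "0 \<le> supnorm f" using C0_le_supnorm[of f 0] f norm_ge_zero order_trans by blast
    have "cmod (\<phi> f) \<le> C * supnorm f" using C f by blast
    also have "\<dots> \<le> \<bar>C\<bar> * 1"
      using f \<open>0 \<le> supnorm f\<close> by (intro mult_mono supnorm_least) auto
    finally show "cmod (\<phi> f) \<le> \<bar>C\<bar>" by simp
  qed
  have "C0_functional \<phi> n"
  proof
    show "cmod (\<phi> f) \<le> n * B" if f: "f \<in> C0" "\<And>x. cmod (f x) \<le> B" for f B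
    proof (cases "B = 0")
      case True
      then have "f = (\<lambda>_. 0)" using f(2) by auto
      then show ?thesis using True \<phi>(2)[OF C0_zero, of 0] by simp
    next
      case False
      then have B: "0 < B" using f(2)[of 0] norm_ge_zero[of "f 0"] by linarith
      have "(\<lambda>x. of_real (1 / B) * f x) \<in> ?B"
      proof (intro CollectI conjI allI C0_scale f)
        show "cmod (of_real (1 / B) * f x) \<le> 1" for x
          using B f(2)[of x] by (simp add: norm_mult norm_divide)
      qed
      then have "cmod (\<phi> (\<lambda>x. of_real (1 / B) * f x)) \<le> n"
        unfolding n_def by (rule cSUP_upper[OF _ bdd])
      then have "cmod (\<phi> f) / B \<le> n"
        unfolding \<phi>(2)[OF f(1)] using B by (simp add: norm_mult norm_divide)
      then show ?thesis using B by (simp add: field_simps)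
    qed
    show "\<exists>g\<in>C0. (\<forall>x. cmod (g x) \<le> 1) \<and> n - e < cmod (\<phi> g)" if "0 < e" for e
      using less_cSUP_iff[OF ne bdd, of "n - e"] that by (auto simp: n_def)
  qed (use \<phi>(1,2) in auto)
  then show ?thesis by blast
qed

theorem measure_algebra_contractive_imp_finite:
  assumes lc: "locally_compact_space (euclidean :: 'a::{topological_ab_group_add, t2_space} topology)"
    and contr: "contractive (measure_algebra :: (('a \<Rightarrow> complex) \<Rightarrow> complex) calg)"
  shows "finite (UNIV :: 'a set)"
proof -
  let ?A = "measure_algebra :: (('a \<Rightarrow> complex) \<Rightarrow> complex) calg"
  define s where "s F a = (SOME f :: 'a \<Rightarrow> complex. f \<in> C0 \<and> (\<forall>x\<in>F. f x = of_bool (x = a)))" for F a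
  have s: "s F a \<in> C0 \<and> (\<forall>x\<in>F. s F a x = of_bool (x = a))" if "finite F" for F a
    unfolding s_def by (rule someI_ex[OF C0_separates[OF lc that]])
  define d where "d a = (\<lambda>f. if f \<in> C0 then f a else 0)" for a :: 'a
  show ?thesis
  proof (rule contractive_commutative_finite[OF contr, where d = d and T = "\<lambda>F a \<phi>. \<phi> (s F a)"])
    show "tms ?A \<phi> \<psi> = tms ?A \<psi> \<phi>" if mem: "\<phi> \<in> carr ?A" "\<psi> \<in> carr ?A" for \<phi> \<psi>
    proof -
      obtain n m where "C0_functional \<phi> n" "C0_functional \<psi> m"
        using measure_algebra_functional[OF mem(1)] measure_algebra_functional[OF mem(2)] by blast
      then show ?thesis
        by (auto simp: measure_algebra_def fun_eq_iff intro: C0_functional_fubini[OF lc])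
    qed
    show "d a \<in> carr ?A" for a
      by (auto simp: measure_algebra_def d_def C0_add C0_scale C0_le_supnorm intro!: exI[of _ 1])
    show "d b (s F a) = of_bool (a = b)" if "finite F" "a \<in> F" "b \<in> F" for F a b
      using that s[of F a] by (auto simp: d_def)
  qed (simp_all add: measure_algebra_def)
qed

theorem theorem4p5:
  assumes "locally_compact_space (euclidean :: 'g::{topological_ab_group_add, t2_space} topology)"
    and "locally_compact_space (euclidean :: 'h::{topological_ab_group_add, t2_space} topology)"
  shows "(contractive (bimeasure_algebra ::
              (('g \<Rightarrow> complex) \<Rightarrow> ('h \<Rightarrow> complex) \<Rightarrow> complex) calg)
          \<longleftrightarrow> contractive (measure_algebra :: (('g \<times> 'h \<Rightarrow> complex) \<Rightarrow> complex) calg))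
       \<and> (contractive (measure_algebra :: (('g \<times> 'h \<Rightarrow> complex) \<Rightarrow> complex) calg)
          \<longleftrightarrow> finite (UNIV :: 'g set) \<and> finite (UNIV :: 'h set))"
proof -
  have prod: "finite (UNIV :: ('g \<times> 'h) set) \<longleftrightarrow> finite (UNIV :: 'g set) \<and> finite (UNIV :: 'h set)"
    using finite_cartesian_product_iff[of "UNIV :: 'g set" "UNIV :: 'h set"] by simp
  have "locally_compact_space (euclidean :: ('g \<times> 'h) topology)"
    using assms by (simp add: locally_compact_space_prod_topology flip: euclidean_product_topology prod_topology_euclidean)
  then show ?thesis
    using measure_algebra_contractive_imp_finite[where 'a = "'g \<times> 'h"]
      measure_algebra_finite_contractive[where 'a = "'g \<times> 'h"]
      bimeasure_algebra_contractive_imp_finite[OF assms] bimeasure_algebra_finite_contractive[where 'a = 'g and 'b = 'h]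
    unfolding prod by blast
qed

end
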